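(* Let $d\ge 1$ be an integer. There exists a constant $C>0$ (depending only on $d$) such that for every $t\ge 0$ and every $0<\varepsilon<1$ there exist a positive integer $n\le \lceil C t^2/\varepsilon\rceil$ (that is, $n=O(t^2/\varepsilon)$) and a quantum channel $\Lambda$, mapping operators on $\mathcal{H}_S\otimes(\mathcal{H}_P\otimes\mathcal{H}_Q)^{\otimes n}$ to operators on $\mathcal{H}_S$, where $\mathcal{H}_S,\mathcal{H}_P,\mathcal{H}_Q$ are copies of $\mathbb{C}^d$, such that $\Lambda$ does not depend on the Lindblad operator $L$ and the following holds. For every linear operator $L$ on $\mathbb{C}^d$ with $\|L\|_2=1$, let $|\psi\rangle=(L\otimes I)|\Gamma\rangle\in\mathcal{H}_P\otimes\mathcal{H}_Q$ be the program state vector encoding $L$, let $\psi=|\psi\rangle\langle\psi|$, and let $\mathcal{L}(\rho)=L\rho L^\dagger-\frac12\{L^\dagger L,\rho\}$. Then the channel $\mathcal{A}$ on $\mathcal{H}_S$ defined by $\mathcal{A}(\rho)=\Lambda(\rho\otimes\psi^{\otimes n})$ satisfies $$\frac12\left\| e^{\mathcal{L}t}-\mathcal{A}\right\|_{\diamond}\le\varepsilon .$$ In other words, a quantum algorithm that is given $n=O(t^2/\varepsilon)$ copies of the program state $\psi$ can approximate the channel $e^{\mathcal{L}t}$ up to error $\varepsilon$ in normalized diamond distance.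
   Context: All Hilbert spaces are finite-dimensional. $|\Gamma\rangle=\sum_{j=1}^d|j\rangle\otimes|j\rangle$ is the unnormalized maximally entangled vector in $\mathbb{C}^d\otimes\mathbb{C}^d$, with respect to the standard orthonormal basis. $\|A\|_2=\sqrt{\operatorname{Tr}[A^\dagger A]}$ is the Hilbert--Schmidt norm, $\|A\|_1=\operatorname{Tr}[(A^\dagger A)^{1/2}]$ is the trace norm, and $\{A,B\}=AB+BA$. A quantum channel is a completely positive trace-preserving linear map. For a linear superoperator $\mathcal{L}$, $e^{\mathcal{L}t}=\sum_{k\ge0}\mathcal{L}^k t^k/k!$, where $\mathcal{L}^k$ is the $k$-fold composition. For channels $\mathcal{N},\mathcal{M}$ on $\mathcal{H}_S$, the diamond distance is $\|\mathcal{N}-\mathcal{M}\|_\diamond=\sup_{\rho}\|(\mathcal{I}_R\otimes\mathcal{N})(\rho)-(\mathcal{I}_R\otimes\mathcal{M})(\rho)\|_1$, where the supremum is over all finite-dimensional reference systems $R$ and all density operators $\rho$ on $\mathcal{H}_R\otimes\mathcal{H}_S$, and $\mathcal{I}_R$ is the identity channel. A quantum algorithm with access to $n$ copies of an unknown program state $\psi$ means a fixed quantum channel (independent of $\psi$) applied to the input state together with $\psi^{\otimes n}$.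
   Formalization: Positivity of n is required only for t > 0; at t = 0 the bound n ≤ ⌈Ct²/ε⌉ = 0 admits no positive integer, so there n = 0 copies are used. *)

theory Defs
  imports
    "Jordan_Normal_Form.Schur_Decomposition"
    "HOL-Library.Extended_Real"
begin

(* Operators on C^n are complex matrices in carrier_mat n n. The basis vector
   |i> (x) |a> of C^m (x) C^n has index i * n + a. *)

definition trace :: "complex mat \<Rightarrow> complex" where
  "trace A = (\<Sum>i<dim_row A. A $$ (i, i))"

definition kron :: "complex mat \<Rightarrow> complex mat \<Rightarrow> complex mat" where
  "kron A B = mat (dim_row A * dim_row B) (dim_col A * dim_col B)
     (\<lambda>(i, j). A $$ (i div dim_row B, j div dim_col B) * B $$ (i mod dim_row B, j mod dim_col B))"

definition kron_vec :: "complex vec \<Rightarrow> complex vec \<Rightarrow> complex vec" where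
  "kron_vec u v = vec (dim_vec u * dim_vec v) (\<lambda>i. u $ (i div dim_vec v) * v $ (i mod dim_vec v))"

primrec kron_pow :: "complex mat \<Rightarrow> nat \<Rightarrow> complex mat" where
  "kron_pow A 0 = 1\<^sub>m 1"
| "kron_pow A (Suc n) = kron A (kron_pow A n)"

(* 0 \<le> z for complex z means that z is real and nonnegative, so the condition
   below forces A to be Hermitian. *)
definition psd :: "nat \<Rightarrow> complex mat \<Rightarrow> bool" where
  "psd n A \<longleftrightarrow> A \<in> carrier_mat n n \<and> (\<forall>v\<in>carrier_vec n. 0 \<le> (A *\<^sub>v v) \<bullet>c v)"

definition density_operator :: "nat \<Rightarrow> complex mat \<Rightarrow> bool" where
  "density_operator n \<rho> \<longleftrightarrow> psd n \<rho> \<and> trace \<rho> = 1"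

(* The positive square root; meaningful for positive semidefinite A only. *)
definition psd_sqrt :: "complex mat \<Rightarrow> complex mat" where
  "psd_sqrt A = (THE B. psd (dim_row A) B \<and> B * B = A)"

definition trace_norm :: "complex mat \<Rightarrow> real" where
  "trace_norm A = Re (trace (psd_sqrt (mat_adjoint A * A)))"

definition hs_norm :: "complex mat \<Rightarrow> real" where
  "hs_norm A = sqrt (Re (trace (mat_adjoint A * A)))"

type_synonym superop = "complex mat \<Rightarrow> complex mat"

definition linear_superop :: "nat \<Rightarrow> nat \<Rightarrow> superop \<Rightarrow> bool" where
  "linear_superop m n \<Phi> \<longleftrightarrow>
     (\<forall>A\<in>carrier_mat m m. \<Phi> A \<in> carrier_mat n n) \<and>
     (\<forall>A\<in>carrier_mat m m. \<forall>B\<in>carrier_mat m m. \<Phi> (A + B) = \<Phi> A + \<Phi> B) \<and>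
     (\<forall>c. \<forall>A\<in>carrier_mat m m. \<Phi> (c \<cdot>\<^sub>m A) = c \<cdot>\<^sub>m \<Phi> A)"

(* (id_r (x) \<Phi>)(X), for \<Phi> taking m x m to n x n matrices: X is read as an r x r
   array of m x m blocks and \<Phi> is applied to every block. *)
definition block :: "nat \<Rightarrow> complex mat \<Rightarrow> nat \<Rightarrow> nat \<Rightarrow> complex mat" where
  "block m X i j = mat m m (\<lambda>(a, b). X $$ (i * m + a, j * m + b))"

definition ampliation :: "nat \<Rightarrow> nat \<Rightarrow> nat \<Rightarrow> superop \<Rightarrow> superop" where
  "ampliation r m n \<Phi> X = mat (r * n) (r * n)
     (\<lambda>(i, j). \<Phi> (block m X (i div n) (j div n)) $$ (i mod n, j mod n))"

lemma ampliation_kron: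
  assumes lin: "linear_superop m n \<Phi>" and A: "A \<in> carrier_mat r r" and B: "B \<in> carrier_mat m m"
  shows "ampliation r m n \<Phi> (kron A B) = kron A (\<Phi> B)"
proof -
  have PB: "\<Phi> B \<in> carrier_mat n n"
    using lin B by (auto simp: linear_superop_def)
  have idx: "i * m + a < r * m" if "i < r" "a < m" for i a
  proof -
    have "i * m + a < Suc i * m" using that by simp
    also have "\<dots> \<le> r * m" using that by (intro mult_le_mono1) simp
    finally show ?thesis .
  qed
  have blk: "block m (kron A B) i j = A $$ (i, j) \<cdot>\<^sub>m B" if "i < r" "j < r" for i j
    using that A B by (intro eq_matI) (auto simp: block_def kron_def idx)
  show ?thesis
  proof (rule eq_matI)
    fix i j
    assume "i < dim_row (kron A (\<Phi> B))" "j < dim_col (kron A (\<Phi> B))"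
    then have ij: "i < r * n" "j < r * n"
      using A PB by (auto simp: kron_def)
    then have "0 < n" by (cases n) auto
    then have div_mod: "i div n < r" "j div n < r" "i mod n < n" "j mod n < n"
      using ij by (auto simp: less_mult_imp_div_less)
    have "\<Phi> (block m (kron A B) (i div n) (j div n)) = A $$ (i div n, j div n) \<cdot>\<^sub>m \<Phi> B"
      using lin B div_mod by (simp add: blk linear_superop_def)
    moreover have "kron A (\<Phi> B) $$ (i, j) = A $$ (i div n, j div n) * \<Phi> B $$ (i mod n, j mod n)"
      using ij A PB by (simp add: kron_def carrier_matD[OF PB] carrier_matD[OF A])
    ultimately show "ampliation r m n \<Phi> (kron A B) $$ (i, j) = kron A (\<Phi> B) $$ (i, j)"
      using ij div_mod by (simp add: ampliation_def carrier_matD[OF PB])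
  qed (use A PB in \<open>auto simp: ampliation_def kron_def\<close>)
qed

definition completely_positive :: "nat \<Rightarrow> nat \<Rightarrow> superop \<Rightarrow> bool" where
  "completely_positive m n \<Phi> \<longleftrightarrow>
     (\<forall>r X. psd (r * m) X \<longrightarrow> psd (r * n) (ampliation r m n \<Phi> X))"

definition trace_preserving :: "nat \<Rightarrow> superop \<Rightarrow> bool" where
  "trace_preserving m \<Phi> \<longleftrightarrow> (\<forall>A\<in>carrier_mat m m. trace (\<Phi> A) = trace A)"

definition quantum_channel :: "nat \<Rightarrow> nat \<Rightarrow> superop \<Rightarrow> bool" where
  "quantum_channel m n \<Phi> \<longleftrightarrow>
     linear_superop m n \<Phi> \<and> completely_positive m n \<Phi> \<and> trace_preserving m \<Phi>"

(* The supremum is taken in the extended reals, where it exists without a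
   boundedness proof. *)
definition diamond_dist :: "nat \<Rightarrow> superop \<Rightarrow> superop \<Rightarrow> ereal" where
  "diamond_dist d N M =
     (SUP (r, \<rho>) \<in> {(r, \<rho>). 0 < r \<and> density_operator (r * d) \<rho>}.
        ereal (trace_norm (ampliation r d d N \<rho> - ampliation r d d M \<rho>)))"

definition anticommutator :: "complex mat \<Rightarrow> complex mat \<Rightarrow> complex mat" where
  "anticommutator A B = A * B + B * A"

definition lindbladian :: "complex mat \<Rightarrow> superop" where
  "lindbladian L \<rho> =
     L * \<rho> * mat_adjoint L - (1 / 2) \<cdot>\<^sub>m anticommutator (mat_adjoint L * L) \<rho>"

(* exp(t \<Phi>) for a linear \<Phi> on d x d matrices. The type of matrices of all sizes
   carries no topology, so the exponential series is summed entrywise. *)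
definition exp_superop :: "nat \<Rightarrow> superop \<Rightarrow> real \<Rightarrow> superop" where
  "exp_superop d \<Phi> t \<rho> =
     mat d d (\<lambda>(i, j). \<Sum>k. complex_of_real (t ^ k / fact k) * (\<Phi> ^^ k) \<rho> $$ (i, j))"

definition max_entangled :: "nat \<Rightarrow> complex vec" where
  "max_entangled d =
     finsum_vec TYPE(complex) (d * d) (\<lambda>j. kron_vec (unit_vec d j) (unit_vec d j)) {..<d}"

definition program_vec :: "nat \<Rightarrow> complex mat \<Rightarrow> complex vec" where
  "program_vec d L = kron L (1\<^sub>m d) *\<^sub>v max_entangled d"

definition ket_bra :: "complex vec \<Rightarrow> complex mat" where
  "ket_bra v = mat (dim_vec v) (dim_vec v) (\<lambda>(i, j). v $ i * conjugate (v $ j))"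

definition program_state :: "nat \<Rightarrow> complex mat \<Rightarrow> complex mat" where
  "program_state d L = ket_bra (program_vec d L)"

end

theory Submission
  imports Defs
begin

text \<open>
  Let \<open>K\<close> map \<open>\<phi> \<otimes> (L \<otimes> I)\<Gamma>\<close> to \<open>L \<phi>\<close>; it is a fixed operator on \<open>S \<otimes> P \<otimes> Q\<close> and \<open>K\<^sup>\<dagger>K\<close> is
  \<open>d\<close> times a projection. The channel with jump operator proportional to \<open>K\<close> and no-jump operator
  \<open>I - (h/2) K\<^sup>\<dagger>K\<close>, followed by tracing out one program copy, maps \<open>\<rho> \<otimes> \<psi>\<close> to exactly
  \<open>\<rho> + h \<L>(\<rho>) + h\<^sup>2 R(\<rho>)\<close> with \<open>R(\<rho>) = (Tr(L\<rho>L\<^sup>\<dagger>) I - d L\<rho>L\<^sup>\<dagger>) / 4\<close>. Composing \<open>n\<close> such steps with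
  \<open>h = t/n\<close> costs \<open>n\<close> copies.

  For the error, a step of size \<open>h\<close> differs from \<open>m\<close> steps of size \<open>h/m\<close> by \<open>O(h\<^sup>2)\<close>, uniformly in \<open>m\<close>.
  Since all steps are channels these differences add up to \<open>O(n h\<^sup>2) = O(t\<^sup>2/n)\<close>, and for \<open>m \<rightarrow> \<infinity>\<close> the refined
  evolution converges to \<open>e\<^bsup>\<L>t\<^esup>\<close>; contractivity of \<open>e\<^bsup>\<L>t\<^esup>\<close> itself is never needed.

  Diamond-norm bounds come from writing superoperators as differences \<open>T\<^sub>1 - T\<^sub>2\<close> of completely positive
  maps with \<open>Tr T\<^sub>1(X) + Tr T\<^sub>2(X) \<le> K Tr X\<close> on positive \<open>X\<close>: such a bound survives ampliation, sums and
  compositions, and it dominates the trace norm of \<open>T\<^sub>1(\<rho>) - T\<^sub>2(\<rho>)\<close>.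
\<close>

section \<open>Positive semidefinite matrices\<close>

text \<open>On the program state, \<open>K\<^sup>\<dagger>K\<close> gives sum_b |b> (x) L phi (x)
  |b>, whose overlap with psi on the program register is L^dagger L phi. Tracing that register out
  turns the cross terms of the no-jump operator into the anticommutator and its square into a
  multiple of I, while norm 1 of L keeps the zeroth-order term equal to rho. A square root as
  no-jump operator would also preserve the trace; the polynomial is chosen because it keeps R free
  of h, so one pair of generator and remainder describes steps of every size and a step can be
  compared with its own refinement. Two definitions shape the rest. The trace norm is a definite
  description of a square root, so bounding it takes a diagonalization and uniqueness of the root;
  this is done once, for a limit of differences of positive matrices. The exponential is an
  entrywise series with no positivity at hand, so it enters only as an entrywise limit of channels.
  All constants come from |L_ab| <= 1 and are crude in d, on which C may depend.\<close>

lemma mat_adjoint_carrier [simp]: "A \<in> carrier_mat m n \<Longrightarrow> mat_adjoint A \<in> carrier_mat n m"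
  using mat_of_rows_carrier(1)[of "dim_row A" "map conjugate (cols A)"]
  by (metis mat_adjoint_def length_map cols_length carrier_matD)

lemma mat_adjoint_index:
  fixes A :: "complex mat"
  assumes "A \<in> carrier_mat m n" "i < n" "j < m"
  shows "mat_adjoint A $$ (i, j) = cnj (A $$ (j, i))"
  using assms carrier_matD[OF assms(1)] by (simp add: mat_adjoint_def mat_of_rows_def)

lemma mat_mult_index:
  assumes "A \<in> carrier_mat m n" "B \<in> carrier_mat n k" "i < m" "j < k"
  shows "(A * B) $$ (i, j) = (\<Sum>l<n. A $$ (i, l) * B $$ (l, j))"
  using assms by (auto simp: scalar_prod_def atLeast0LessThan intro!: sum.cong)

lemma trace_carrier: "A \<in> carrier_mat n n \<Longrightarrow> trace A = (\<Sum>i<n. A $$ (i, i))"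
  by (auto simp: trace_def)

lemma quadratic_form:
  assumes "A \<in> carrier_mat n n" "v \<in> carrier_vec n"
  shows "(A *\<^sub>v v) \<bullet>c v = (\<Sum>i<n. \<Sum>j<n. A $$ (i, j) * v $ j * cnj (v $ i))"
  using assms
  by (auto simp: scalar_prod_def atLeast0LessThan sum_distrib_right intro!: sum.cong)

text \<open>Test vectors become arbitrary functions on indices, so they can be given by lambda terms
  and no carrier condition has to be carried along.\<close>

lemma psd_iff:
  "psd n A \<longleftrightarrow> A \<in> carrier_mat n n \<and>
     (\<forall>f. 0 \<le> (\<Sum>i<n. \<Sum>j<n. A $$ (i, j) * f j * cnj (f i)))"
proof (intro iffI conjI allI)
  assume A: "psd n A"
  then show c: "A \<in> carrier_mat n n" by (simp add: psd_def)
  fix f :: "nat \<Rightarrow> complex"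
  have "0 \<le> (A *\<^sub>v vec n f) \<bullet>c vec n f" using A by (simp add: psd_def)
  then show "0 \<le> (\<Sum>i<n. \<Sum>j<n. A $$ (i, j) * f j * cnj (f i))"
    by (subst (asm) quadratic_form[OF c]) auto
next
  assume "A \<in> carrier_mat n n \<and>
     (\<forall>f. 0 \<le> (\<Sum>i<n. \<Sum>j<n. A $$ (i, j) * f j * cnj (f i)))"
  then show "psd n A" by (auto simp: psd_def quadratic_form)
qed

lemma psd_carrier: "psd n A \<Longrightarrow> A \<in> carrier_mat n n"
  by (simp add: psd_def)

lemma psd_form_nonneg:
  "psd n A \<Longrightarrow> 0 \<le> (\<Sum>i<n. \<Sum>j<n. A $$ (i, j) * f j * cnj (f i))"
  by (simp add: psd_iff)

lemma psd_add: "psd n A \<Longrightarrow> psd n B \<Longrightarrow> psd n (A + B)"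
  by (auto simp: psd_iff distrib_right sum.distrib)

lemma psd_smult:
  assumes "0 \<le> (c::real)" "psd n A" shows "psd n (complex_of_real c \<cdot>\<^sub>m A)"
proof -
  have "0 \<le> complex_of_real c * (\<Sum>i<n. \<Sum>j<n. A $$ (i, j) * f j * cnj (f i))" for f
    using assms(1) psd_form_nonneg[OF assms(2), of f]
    by (intro mult_nonneg_nonneg) (auto simp: less_eq_complex_def)
  then show ?thesis using assms(2)
    by (auto simp: psd_iff sum_distrib_left mult.assoc)
qed

text \<open>The quadratic form at e_i + c e_j. The choices c = 1, c = i and c a suitable phase yield
  all the off-diagonal information used below.\<close>

lemma psd_form_two:
  assumes A: "psd n A" and "i < n" "j < n" "i \<noteq> j"
  shows "0 \<le> A $$ (i, i) + A $$ (i, j) * c + A $$ (j, i) * cnj c + A $$ (j, j) * (c * cnj c)"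
proof -
  let ?f = "\<lambda>k. (if k = i then 1 else 0) + (if k = j then c else 0)"
  have 1: "(\<Sum>b<n. A $$ (a, b) * ?f b * cnj (?f a)) = (A $$ (a, i) + A $$ (a, j) * c) * cnj (?f a)" for a
    using assms(2-3) unfolding sum_distrib_right[symmetric]
    by (simp add: distrib_left sum.distrib if_distrib[of "\<lambda>x. _ * x"] cong: if_cong)
  have "(\<Sum>a<n. \<Sum>b<n. A $$ (a, b) * ?f b * cnj (?f a))
    = (\<Sum>a<n. (A $$ (a, i) + A $$ (a, j) * c) * (if a = i then 1 else 0)
        + (A $$ (a, i) + A $$ (a, j) * c) * (if a = j then cnj c else 0))"
    unfolding 1 by (intro sum.cong refl) (simp add: distrib_left)
  also have "\<dots> = A $$ (i, i) + A $$ (i, j) * c + (A $$ (j, i) + A $$ (j, j) * c) * cnj c"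
    using assms(2-3) by (simp add: sum.distrib if_distrib[of "\<lambda>x. _ * x"] cong: if_cong)
  also have "\<dots> = A $$ (i, i) + A $$ (i, j) * c + A $$ (j, i) * cnj c + A $$ (j, j) * (c * cnj c)"
    by (simp add: distrib_right)
  finally have form: "(\<Sum>a<n. \<Sum>b<n. A $$ (a, b) * ?f b * cnj (?f a)) =
    A $$ (i, i) + A $$ (i, j) * c + A $$ (j, i) * cnj c + A $$ (j, j) * (c * cnj c)" .
  from psd_form_nonneg[OF A, of ?f, unfolded form] show ?thesis .
qed

lemma psd_diag_nonneg:
  assumes A: "psd n A" and "i < n" shows "0 \<le> A $$ (i, i)"
proof -
  let ?f = "\<lambda>k. (if k = i then 1 else 0)"
  have "(\<Sum>b<n. A $$ (a, b) * ?f b * cnj (?f a)) = (if a = i then A $$ (i, i) else 0)" for a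
    using assms(2) by (cases "a = i") (simp_all add: if_distrib[of "\<lambda>x. _ * x"] cong: if_cong)
  note inner = this
  have "(\<Sum>a<n. \<Sum>b<n. A $$ (a, b) * ?f b * cnj (?f a)) = A $$ (i, i)"
    unfolding inner using assms(2) by simp
  from psd_form_nonneg[OF A, of ?f, unfolded this] show ?thesis .
qed

lemma psd_hermitian:
  assumes A: "psd n A" and "i < n" "j < n"
  shows "A $$ (j, i) = cnj (A $$ (i, j))"
proof (cases "i = j")
  case True
  then show ?thesis using psd_diag_nonneg[OF A assms(2)]
    by (simp add: complex_eq_iff less_eq_complex_def)
next
  case False
  \<comment> \<open>\<open>0 \<le> z\<close> includes Im z = 0. As the diagonal is real, c = 1 makes
    the imaginary parts of the two off-diagonal entries opposite and c = i makes their real parts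
    equal.\<close>
  show ?thesis
    using psd_form_two[OF A assms(2,3) False, of 1] psd_form_two[OF A assms(2,3) False, of \<i>]
      psd_diag_nonneg[OF A assms(2)] psd_diag_nonneg[OF A assms(3)]
    by (simp add: complex_eq_iff less_eq_complex_def)
qed

lemma psd_trace_nonneg: "psd n A \<Longrightarrow> 0 \<le> trace A"
  by (auto simp: trace_carrier[OF psd_carrier] intro!: sum_nonneg psd_diag_nonneg)

lemma psd_norm_index_le_trace:
  assumes A: "psd n A" and "i < n" "j < n"
  shows "norm (A $$ (i, j)) \<le> Re (trace A)"
proof -
  have nn: "0 \<le> Re (A $$ (k, k))" if "k < n" for k
    using psd_diag_nonneg[OF A that] by (simp add: less_eq_complex_def)
  have tr: "Re (trace A) = (\<Sum>k<n. Re (A $$ (k, k)))"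
    by (simp add: trace_carrier[OF psd_carrier[OF A]])
  have d: "Re (A $$ (k, k)) \<le> Re (trace A)" if "k < n" for k
    unfolding tr using that nn by (intro member_le_sum) auto
  show ?thesis
  proof (cases "i = j")
    case True
    have "A $$ (i, i) = of_real (Re (A $$ (i, i)))"
      using psd_diag_nonneg[OF A assms(2)] by (simp add: complex_eq_iff less_eq_complex_def)
    then have "norm (A $$ (i, i)) = Re (A $$ (i, i))"
      using nn[OF assms(2)] by (metis norm_of_real abs_of_nonneg)
    then show ?thesis using d[OF assms(2)] True by simp
  next
    case False
    show ?thesis
    proof (cases "A $$ (i, j) = 0")
      case True
      have "0 \<le> Re (trace A)" unfolding tr by (intro sum_nonneg) (use nn in auto)
      then show ?thesis using True by simp
    next
      case z: False
      let ?z = "A $$ (i, j)"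
      \<comment> \<open>This phase turns each off-diagonal term into -|z|, so 2|z| is at most the
        sum of two diagonal entries, each at most the trace.\<close>
      let ?c = "- cnj ?z / of_real (norm ?z)"
      have sq: "?z * cnj ?z = of_real (norm ?z) * of_real (norm ?z)"
        by (simp add: complex_norm_square[symmetric] power2_eq_square)
      have 1: "?z * ?c = - of_real (norm ?z)" "cnj ?z * cnj ?c = - of_real (norm ?z)" "?c * cnj ?c = 1"
        using z sq by (simp_all add: field_simps)
      have "0 \<le> A $$ (i, i) + ?z * ?c + A $$ (j, i) * cnj ?c + A $$ (j, j) * (?c * cnj ?c)"
        by (rule psd_form_two[OF A assms(2,3) False])
      then have "0 \<le> Re (A $$ (i, i) - of_real (norm ?z) - of_real (norm ?z) + A $$ (j, j))"
        unfolding psd_hermitian[OF A assms(2,3)] 1 by (simp add: less_eq_complex_def)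
      then show ?thesis using d[OF assms(2)] d[OF assms(3)] by simp
    qed
  qed
qed

section \<open>Spectral theorem and the trace norm\<close>

definition hermitian :: "nat \<Rightarrow> complex mat \<Rightarrow> bool" where
  "hermitian n A \<longleftrightarrow> A \<in> carrier_mat n n \<and> (\<forall>i<n. \<forall>j<n. cnj (A $$ (i, j)) = A $$ (j, i))"

text \<open>Gram-Schmidt keeps the first vector of a basis extending v. Only normalization is left,
  which is why the first column is a multiple of v.\<close>

lemma unitary_with_first_column:
  assumes v: "(v::complex vec) \<in> carrier_vec (Suc n)" "v \<noteq> 0\<^sub>v (Suc n)"
  obtains W c where "W \<in> carrier_mat (Suc n) (Suc n)"
    "\<And>j k. j < Suc n \<Longrightarrow> k < Suc n \<Longrightarrow>
       (\<Sum>i<Suc n. cnj (W $$ (i, j)) * W $$ (i, k)) = (if j = k then 1 else 0)"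
    "\<And>i. i < Suc n \<Longrightarrow> W $$ (i, 0) = c * v $ i"
proof -
  interpret cof_vec_space "Suc n" "TYPE(complex)" .
  define b where "b = basis_completion v"
  from basis_completion[OF v, folded b_def]
  have dist_b: "distinct b" and indep: "\<not> lin_dep (set b)" and b: "set b \<subseteq> carrier_vec (Suc n)"
    and hdb: "hd b = v" and len_b: "length b = Suc n" by auto
  from hdb len_b obtain vs where bv: "b = v # vs" by (cases b) auto
  define ws where "ws = gram_schmidt (Suc n) b"
  from gram_schmidt_result[OF b dist_b indep refl, folded ws_def]
  have ws: "set ws \<subseteq> carrier_vec (Suc n)" "corthogonal ws" "length ws = Suc n"
    by (auto simp: len_b)
  have "hd ws = v" using gram_schmidt_hd[OF v(1), of vs, folded bv] by (simp add: ws_def)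
  with ws(3) have ws0: "ws ! 0 = v" by (cases ws) auto
  define N where "N j = sqrt (\<Sum>i<Suc n. (cmod (ws ! j $ i))\<^sup>2)" for j
  have wc: "ws ! j \<in> carrier_vec (Suc n)" if "j < Suc n" for j
    using ws that by (auto dest!: nth_mem)
  have ip: "(\<Sum>i<Suc n. ws ! k $ i * cnj (ws ! j $ i)) = (if j = k then of_real ((N j)\<^sup>2) else 0)"
    if "j < Suc n" "k < Suc n" for j k
  proof (cases "j = k")
    case True
    have "(N j)\<^sup>2 = (\<Sum>i<Suc n. (cmod (ws ! j $ i))\<^sup>2)"
      unfolding N_def by (intro real_sqrt_pow2 sum_nonneg) simp
    then show ?thesis using True by (simp only: complex_norm_square of_real_sum if_True simp_thms)
  next
    case False
    have "ws ! k \<bullet>c ws ! j = 0" using corthogonalD[OF ws(2), of k j] that ws(3) False by auto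
    then show ?thesis using False wc[OF that(1)] wc[OF that(2)]
      by (simp add: scalar_prod_def atLeast0LessThan del: sum.lessThan_Suc)
  qed
  have N0: "N j \<noteq> 0" if "j < Suc n" for j
  proof
    assume "N j = 0"
    then have "ws ! j \<bullet>c ws ! j = 0" using ip[OF that that] wc[OF that]
      by (simp add: scalar_prod_def atLeast0LessThan del: sum.lessThan_Suc)
    then show False using corthogonalD[OF ws(2), of j j] that ws(3) by auto
  qed
  define W where "W = mat (Suc n) (Suc n) (\<lambda>(i, j). ws ! j $ i / of_real (N j))"
  show ?thesis
  proof
    show "W \<in> carrier_mat (Suc n) (Suc n)" by (simp add: W_def)
    show "W $$ (i, 0) = 1 / of_real (N 0) * v $ i" if "i < Suc n" for i
      using that by (simp add: W_def ws0)
    fix j k assume jk: "j < Suc n" "k < Suc n"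
    have "(\<Sum>i<Suc n. cnj (W $$ (i, j)) * W $$ (i, k))
      = (\<Sum>i<Suc n. ws ! k $ i * cnj (ws ! j $ i)) / (of_real (N j) * of_real (N k))"
      unfolding sum_divide_distrib using jk by (intro sum.cong refl) (simp add: W_def)
    also have "\<dots> = (if j = k then 1 else 0)"
      unfolding ip[OF jk] using N0[OF jk(1)] N0[OF jk(2)] by (auto simp: power2_eq_square)
    finally show "(\<Sum>i<Suc n. cnj (W $$ (i, j)) * W $$ (i, k)) = (if j = k then 1 else 0)" .
  qed
qed


lemma mat_adjoint_unitary_inverse:
  assumes W: "W \<in> carrier_mat n n"
    and orth: "\<And>j k. j < n \<Longrightarrow> k < n \<Longrightarrow> (\<Sum>i<n. cnj (W $$ (i, j)) * W $$ (i, k)) = (if j = k then 1 else 0)"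
  shows "mat_adjoint W * W = 1\<^sub>m n" "W * mat_adjoint W = 1\<^sub>m n"
proof -
  note Wa = mat_adjoint_carrier[OF W]
  show 1: "mat_adjoint W * W = 1\<^sub>m n"
  proof (rule eq_matI)
    fix i j assume "i < dim_row (1\<^sub>m n :: complex mat)" "j < dim_col (1\<^sub>m n :: complex mat)"
    then show "(mat_adjoint W * W) $$ (i, j) = 1\<^sub>m n $$ (i, j)"
      using orth[of i j] by (simp add: mat_mult_index[OF Wa W] mat_adjoint_index[OF W])
  qed (use W carrier_matD[OF Wa] in auto)
  show "W * mat_adjoint W = 1\<^sub>m n"
    by (rule mat_mult_left_right_inverse[OF Wa W 1])
qed

text \<open>Deflation: in a unitary basis starting with an eigenvector, a Hermitian matrix splits
  into a number and a Hermitian block one size smaller.\<close>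

lemma hermitian_diagonalization:
  assumes "hermitian n A"
  shows "\<exists>U l. U \<in> carrier_mat n n \<and>
    (\<forall>j<n. \<forall>k<n. (\<Sum>i<n. cnj (U $$ (i, j)) * U $$ (i, k)) = (if j = k then 1 else 0)) \<and>
    (\<forall>i<n. \<forall>k<n. (\<Sum>j<n. A $$ (i, j) * U $$ (j, k)) = complex_of_real (l k) * U $$ (i, k))"
  using assms
proof (induction n arbitrary: A)
  case 0
  then show ?case by (intro exI[of _ "1\<^sub>m 0"]) auto
next
  case (Suc n)
  let ?n = "Suc n"
  have A: "A \<in> carrier_mat ?n ?n" and herm: "\<And>i j. i < ?n \<Longrightarrow> j < ?n \<Longrightarrow> cnj (A $$ (i, j)) = A $$ (j, i)"
    using Suc.prems by (simp_all add: hermitian_def)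
  obtain as where "char_poly A = (\<Prod>a\<leftarrow>as. [:- a, 1:])" "length as = ?n"
    using char_poly_factorized[OF A] by blast
  then have "poly (char_poly A) (hd as) = 0" by (cases as) auto
  then have "eigenvalue A (hd as)" by (simp add: eigenvalue_root_char_poly[OF A])
  then obtain v e where v: "v \<in> carrier_vec ?n" "v \<noteq> 0\<^sub>v ?n" and ev: "A *\<^sub>v v = e \<cdot>\<^sub>v v"
    using A unfolding eigenvalue_def eigenvector_def by auto
  obtain W c where W: "W \<in> carrier_mat ?n ?n"
    and orth: "\<And>j k. j < ?n \<Longrightarrow> k < ?n \<Longrightarrow> (\<Sum>i<?n. cnj (W $$ (i, j)) * W $$ (i, k)) = (if j = k then 1 else 0)"
    and W0: "\<And>i. i < ?n \<Longrightarrow> W $$ (i, 0) = c * v $ i"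
    by (rule unitary_with_first_column[OF v]) blast
  note Wa = mat_adjoint_carrier[OF W]
  note WW = mat_adjoint_unitary_inverse[OF W orth]
  define B where "B = mat_adjoint W * (A * W)"
  have AW: "A * W \<in> carrier_mat ?n ?n" using A W by simp
  have B: "B \<in> carrier_mat ?n ?n" using Wa AW by (simp add: B_def)
  have Bidx: "B $$ (j, k) = (\<Sum>i<?n. \<Sum>l<?n. cnj (W $$ (i, j)) * A $$ (i, l) * W $$ (l, k))"
    if "j < ?n" "k < ?n" for j k
    using that by (simp add: B_def mat_mult_index[OF Wa AW] mat_mult_index[OF A W] mat_adjoint_index[OF W]
      sum_distrib_left mult.assoc del: sum.lessThan_Suc)
  have Bherm: "B $$ (k, j) = cnj (B $$ (j, k))" if "j < ?n" "k < ?n" for j k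
  proof -
    have "cnj (B $$ (j, k)) = (\<Sum>i<?n. \<Sum>l<?n. W $$ (i, j) * A $$ (l, i) * cnj (W $$ (l, k)))"
      unfolding Bidx[OF that] cnj_sum complex_cnj_mult complex_cnj_cnj
      by (intro sum.cong refl) (simp add: herm)
    also have "\<dots> = B $$ (k, j)"
      unfolding Bidx[OF that(2,1)] by (subst sum.swap) (simp add: mult_ac del: sum.lessThan_Suc)
    finally show ?thesis by simp
  qed
  have ev': "(\<Sum>l<?n. A $$ (i, l) * v $ l) = e * v $ i" if "i < ?n" for i
    using arg_cong[OF ev, of "\<lambda>w. w $ i"] that A v
    by (simp add: scalar_prod_def atLeast0LessThan del: sum.lessThan_Suc)
  have AW0: "(A * W) $$ (i, 0) = e * W $$ (i, 0)" if "i < ?n" for i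
  proof -
    have "(A * W) $$ (i, 0) = c * (\<Sum>l<?n. A $$ (i, l) * v $ l)"
      using that by (simp add: mat_mult_index[OF A W] W0 sum_distrib_left mult_ac del: sum.lessThan_Suc)
    then show ?thesis using that by (simp add: ev' W0 del: sum.lessThan_Suc)
  qed
  have B0: "B $$ (j, 0) = (if j = 0 then e else 0)" if "j < ?n" for j
  proof -
    have "B $$ (j, 0) = e * (\<Sum>i<?n. cnj (W $$ (i, j)) * W $$ (i, 0))"
      using that by (simp add: B_def mat_mult_index[OF Wa AW] mat_adjoint_index[OF W] AW0
        sum_distrib_left mult_ac del: sum.lessThan_Suc)
    then show ?thesis using that by (simp add: orth del: sum.lessThan_Suc)
  qed
  have B0': "B $$ (0, j) = (if j = 0 then e else 0)" if "j < ?n" for j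
    using Bherm[of j 0] B0[OF that] B0[of 0] Bherm[of 0 0] that by auto
  \<comment> \<open>The eigenvalue has become a diagonal entry of the Hermitian matrix
    \<open>B\<close>.\<close>
  have e: "e = complex_of_real (Re e)"
    using Bherm[of 0 0] B0[of 0] by (simp add: complex_eq_iff)
  define B' where "B' = mat n n (\<lambda>(i, j). B $$ (Suc i, Suc j))"
  have "hermitian n B'" unfolding hermitian_def
  proof (intro conjI allI impI)
    show "B' \<in> carrier_mat n n" by (simp add: B'_def)
    fix i j assume "i < n" "j < n"
    then show "cnj (B' $$ (i, j)) = B' $$ (j, i)"
      using Bherm[of "Suc i" "Suc j"] by (simp add: B'_def)
  qed
  from Suc.IH[OF this] obtain U l where U: "U \<in> carrier_mat n n"
    and Uo: "\<And>j k. j < n \<Longrightarrow> k < n \<Longrightarrow> (\<Sum>i<n. cnj (U $$ (i, j)) * U $$ (i, k)) = (if j = k then 1 else 0)"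
    and Ue: "\<And>i k. i < n \<Longrightarrow> k < n \<Longrightarrow> (\<Sum>j<n. B' $$ (i, j) * U $$ (j, k)) = complex_of_real (l k) * U $$ (i, k)"
    by blast
  \<comment> \<open>The block sum of 1 and \<open>U\<close>; the columns of \<open>W * V\<close>
    will be the eigenvectors.\<close>
  define V where "V = mat ?n ?n (\<lambda>(i, k). if i = 0 \<or> k = 0 then (if i = k then 1 else 0) else U $$ (i - 1, k - 1))"
  define m where "m k = (if k = 0 then Re e else l (k - 1))" for k
  have V: "V \<in> carrier_mat ?n ?n" by (simp add: V_def)
  have Vo: "(\<Sum>i<?n. cnj (V $$ (i, j)) * V $$ (i, k)) = (if j = k then 1 else 0)" if "j < ?n" "k < ?n" for j k
    using that unfolding sum.lessThan_Suc_shift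
    by (cases j; cases k) (auto simp: V_def Uo)
  have VV: "mat_adjoint V * V = 1\<^sub>m ?n" by (rule mat_adjoint_unitary_inverse[OF V Vo])
  have Ue': "(\<Sum>j<n. B $$ (Suc i, Suc j) * U $$ (j, k)) = complex_of_real (l k) * U $$ (i, k)" if "i < n" "k < n" for i k
    using Ue[OF that] that by (simp add: B'_def)
  have Ve: "(B * V) $$ (i, k) = complex_of_real (m k) * V $$ (i, k)" if "i < ?n" "k < ?n" for i k
    using that unfolding mat_mult_index[OF B V that] sum.lessThan_Suc_shift
    by (cases i; cases k) (auto simp: V_def B0 B0' m_def Ue' e[symmetric])
  have WV: "W * V \<in> carrier_mat ?n ?n" using W V by simp
  have AWV: "A * (W * V) = W * (B * V)"
  proof -
    have "W * (B * V) = W * B * V"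
      by (rule assoc_mult_mat[OF W B V, symmetric])
    also have "W * B = W * mat_adjoint W * (A * W)"
      unfolding B_def by (rule assoc_mult_mat[OF W Wa AW, symmetric])
    also have "\<dots> = A * W" by (simp add: WW(2) left_mult_one_mat[OF AW])
    also have "A * W * V = A * (W * V)" by (rule assoc_mult_mat[OF A W V])
    finally show ?thesis ..
  qed
  show ?case
  proof (intro exI conjI allI impI)
    show "W * V \<in> carrier_mat ?n ?n" by fact
    fix j k assume jk: "j < ?n" "k < ?n"
    have BV: "B * V \<in> carrier_mat ?n ?n" using B V by simp
    show "(\<Sum>i<?n. A $$ (j, i) * (W * V) $$ (i, k)) = complex_of_real (m k) * (W * V) $$ (j, k)"
    proof -
      have "(\<Sum>i<?n. A $$ (j, i) * (W * V) $$ (i, k)) = (A * (W * V)) $$ (j, k)"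
        using mat_mult_index[OF A WV jk] by simp
      also have "\<dots> = (\<Sum>i<?n. W $$ (j, i) * (complex_of_real (m k) * V $$ (i, k)))"
        unfolding AWV mat_mult_index[OF W BV jk] using jk by (intro sum.cong refl) (simp add: Ve)
      also have "\<dots> = complex_of_real (m k) * (W * V) $$ (j, k)"
        unfolding mat_mult_index[OF W V jk] sum_distrib_left by (simp add: mult_ac)
      finally show ?thesis .
    qed
    have "(\<Sum>i<?n. cnj ((W * V) $$ (i, j)) * (W * V) $$ (i, k))
       = (\<Sum>i<?n. \<Sum>a<?n. \<Sum>b<?n. cnj (V $$ (a, j)) * V $$ (b, k) * (cnj (W $$ (i, a)) * W $$ (i, b)))"
    proof (intro sum.cong refl)
      fix i assume "i \<in> {..<?n}"
      then have i: "i < ?n" by simp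
      show "cnj ((W * V) $$ (i, j)) * (W * V) $$ (i, k) =
        (\<Sum>a<?n. \<Sum>b<?n. cnj (V $$ (a, j)) * V $$ (b, k) * (cnj (W $$ (i, a)) * W $$ (i, b)))"
        unfolding mat_mult_index[OF W V i jk(1)] mat_mult_index[OF W V i jk(2)] cnj_sum sum_product
        by (intro sum.cong refl) simp
    qed
    also have "\<dots> = (\<Sum>a<?n. \<Sum>b<?n. \<Sum>i<?n. cnj (V $$ (a, j)) * V $$ (b, k) * (cnj (W $$ (i, a)) * W $$ (i, b)))"
      by (subst sum.swap, rule sum.cong[OF refl], subst sum.swap, rule refl)
    also have "\<dots> = (\<Sum>a<?n. \<Sum>b<?n. if a = b then cnj (V $$ (a, j)) * V $$ (b, k) else 0)"
      unfolding sum_distrib_left[symmetric] by (intro sum.cong refl) (simp add: orth del: sum.lessThan_Suc)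
    also have "\<dots> = (\<Sum>a<?n. cnj (V $$ (a, j)) * V $$ (a, k))"
      by (simp del: sum.lessThan_Suc)
    finally show "(\<Sum>i<?n. cnj ((W * V) $$ (i, j)) * (W * V) $$ (i, k)) = (if j = k then 1 else 0)"
      using Vo[OF jk] by simp
  qed
qed

section \<open>Positive square roots and the trace norm of Hermitian matrices\<close>

definition qform :: "nat \<Rightarrow> complex mat \<Rightarrow> (nat \<Rightarrow> complex) \<Rightarrow> complex" where
  "qform n A f = (\<Sum>i<n. \<Sum>j<n. A $$ (i, j) * f j * cnj (f i))"

lemma qform_nonneg: "psd n A \<Longrightarrow> 0 \<le> qform n A f"
  by (simp add: qform_def psd_form_nonneg)

definition apply_mat :: "nat \<Rightarrow> complex mat \<Rightarrow> (nat \<Rightarrow> complex) \<Rightarrow> nat \<Rightarrow> complex" where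
  "apply_mat n A f i = (\<Sum>j<n. A $$ (i, j) * f j)"

lemma qform_apply_mat: "qform n A f = (\<Sum>i<n. apply_mat n A f i * cnj (f i))"
  by (simp add: qform_def apply_mat_def sum_distrib_right)

lemma hermitian_square_qform:
  assumes "hermitian n A"
  shows "qform n (A * A) f = (\<Sum>i<n. apply_mat n A f i * cnj (apply_mat n A f i))"
proof -
  have A: "A \<in> carrier_mat n n" and h: "\<And>i j. i < n \<Longrightarrow> j < n \<Longrightarrow> cnj (A $$ (i, j)) = A $$ (j, i)"
    using assms by (simp_all add: hermitian_def)
  have "qform n (A * A) f = (\<Sum>k<n. \<Sum>j<n. \<Sum>i<n. A $$ (i, j) * f j * (cnj (A $$ (i, k)) * cnj (f k)))"
    unfolding qform_def
    by (intro sum.cong refl) (simp add: mat_mult_index[OF A A] sum_distrib_right sum_distrib_left h mult_ac)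
  also have "\<dots> = (\<Sum>i<n. \<Sum>j<n. \<Sum>k<n. A $$ (i, j) * f j * (cnj (A $$ (i, k)) * cnj (f k)))"
    by (subst sum.swap, subst (2) sum.swap, subst sum.swap, rule refl)
  also have "\<dots> = (\<Sum>i<n. apply_mat n A f i * cnj (apply_mat n A f i))"
    by (simp add: apply_mat_def sum_product)
  finally show ?thesis .
qed

lemma psd_imp_hermitian: "psd n A \<Longrightarrow> hermitian n A"
  unfolding hermitian_def using psd_carrier psd_hermitian[of n A] by metis

text \<open>\<open>psd_sqrt\<close> is a definite description, so uniqueness is what gives it a
  value. For a unit eigenvector x of B - C with eigenvalue l, |Bx| = |Cx| expands to l(<Bx,x> +
  <Cx,x>) = 0. Both forms are nonnegative and differ by l, hence l = 0.\<close>

lemma psd_square_root_unique: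
  assumes B: "psd n B" and C: "psd n C" and eq: "B * B = C * C"
  shows "B = C"
proof -
  have Bc: "B \<in> carrier_mat n n" and Cc: "C \<in> carrier_mat n n"
    using B C by (auto dest: psd_carrier)
  have "hermitian n (B - C)"
    using psd_imp_hermitian[OF B] psd_imp_hermitian[OF C] Bc Cc by (auto simp: hermitian_def)
  from hermitian_diagonalization[OF this] obtain U l where U: "U \<in> carrier_mat n n"
    and Uo: "\<And>j k. j < n \<Longrightarrow> k < n \<Longrightarrow> (\<Sum>i<n. cnj (U $$ (i, j)) * U $$ (i, k)) = (if j = k then 1 else 0)"
    and Ue: "\<And>i k. i < n \<Longrightarrow> k < n \<Longrightarrow> (\<Sum>j<n. (B - C) $$ (i, j) * U $$ (j, k)) = complex_of_real (l k) * U $$ (i, k)"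
    by blast
  have l0: "l k = 0" if k: "k < n" for k
  proof -
    define x where "x i = U $$ (i, k)" for i
    have xx: "(\<Sum>i<n. x i * cnj (x i)) = 1"
      using Uo[OF k k] by (simp add: x_def mult.commute)
    have rel: "apply_mat n B x i = apply_mat n C x i + complex_of_real (l k) * x i" if "i < n" for i
    proof -
      have "apply_mat n B x i - apply_mat n C x i = (\<Sum>j<n. (B - C) $$ (i, j) * U $$ (j, k))"
        unfolding apply_mat_def sum_subtractf[symmetric] using that Bc Cc
        by (intro sum.cong refl) (simp add: x_def left_diff_distrib)
      then show ?thesis using Ue[OF that k] by (simp add: x_def algebra_simps)
    qed
    have "(\<Sum>i<n. apply_mat n B x i * cnj (apply_mat n B x i)) = (\<Sum>i<n. apply_mat n C x i * cnj (apply_mat n C x i))"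
      unfolding hermitian_square_qform[OF psd_imp_hermitian[OF B], symmetric]
        hermitian_square_qform[OF psd_imp_hermitian[OF C], symmetric] eq ..
    moreover have "(\<Sum>i<n. apply_mat n B x i * cnj (apply_mat n B x i)) =
      (\<Sum>i<n. apply_mat n C x i * cnj (apply_mat n C x i)) +
        complex_of_real (l k) * (qform n C x + cnj (qform n C x)) + complex_of_real ((l k)\<^sup>2) * (\<Sum>i<n. x i * cnj (x i))"
      unfolding qform_apply_mat cnj_sum sum_distrib_left sum.distrib[symmetric]
      by (intro sum.cong refl) (simp add: rel algebra_simps power2_eq_square)
    moreover have "qform n B x = qform n C x + complex_of_real (l k) * (\<Sum>i<n. x i * cnj (x i))"
      unfolding qform_apply_mat sum_distrib_left sum.distrib[symmetric]
      by (intro sum.cong refl) (simp add: rel algebra_simps)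
    then have qB: "qform n B x = qform n C x + complex_of_real (l k)"
      by (simp add: xx)
    moreover note xx
    ultimately have "complex_of_real (l k) * (qform n C x + cnj (qform n C x)) + complex_of_real ((l k)\<^sup>2) = 0"
      by (simp add: xx)
    then have "Re (complex_of_real (l k) * (qform n C x + cnj (qform n C x)) + complex_of_real ((l k)\<^sup>2)) = 0"
      by simp
    then have "l k * (2 * Re (qform n C x) + l k) = 0"
      by (simp add: algebra_simps power2_eq_square)
    moreover have "0 \<le> Re (qform n C x)" "0 \<le> Re (qform n B x)"
      using qform_nonneg[OF C] qform_nonneg[OF B] by (auto simp: less_eq_complex_def)
    moreover have "Re (qform n B x) = Re (qform n C x) + l k" using qB by simp
    ultimately show ?thesis by auto
  qed
  have "(B - C) * U = 0\<^sub>m n n"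
  proof (rule eq_matI)
    fix i j assume "i < dim_row (0\<^sub>m n n :: complex mat)" "j < dim_col (0\<^sub>m n n :: complex mat)"
    then have ij: "i < n" "j < n" by simp_all
    show "((B - C) * U) $$ (i, j) = 0\<^sub>m n n $$ (i, j)"
      using Ue[OF ij] l0[OF ij(2)] ij
      by (simp add: mat_mult_index[OF minus_carrier_mat[OF Cc] U ij] del: index_minus_mat)
  qed (use Bc Cc U in auto)
  then have "(B - C) * (U * mat_adjoint U) = 0\<^sub>m n n"
    using assoc_mult_mat[OF minus_carrier_mat[OF Cc] U mat_adjoint_carrier[OF U], of B] mat_adjoint_carrier[OF U] by simp
  then have BC: "B - C = 0\<^sub>m n n"
    using mat_adjoint_unitary_inverse(2)[OF U Uo] right_mult_one_mat[OF minus_carrier_mat[OF Cc]] by simp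
  show ?thesis
  proof (rule eq_matI)
    fix i j assume "i < dim_row C" "j < dim_col C"
    then show "B $$ (i, j) = C $$ (i, j)"
      using arg_cong[OF BC, of "\<lambda>M. M $$ (i, j)"] Bc Cc by simp
  qed (use Bc Cc in auto)
qed

text \<open>U diag(g) U^dagger.\<close>

definition spectral_mat :: "nat \<Rightarrow> complex mat \<Rightarrow> (nat \<Rightarrow> real) \<Rightarrow> complex mat" where
  "spectral_mat n U g = mat n n (\<lambda>(i, j). \<Sum>k<n. complex_of_real (g k) * U $$ (i, k) * cnj (U $$ (j, k)))"

lemma spectral_mat_mult:
  assumes Uo: "\<And>j k. j < n \<Longrightarrow> k < n \<Longrightarrow> (\<Sum>i<n. cnj (U $$ (i, j)) * U $$ (i, k)) = (if j = k then 1 else 0)"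
  shows "spectral_mat n U g * spectral_mat n U h = spectral_mat n U (\<lambda>k. g k * h k)"
proof (rule eq_matI)
  have c: "spectral_mat n U f \<in> carrier_mat n n" for f by (simp add: spectral_mat_def)
  fix i j assume "i < dim_row (spectral_mat n U (\<lambda>k. g k * h k))" "j < dim_col (spectral_mat n U (\<lambda>k. g k * h k))"
  then have ij: "i < n" "j < n" by (simp_all add: spectral_mat_def)
  have "(spectral_mat n U g * spectral_mat n U h) $$ (i, j) =
    (\<Sum>m<n. \<Sum>k<n. \<Sum>k'<n. complex_of_real (g k) * complex_of_real (h k') * U $$ (i, k) * cnj (U $$ (j, k')) * (cnj (U $$ (m, k)) * U $$ (m, k')))"
    unfolding mat_mult_index[OF c c ij]
    by (intro sum.cong refl) (simp add: spectral_mat_def ij sum_product mult_ac)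
  also have "\<dots> = (\<Sum>k<n. \<Sum>k'<n. \<Sum>m<n. complex_of_real (g k) * complex_of_real (h k') * U $$ (i, k) * cnj (U $$ (j, k')) * (cnj (U $$ (m, k)) * U $$ (m, k')))"
    by (subst sum.swap, rule sum.cong[OF refl], subst sum.swap, rule refl)
  also have "\<dots> = (\<Sum>k<n. \<Sum>k'<n. if k = k' then complex_of_real (g k) * complex_of_real (h k') * U $$ (i, k) * cnj (U $$ (j, k')) else 0)"
    unfolding sum_distrib_left[symmetric] by (intro sum.cong refl) (simp add: Uo)
  also have "\<dots> = spectral_mat n U (\<lambda>k. g k * h k) $$ (i, j)"
    using ij by (simp add: spectral_mat_def)
  finally show "(spectral_mat n U g * spectral_mat n U h) $$ (i, j) = spectral_mat n U (\<lambda>k. g k * h k) $$ (i, j)" .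
qed (simp_all add: spectral_mat_def)

lemma psd_spectral_mat:
  assumes "\<And>k. 0 \<le> g k" shows "psd n (spectral_mat n U g)"
  unfolding psd_iff
proof (intro conjI allI)
  show "spectral_mat n U g \<in> carrier_mat n n" by (simp add: spectral_mat_def)
  fix f :: "nat \<Rightarrow> complex"
  let ?y = "\<lambda>k. \<Sum>j<n. cnj (U $$ (j, k)) * f j"
  have "(\<Sum>i<n. \<Sum>j<n. spectral_mat n U g $$ (i, j) * f j * cnj (f i)) =
    (\<Sum>i<n. \<Sum>j<n. \<Sum>k<n. complex_of_real (g k) * (cnj (U $$ (j, k)) * f j * (U $$ (i, k) * cnj (f i))))"
    by (intro sum.cong refl) (simp add: spectral_mat_def sum_distrib_right sum_distrib_left mult_ac)
  also have "\<dots> = (\<Sum>k<n. \<Sum>j<n. \<Sum>i<n. complex_of_real (g k) * (cnj (U $$ (j, k)) * f j * (U $$ (i, k) * cnj (f i))))"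
    by (subst sum.swap, subst (2) sum.swap, subst sum.swap, rule refl)
  also have "\<dots> = (\<Sum>k<n. complex_of_real (g k) * (?y k * cnj (?y k)))"
    by (simp only: cnj_sum sum_product, simp add: sum_distrib_left)
  also have "\<dots> = (\<Sum>k<n. complex_of_real (g k * (cmod (?y k))\<^sup>2))"
    by (simp only: complex_norm_square of_real_mult)
  also have "0 \<le> \<dots>"
    using assms by (intro sum_nonneg) (simp add: less_eq_complex_def del: of_real_mult)
  finally show "0 \<le> (\<Sum>i<n. \<Sum>j<n. spectral_mat n U g $$ (i, j) * f j * cnj (f i))" .
qed

text \<open>For Hermitian X the matrix X^dagger X is X^2, whose positive root is U diag(|l|)
  U^dagger. The eigenvalues are returned as values of the quadratic form because these are linear in
  X and so pass to limits; orthonormality is returned for the rows of U, the form in which traces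
  are computed.\<close>

lemma hermitian_trace_norm:
  assumes X: "hermitian n X"
  obtains U l where "U \<in> carrier_mat n n"
    "\<And>j k. j < n \<Longrightarrow> k < n \<Longrightarrow> (\<Sum>i<n. U $$ (j, i) * cnj (U $$ (k, i))) = (if j = k then 1 else 0)"
    "\<And>k. k < n \<Longrightarrow> complex_of_real (l k) = qform n X (\<lambda>i. U $$ (i, k))"
    "trace_norm X = (\<Sum>k<n. \<bar>l k\<bar>)"
proof -
  have Xc: "X \<in> carrier_mat n n" using X by (simp add: hermitian_def)
  from hermitian_diagonalization[OF X] obtain U l where U: "U \<in> carrier_mat n n"
    and Uo: "\<And>j k. j < n \<Longrightarrow> k < n \<Longrightarrow> (\<Sum>i<n. cnj (U $$ (i, j)) * U $$ (i, k)) = (if j = k then 1 else 0)"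
    and Ue: "\<And>i k. i < n \<Longrightarrow> k < n \<Longrightarrow> (\<Sum>j<n. X $$ (i, j) * U $$ (j, k)) = complex_of_real (l k) * U $$ (i, k)"
    by blast
  have Uo': "(\<Sum>i<n. U $$ (j, i) * cnj (U $$ (k, i))) = (if j = k then 1 else 0)" if "j < n" "k < n" for j k
    using arg_cong[OF mat_adjoint_unitary_inverse(2)[OF U Uo], of "\<lambda>M. M $$ (j, k)"] that
    by (simp add: mat_mult_index[OF U mat_adjoint_carrier[OF U]] mat_adjoint_index[OF U] del: index_mult_mat)
  have Xl: "X = spectral_mat n U l"
  proof (rule eq_matI)
    fix i j assume "i < dim_row (spectral_mat n U l)" "j < dim_col (spectral_mat n U l)"
    then have ij: "i < n" "j < n" by (simp_all add: spectral_mat_def)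
    have "spectral_mat n U l $$ (i, j) = (\<Sum>k<n. (\<Sum>m<n. X $$ (i, m) * U $$ (m, k)) * cnj (U $$ (j, k)))"
      using ij by (simp add: spectral_mat_def Ue)
    also have "\<dots> = (\<Sum>m<n. X $$ (i, m) * (\<Sum>k<n. U $$ (m, k) * cnj (U $$ (j, k))))"
      unfolding sum_distrib_left sum_distrib_right by (subst sum.swap) (simp add: mult.assoc)
    also have "\<dots> = (\<Sum>m<n. if m = j then X $$ (i, m) else 0)"
      using ij by (intro sum.cong refl) (simp add: Uo')
    also have "\<dots> = X $$ (i, j)" using ij by simp
    finally show "X $$ (i, j) = spectral_mat n U l $$ (i, j)" ..
  qed (use Xc in \<open>auto simp: spectral_mat_def\<close>)
  have "mat_adjoint X = X"
  proof (rule eq_matI)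
    fix i j assume "i < dim_row X" "j < dim_col X"
    then show "mat_adjoint X $$ (i, j) = X $$ (i, j)"
      using X Xc by (simp add: mat_adjoint_index[OF Xc] hermitian_def)
  qed (use Xc carrier_matD[OF mat_adjoint_carrier[OF Xc]] in auto)
  let ?S = "spectral_mat n U (\<lambda>k. \<bar>l k\<bar>)"
  have "psd_sqrt (mat_adjoint X * X) = ?S"
    unfolding psd_sqrt_def
  proof (rule the_equality)
    have d: "dim_row (mat_adjoint X * X) = n" using carrier_matD[OF mat_adjoint_carrier[OF Xc]] by simp
    have sq: "?S * ?S = mat_adjoint X * X"
      unfolding \<open>mat_adjoint X = X\<close> using spectral_mat_mult[of n U, OF Uo] Xl by simp
    have S: "psd n ?S" by (rule psd_spectral_mat) simp
    show "psd (dim_row (mat_adjoint X * X)) ?S \<and> ?S * ?S = mat_adjoint X * X"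
      unfolding d by (rule conjI[OF S sq])
    fix B assume "psd (dim_row (mat_adjoint X * X)) B \<and> B * B = mat_adjoint X * X"
    then have B: "psd n B" "B * B = mat_adjoint X * X" unfolding d by (rule conjunct1, rule conjunct2)
    show "B = ?S" by (rule psd_square_root_unique[OF B(1) S]) (rule B(2)[folded sq])
  qed
  then have "trace_norm X = Re (\<Sum>i<n. \<Sum>k<n. complex_of_real \<bar>l k\<bar> * U $$ (i, k) * cnj (U $$ (i, k)))"
    by (simp add: trace_norm_def trace_def spectral_mat_def)
  also have "(\<Sum>i<n. \<Sum>k<n. complex_of_real \<bar>l k\<bar> * U $$ (i, k) * cnj (U $$ (i, k))) =
    (\<Sum>k<n. complex_of_real \<bar>l k\<bar> * (\<Sum>i<n. cnj (U $$ (i, k)) * U $$ (i, k)))"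
    by (subst sum.swap) (simp add: sum_distrib_left mult_ac)
  also have "\<dots> = complex_of_real (\<Sum>k<n. \<bar>l k\<bar>)" by (simp add: Uo)
  finally have tn: "trace_norm X = (\<Sum>k<n. \<bar>l k\<bar>)" by simp
  have q: "complex_of_real (l k) = qform n X (\<lambda>i. U $$ (i, k))" if "k < n" for k
  proof -
    have "qform n X (\<lambda>i. U $$ (i, k)) = (\<Sum>i<n. complex_of_real (l k) * (cnj (U $$ (i, k)) * U $$ (i, k)))"
      unfolding qform_apply_mat apply_mat_def using that by (intro sum.cong refl) (simp add: Ue)
    then show ?thesis using that unfolding sum_distrib_left[symmetric] by (simp add: Uo)
  qed
  show ?thesis using that[OF U Uo' q tn] .
qed

text \<open>All forms are evaluated in the fixed eigenbasis of the limit X, where |p - q| <= p + q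
  for p, q >= 0 bounds the sum of the |l_k| by traces. Only the differences P m - Q m are assumed to
  converge, not P m and Q m themselves.\<close>

lemma trace_norm_le_limit:
  assumes X: "X \<in> carrier_mat n n"
    and P: "\<And>m. psd n (P m)" and Q: "\<And>m. psd n (Q m)"
    and lim: "\<And>i j. i < n \<Longrightarrow> j < n \<Longrightarrow> (\<lambda>m. P m $$ (i, j) - Q m $$ (i, j)) \<longlonglongrightarrow> X $$ (i, j)"
    and K: "\<And>m. Re (trace (P m)) + Re (trace (Q m)) \<le> K m" and Klim: "K \<longlonglongrightarrow> c"
  shows "trace_norm X \<le> c"
proof -
  have "hermitian n X" unfolding hermitian_def
  proof (intro conjI allI impI)
    fix i j assume ij: "i < n" "j < n"
    have "(\<lambda>m. cnj (P m $$ (i, j) - Q m $$ (i, j))) \<longlonglongrightarrow> cnj (X $$ (i, j))"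
      by (intro tendsto_cnj lim ij)
    moreover have "cnj (P m $$ (i, j) - Q m $$ (i, j)) = P m $$ (j, i) - Q m $$ (j, i)" for m
      using psd_hermitian[OF P ij, of m] psd_hermitian[OF Q ij, of m] by simp
    ultimately show "cnj (X $$ (i, j)) = X $$ (j, i)"
      using LIMSEQ_unique[OF lim[OF ij(2,1)]] by simp
  qed (rule X)
  from hermitian_trace_norm[OF this] obtain U l where U: "U \<in> carrier_mat n n"
    and Uo: "\<And>j k. j < n \<Longrightarrow> k < n \<Longrightarrow> (\<Sum>i<n. U $$ (j, i) * cnj (U $$ (k, i))) = (if j = k then 1 else 0)"
    and q: "\<And>k. k < n \<Longrightarrow> complex_of_real (l k) = qform n X (\<lambda>i. U $$ (i, k))"
    and tn: "trace_norm X = (\<Sum>k<n. \<bar>l k\<bar>)" by blast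
  \<comment> \<open>Basis independence of the trace, from the orthonormality of the rows of
    \<open>U\<close>.\<close>
  have tr: "(\<Sum>k<n. qform n A (\<lambda>i. U $$ (i, k))) = trace A" if "A \<in> carrier_mat n n" for A
  proof -
    have "(\<Sum>k<n. qform n A (\<lambda>i. U $$ (i, k))) = (\<Sum>i<n. \<Sum>j<n. \<Sum>k<n. A $$ (i, j) * (U $$ (j, k) * cnj (U $$ (i, k))))"
      unfolding qform_def by (subst sum.swap, rule sum.cong[OF refl], subst sum.swap) (simp add: mult.assoc)
    also have "\<dots> = (\<Sum>i<n. \<Sum>j<n. if j = i then A $$ (i, j) else 0)"
      unfolding sum_distrib_left[symmetric] by (intro sum.cong refl) (simp add: Uo)
    finally show ?thesis using that by (simp add: trace_carrier)
  qed
  define D where "D m k = Re (qform n (P m) (\<lambda>i. U $$ (i, k))) - Re (qform n (Q m) (\<lambda>i. U $$ (i, k)))" for m k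
  have "(\<lambda>m. D m k) \<longlonglongrightarrow> l k" if "k < n" for k
  proof -
    have "(\<lambda>m. Re (\<Sum>i<n. \<Sum>j<n. (P m $$ (i, j) - Q m $$ (i, j)) * U $$ (j, k) * cnj (U $$ (i, k)))) \<longlonglongrightarrow>
      Re (\<Sum>i<n. \<Sum>j<n. X $$ (i, j) * U $$ (j, k) * cnj (U $$ (i, k)))"
      by (intro tendsto_intros lim) auto
    moreover have "Re (\<Sum>i<n. \<Sum>j<n. X $$ (i, j) * U $$ (j, k) * cnj (U $$ (i, k))) = l k"
      using q[OF that] by (metis Re_complex_of_real qform_def)
    ultimately show ?thesis
      by (simp add: D_def qform_def left_diff_distrib sum_subtractf)
  qed
  then have "(\<lambda>m. \<Sum>k<n. \<bar>D m k\<bar>) \<longlonglongrightarrow> (\<Sum>k<n. \<bar>l k\<bar>)"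
    by (intro tendsto_sum tendsto_rabs) auto
  moreover have "(\<Sum>k<n. \<bar>D m k\<bar>) \<le> K m" for m
  proof -
    have pos: "0 \<le> Re (qform n (P m) f)" "0 \<le> Re (qform n (Q m) f)" for f
      using qform_nonneg[OF P, of m f] qform_nonneg[OF Q, of m f] by (auto simp: less_eq_complex_def)
    have "(\<Sum>k<n. \<bar>D m k\<bar>) \<le> (\<Sum>k<n. Re (qform n (P m) (\<lambda>i. U $$ (i, k))) + Re (qform n (Q m) (\<lambda>i. U $$ (i, k))))"
    proof (rule sum_mono)
      fix k
      have "\<bar>p - q\<bar> \<le> p + q" if "0 \<le> p" "0 \<le> q" for p q :: real
        using that by (simp add: abs_le_iff)
      then show "\<bar>D m k\<bar> \<le> Re (qform n (P m) (\<lambda>i. U $$ (i, k))) + Re (qform n (Q m) (\<lambda>i. U $$ (i, k)))"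
        unfolding D_def using pos by blast
    qed
    also have "\<dots> = Re (trace (P m)) + Re (trace (Q m))"
      unfolding tr[OF psd_carrier[OF P[of m]], symmetric] tr[OF psd_carrier[OF Q[of m]], symmetric]
      by (simp add: sum.distrib)
    finally show ?thesis using K[of m] by simp
  qed
  ultimately show ?thesis unfolding tn using Klim by (intro LIMSEQ_le[OF _ Klim]) auto
qed

section \<open>Kraus maps and ampliations\<close>

lemma sum_lessThan_mult:
  fixes f :: "nat \<Rightarrow> 'a::comm_monoid_add"
  shows "(\<Sum>k<r * n. f k) = (\<Sum>i<r. \<Sum>c<n. f (i * n + c))"
proof -
  have "(\<Sum>i<r. \<Sum>c<n. f (i * n + c)) = (\<Sum>i<r. sum f {i * n..<i * n + n})"
  proof (rule sum.cong[OF refl])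
    fix i
    show "(\<Sum>c<n. f (i * n + c)) = sum f {i * n..<i * n + n}"
      using sum.shift_bounds_nat_ivl[of f 0 "i * n" n] by (simp add: atLeast0LessThan add.commute)
  qed
  then show ?thesis using sum.nat_group[of f n r] by simp
qed

lemma sum_swap_pairs:
  "(\<Sum>i\<in>A. \<Sum>j\<in>B. \<Sum>k\<in>C. \<Sum>l\<in>D. g i j k l) = (\<Sum>k\<in>C. \<Sum>l\<in>D. \<Sum>i\<in>A. \<Sum>j\<in>B. g i j k l)"
  for g :: "_ \<Rightarrow> _ \<Rightarrow> _ \<Rightarrow> _ \<Rightarrow> 'a::comm_monoid_add"
proof -
  have "(\<Sum>i\<in>A. \<Sum>j\<in>B. \<Sum>k\<in>C. \<Sum>l\<in>D. g i j k l) = (\<Sum>i\<in>A. \<Sum>k\<in>C. \<Sum>l\<in>D. \<Sum>j\<in>B. g i j k l)"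
    by (rule sum.cong[OF refl], subst sum.swap, rule sum.cong[OF refl], rule sum.swap)
  also have "\<dots> = (\<Sum>k\<in>C. \<Sum>l\<in>D. \<Sum>i\<in>A. \<Sum>j\<in>B. g i j k l)"
    by (subst sum.swap, rule sum.cong[OF refl], rule sum.swap)
  finally show ?thesis .
qed

lemma div_mod_less:
  "k < r * (n::nat) \<Longrightarrow> k div n < r" "k < r * (n::nat) \<Longrightarrow> k mod n < n"
  by (auto simp: less_mult_imp_div_less) (metis mod_less_divisor mult_0_right not_less_zero neq0_conv)

lemma index_less_mult: "i * m + a < r * m" if "i < r" "a < (m::nat)"
proof -
  have "i * m + a < Suc i * m" using that by simp
  also have "\<dots> \<le> r * m" using that by (intro mult_le_mono1) simp
  finally show ?thesis .
qed

lemma sum_if_const: "(\<Sum>x\<in>A. if P then f x else 0) = (if P then sum f A else 0)"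
  by simp

text \<open>X -> sum_x a_x X a_x^dagger, with operators given by entry functions. The label type is
  free because unit, pairs and optional pairs all occur as labels.\<close>

definition kraus_map :: "'x set \<Rightarrow> ('x \<Rightarrow> nat \<Rightarrow> nat \<Rightarrow> complex) \<Rightarrow> nat \<Rightarrow> nat \<Rightarrow> superop" where
  "kraus_map I a m n X = mat n n (\<lambda>(i, j). \<Sum>x\<in>I. \<Sum>k<m. \<Sum>l<m. a x i k * X $$ (k, l) * cnj (a x j l))"

lemma kraus_map_carrier [simp]: "kraus_map I a m n X \<in> carrier_mat n n"
  by (simp add: kraus_map_def)

lemma kraus_map_dim [simp]: "dim_row (kraus_map I a m n X) = n" "dim_col (kraus_map I a m n X) = n"
  by (simp_all add: kraus_map_def)

lemma kraus_map_index:
  "i < n \<Longrightarrow> j < n \<Longrightarrow> kraus_map I a m n X $$ (i, j) = (\<Sum>x\<in>I. \<Sum>k<m. \<Sum>l<m. a x i k * X $$ (k, l) * cnj (a x j l))"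
  by (simp add: kraus_map_def)

lemma linear_kraus_map: "linear_superop m n (kraus_map I a m n)"
  unfolding linear_superop_def
proof (intro conjI ballI allI)
  fix A B :: "complex mat" assume "A \<in> carrier_mat m m" "B \<in> carrier_mat m m"
  then show "kraus_map I a m n (A + B) = kraus_map I a m n A + kraus_map I a m n B"
    by (intro eq_matI) (auto simp: kraus_map_index distrib_left distrib_right sum.distrib)
next
  fix c and A :: "complex mat" assume "A \<in> carrier_mat m m"
  then show "kraus_map I a m n (c \<cdot>\<^sub>m A) = c \<cdot>\<^sub>m kraus_map I a m n A"
    by (intro eq_matI) (auto simp: kraus_map_index sum_distrib_left mult_ac intro!: sum.cong)
qed simp

text \<open>The form at f is the sum over x of the form of X at a_x^dagger f, which is
  \<open>?w x\<close>.\<close>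

lemma psd_kraus_map:
  assumes X: "psd m X"
  shows "psd n (kraus_map I a m n X)"
  unfolding psd_iff
proof (intro conjI allI)
  fix f :: "nat \<Rightarrow> complex"
  let ?w = "\<lambda>x l. \<Sum>j<n. cnj (a x j l) * f j"
  have "(\<Sum>i<n. \<Sum>j<n. kraus_map I a m n X $$ (i, j) * f j * cnj (f i)) =
    (\<Sum>i<n. \<Sum>j<n. \<Sum>x\<in>I. \<Sum>k<m. \<Sum>l<m. a x i k * X $$ (k, l) * cnj (a x j l) * f j * cnj (f i))"
    by (intro sum.cong refl) (simp add: kraus_map_index sum_distrib_right)
  also have "\<dots> = (\<Sum>x\<in>I. \<Sum>i<n. \<Sum>j<n. \<Sum>k<m. \<Sum>l<m. a x i k * X $$ (k, l) * cnj (a x j l) * f j * cnj (f i))"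
    by (subst (2) sum.swap, subst sum.swap, rule refl)
  also have "\<dots> = (\<Sum>x\<in>I. \<Sum>k<m. \<Sum>l<m. X $$ (k, l) * ?w x l * cnj (?w x k))"
  proof (rule sum.cong[OF refl])
    fix x
    have "(\<Sum>i<n. \<Sum>j<n. \<Sum>k<m. \<Sum>l<m. a x i k * X $$ (k, l) * cnj (a x j l) * f j * cnj (f i)) =
      (\<Sum>k<m. \<Sum>l<m. \<Sum>i<n. \<Sum>j<n. a x i k * X $$ (k, l) * cnj (a x j l) * f j * cnj (f i))"
      by (rule sum_swap_pairs)
    also have "\<dots> = (\<Sum>k<m. \<Sum>l<m. X $$ (k, l) * ?w x l * cnj (?w x k))"
    proof (intro sum.cong refl)
      fix k l
      have "(\<Sum>i<n. \<Sum>j<n. a x i k * X $$ (k, l) * cnj (a x j l) * f j * cnj (f i)) =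
         X $$ (k, l) * (\<Sum>i<n. \<Sum>j<n. (a x i k * cnj (f i)) * (cnj (a x j l) * f j))"
        by (simp add: sum_distrib_left mult_ac)
      also have "(\<Sum>i<n. \<Sum>j<n. (a x i k * cnj (f i)) * (cnj (a x j l) * f j)) = cnj (?w x k) * ?w x l"
        by (simp add: sum_product[symmetric])
      finally show "(\<Sum>i<n. \<Sum>j<n. a x i k * X $$ (k, l) * cnj (a x j l) * f j * cnj (f i)) = X $$ (k, l) * ?w x l * cnj (?w x k)"
        by (simp add: mult_ac)
    qed
    finally show "(\<Sum>i<n. \<Sum>j<n. \<Sum>k<m. \<Sum>l<m. a x i k * X $$ (k, l) * cnj (a x j l) * f j * cnj (f i)) =
      (\<Sum>k<m. \<Sum>l<m. X $$ (k, l) * ?w x l * cnj (?w x k))" .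
  qed
  also have "0 \<le> \<dots>" by (intro sum_nonneg psd_form_nonneg X)
  finally show "0 \<le> (\<Sum>i<n. \<Sum>j<n. kraus_map I a m n X $$ (i, j) * f j * cnj (f i))" .
qed simp

text \<open>The Kraus operators of the ampliation are 1_r (x) a_x. Complete positivity thereby
  reduces to positivity of Kraus maps in every dimension.\<close>

lemma ampliation_kraus_map:
  shows "ampliation r m n (kraus_map I a m n) X =
    kraus_map I (\<lambda>x i k. if i div n = k div m then a x (i mod n) (k mod m) else 0) (r * m) (r * n) X"
proof (rule eq_matI; (simp add: ampliation_def)?)
  fix i j assume ij: "i < r * n" "j < r * n"
  note [simp] = div_mod_less[OF ij(1)] div_mod_less[OF ij(2)]
  let ?b = "\<lambda>x i k. if i div n = k div m then a x (i mod n) (k mod m) else 0"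
  have "kraus_map I ?b (r * m) (r * n) X $$ (i, j) =
    (\<Sum>x\<in>I. \<Sum>p<r. \<Sum>k<m. \<Sum>q<r. \<Sum>l<m. if i div n = p then if j div n = q then
       a x (i mod n) k * X $$ (p * m + k, q * m + l) * cnj (a x (j mod n) l) else 0 else 0)"
    unfolding kraus_map_index[OF ij] sum_lessThan_mult
    by (intro sum.cong refl) auto
  also have "\<dots> = (\<Sum>x\<in>I. \<Sum>k<m. \<Sum>l<m. a x (i mod n) k * X $$ (i div n * m + k, j div n * m + l) * cnj (a x (j mod n) l))"
  proof (rule sum.cong[OF refl])
    fix x
    let ?g = "\<lambda>p q k l. a x (i mod n) k * X $$ (p * m + k, q * m + l) * cnj (a x (j mod n) l)"
    show "(\<Sum>p<r. \<Sum>k<m. \<Sum>q<r. \<Sum>l<m. if i div n = p then if j div n = q then ?g p q k l else 0 else 0) =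
      (\<Sum>k<m. \<Sum>l<m. ?g (i div n) (j div n) k l)"
      by (simp add: sum_if_const)
  qed
  finally show "kraus_map I a m n (block m X (i div n) (j div n)) $$ (i mod n, j mod n) = kraus_map I ?b (r * m) (r * n) X $$ (i, j)"
    by (simp add: kraus_map_index block_def)
qed

lemma completely_positive_kraus_map: "completely_positive m n (kraus_map I a m n)"
  unfolding completely_positive_def ampliation_kraus_map by (intro allI impI psd_kraus_map)

text \<open>The hypothesis is sum_x a_x^dagger a_x = 1, read at entry (l, k).\<close>

lemma trace_preserving_kraus_map:
  assumes "\<And>k l. k < m \<Longrightarrow> l < m \<Longrightarrow> (\<Sum>x\<in>I. \<Sum>i<n. a x i k * cnj (a x i l)) = (if k = l then 1 else 0)"
  shows "trace_preserving m (kraus_map I a m n)"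
  unfolding trace_preserving_def
proof
  fix X :: "complex mat" assume X: "X \<in> carrier_mat m m"
  have "trace (kraus_map I a m n X) = (\<Sum>i<n. \<Sum>x\<in>I. \<Sum>k<m. \<Sum>l<m. X $$ (k, l) * (a x i k * cnj (a x i l)))"
    unfolding trace_carrier[OF kraus_map_carrier] by (intro sum.cong refl) (simp add: kraus_map_index mult_ac)
  also have "\<dots> = (\<Sum>k<m. \<Sum>l<m. \<Sum>i<n. \<Sum>x\<in>I. X $$ (k, l) * (a x i k * cnj (a x i l)))"
    by (rule sum_swap_pairs)
  also have "\<dots> = (\<Sum>k<m. \<Sum>l<m. X $$ (k, l) * (\<Sum>x\<in>I. \<Sum>i<n. a x i k * cnj (a x i l)))"
    unfolding sum_distrib_left by (intro sum.cong refl sum.swap)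
  also have "\<dots> = (\<Sum>k<m. \<Sum>l<m. if k = l then X $$ (k, l) else 0)"
    by (intro sum.cong refl) (simp add: assms)
  also have "\<dots> = trace X" using X by (simp add: trace_carrier)
  finally show "trace (kraus_map I a m n X) = trace X" .
qed

lemma quantum_channel_kraus_map:
  assumes "\<And>k l. k < m \<Longrightarrow> l < m \<Longrightarrow> (\<Sum>x\<in>I. \<Sum>i<n. a x i k * cnj (a x i l)) = (if k = l then 1 else 0)"
  shows "quantum_channel m n (kraus_map I a m n)"
  using trace_preserving_kraus_map[OF assms]
  by (simp add: quantum_channel_def linear_kraus_map completely_positive_kraus_map)

section \<open>Blocks, composition and traces of ampliations\<close>

lemma block_carrier [simp]: "block m X i j \<in> carrier_mat m m"
  by (simp add: block_def)

lemma ampliation_carrier [simp]: "ampliation r m n \<Phi> X \<in> carrier_mat (r * n) (r * n)"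
  by (simp add: ampliation_def)

lemma block_ampliation:
  assumes "linear_superop m n \<Phi>" "i < r" "j < r"
  shows "block n (ampliation r m n \<Phi> X) i j = \<Phi> (block m X i j)"
proof -
  have "\<Phi> (block m X i j) \<in> carrier_mat n n" using assms(1) by (simp add: linear_superop_def)
  then show ?thesis using assms(2,3)
    by (intro eq_matI) (auto simp: block_def ampliation_def index_less_mult)
qed

lemma ampliation_comp:
  assumes "linear_superop m n \<Phi>"
  shows "ampliation r m p (\<Psi> \<circ> \<Phi>) X = ampliation r n p \<Psi> (ampliation r m n \<Phi> X)"
proof (rule eq_matI)
  fix i j assume "i < dim_row (ampliation r n p \<Psi> (ampliation r m n \<Phi> X))" "j < dim_col (ampliation r n p \<Psi> (ampliation r m n \<Phi> X))"
  then have "i < r * p" "j < r * p" by (simp_all add: ampliation_def)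
  then show "ampliation r m p (\<Psi> \<circ> \<Phi>) X $$ (i, j) = ampliation r n p \<Psi> (ampliation r m n \<Phi> X) $$ (i, j)"
    unfolding ampliation_def[of r m p] ampliation_def[of r n p]
    by (simp add: block_ampliation[OF assms] div_mod_less)
qed (simp_all add: ampliation_def)

lemma linear_superop_comp:
  "linear_superop m n \<Phi> \<Longrightarrow> linear_superop n p \<Psi> \<Longrightarrow> linear_superop m p (\<Psi> \<circ> \<Phi>)"
  by (simp add: linear_superop_def)

lemma completely_positive_comp:
  "linear_superop m n \<Phi> \<Longrightarrow> completely_positive m n \<Phi> \<Longrightarrow> completely_positive n p \<Psi> \<Longrightarrow> completely_positive m p (\<Psi> \<circ> \<Phi>)"
  by (simp add: completely_positive_def ampliation_comp)

lemma quantum_channel_comp: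
  "quantum_channel m n \<Phi> \<Longrightarrow> quantum_channel n p \<Psi> \<Longrightarrow> quantum_channel m p (\<Psi> \<circ> \<Phi>)"
  using completely_positive_comp[of m n \<Phi> p \<Psi>] linear_superop_comp[of m n \<Phi> p \<Psi>]
  by (simp add: quantum_channel_def trace_preserving_def) (simp add: linear_superop_def)

lemma ampliation_id: "X \<in> carrier_mat (r * m) (r * m) \<Longrightarrow> ampliation r m m (\<lambda>X. X) X = X"
proof (rule eq_matI)
  fix i j assume X: "X \<in> carrier_mat (r * m) (r * m)" and "i < dim_row X" "j < dim_col X"
  then have "i < r * m" "j < r * m" by auto
  then show "ampliation r m m (\<lambda>X. X) X $$ (i, j) = X $$ (i, j)"
    by (simp add: ampliation_def block_def div_mod_less)
qed (auto simp: ampliation_def)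

lemma quantum_channel_id: "quantum_channel m m (\<lambda>X. X)"
  by (auto simp: quantum_channel_def linear_superop_def completely_positive_def trace_preserving_def
      ampliation_id psd_carrier)

text \<open>Compression by the single Kraus operator <i| (x) 1.\<close>

lemma psd_block:
  assumes "psd (r * m) X" "i < r" shows "psd m (block m X i i)"
proof -
  have "block m X i i = kraus_map {()} (\<lambda>_ c k. if k = i * m + c then 1 else 0) (r * m) m X"
  proof (rule eq_matI; (simp add: block_def)?)
    fix c e assume ce: "c < m" "e < m"
    show "X $$ (i * m + c, i * m + e) = kraus_map {()} (\<lambda>_ c k. if k = i * m + c then 1 else 0) (r * m) m X $$ (c, e)"
    proof -
      have "kraus_map {()} (\<lambda>_ c k. if k = i * m + c then 1 else 0) (r * m) m X $$ (c, e) =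
        (\<Sum>k<r * m. \<Sum>l<r * m. if k = i * m + c then if l = i * m + e then X $$ (k, l) else 0 else 0)"
        unfolding kraus_map_index[OF ce] by (simp, intro sum.cong refl) simp
      then show ?thesis using index_less_mult[OF assms(2) ce(1)] index_less_mult[OF assms(2) ce(2)]
        by (simp add: sum_if_const)
    qed
  qed
  then show ?thesis using psd_kraus_map[OF assms(1)] by simp
qed

text \<open>Off-diagonal blocks drop out, so a trace bound on positive matrices carries over to
  every ampliation with the same constant.\<close>

lemma trace_ampliation:
  assumes "linear_superop m n \<Phi>"
  shows "trace (ampliation r m n \<Phi> X) = (\<Sum>i<r. trace (\<Phi> (block m X i i)))"
proof -
  have c: "\<Phi> (block m X i i) \<in> carrier_mat n n" for i using assms by (simp add: linear_superop_def)
  have "trace (ampliation r m n \<Phi> X) = (\<Sum>i<r. \<Sum>c<n. ampliation r m n \<Phi> X $$ (i * n + c, i * n + c))"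
    unfolding trace_carrier[OF ampliation_carrier] by (rule sum_lessThan_mult)
  also have "\<dots> = (\<Sum>i<r. \<Sum>c<n. \<Phi> (block m X i i) $$ (c, c))"
    by (intro sum.cong refl) (simp add: ampliation_def index_less_mult)
  finally show ?thesis by (simp add: trace_carrier[OF c])
qed

lemma trace_blocks:
  "X \<in> carrier_mat (r * m) (r * m) \<Longrightarrow> (\<Sum>i<r. trace (block m X i i)) = trace X"
  using trace_ampliation[of m m "\<lambda>X. X" r X] by (simp add: linear_superop_def ampliation_id)

section \<open>Differences of completely positive maps\<close>

lemma linear_superopD:
  assumes "linear_superop m n \<Phi>" "A \<in> carrier_mat m m"
  shows "\<Phi> A \<in> carrier_mat n n" "B \<in> carrier_mat m m \<Longrightarrow> \<Phi> (A + B) = \<Phi> A + \<Phi> B"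
    "\<Phi> (c \<cdot>\<^sub>m A) = c \<cdot>\<^sub>m \<Phi> A"
  using assms by (simp_all add: linear_superop_def)

lemma linear_superop_diff:
  assumes T: "linear_superop m n T" and "A \<in> carrier_mat m m" "B \<in> carrier_mat m m"
  shows "T (A - B) = T A - T B"
proof -
  have "A - B = A + (-1) \<cdot>\<^sub>m B" using assms by (intro eq_matI) auto
  then have "T (A - B) = T A + (-1) \<cdot>\<^sub>m T B"
    using linear_superopD[OF T] assms(2,3) by simp
  also have "\<dots> = T A - T B"
    using linear_superopD(1)[OF T assms(2)] linear_superopD(1)[OF T assms(3)] by (intro eq_matI) auto
  finally show ?thesis .
qed

definition cp_map :: "nat \<Rightarrow> superop \<Rightarrow> bool" where
  "cp_map d T \<longleftrightarrow> linear_superop d d T \<and> completely_positive d d T"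

lemma cp_map_carrier: "cp_map d T \<Longrightarrow> X \<in> carrier_mat d d \<Longrightarrow> T X \<in> carrier_mat d d"
  by (simp add: cp_map_def linear_superop_def)

lemma cp_map_id: "cp_map d (\<lambda>X. X)"
  using quantum_channel_id by (auto simp: cp_map_def quantum_channel_def)

lemma cp_map_kraus_map: "cp_map d (kraus_map I a d d)"
  by (simp add: cp_map_def linear_kraus_map completely_positive_kraus_map)

lemma cp_map_comp: "cp_map d S \<Longrightarrow> cp_map d T \<Longrightarrow> cp_map d (S \<circ> T)"
  by (auto simp: cp_map_def intro: linear_superop_comp completely_positive_comp)

lemma ampliation_add:
  assumes "linear_superop m n S" "linear_superop m n T"
  shows "ampliation r m n (\<lambda>X. S X + T X) X = ampliation r m n S X + ampliation r m n T X"
proof -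
  have "S (block m X i j) \<in> carrier_mat n n" "T (block m X i j) \<in> carrier_mat n n" for i j
    using assms by (simp_all add: linear_superop_def)
  note carrier_matD[OF this(1)] carrier_matD[OF this(2)]
  then show ?thesis by (intro eq_matI) (auto simp: ampliation_def div_mod_less)
qed

lemma ampliation_smult:
  assumes "linear_superop m n S"
  shows "ampliation r m n (\<lambda>X. c \<cdot>\<^sub>m S X) X = c \<cdot>\<^sub>m ampliation r m n S X"
proof -
  have "S (block m X i j) \<in> carrier_mat n n" for i j
    using assms by (simp_all add: linear_superop_def)
  note carrier_matD[OF this]
  then show ?thesis by (intro eq_matI) (auto simp: ampliation_def div_mod_less)
qed

lemma linear_superop_add:
  assumes S: "linear_superop m n S" and T: "linear_superop m n T"
  shows "linear_superop m n (\<lambda>X. S X + T X)"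
  unfolding linear_superop_def
proof (intro conjI ballI allI)
  fix A :: "complex mat" assume A: "A \<in> carrier_mat m m"
  note [simp] = linear_superopD[OF S] linear_superopD[OF T]
  have [simp]: "S A \<in> carrier_mat n n" "T A \<in> carrier_mat n n" using A by simp_all
  show "S A + T A \<in> carrier_mat n n" by simp
  show "S (c \<cdot>\<^sub>m A) + T (c \<cdot>\<^sub>m A) = c \<cdot>\<^sub>m (S A + T A)" for c
    using A carrier_matD[of "S A" n n] carrier_matD[of "T A" n n] by (intro eq_matI) (auto simp: distrib_left)
  fix B :: "complex mat" assume B: "B \<in> carrier_mat m m"
  have [simp]: "S B \<in> carrier_mat n n" "T B \<in> carrier_mat n n" using B by simp_all
  show "S (A + B) + T (A + B) = S A + T A + (S B + T B)"
    using A B carrier_matD[of "S A" n n] carrier_matD[of "T A" n n] carrier_matD[of "S B" n n] carrier_matD[of "T B" n n]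
    by (intro eq_matI) auto
qed

lemma linear_superop_smult:
  assumes S: "linear_superop m n S"
  shows "linear_superop m n (\<lambda>X. c \<cdot>\<^sub>m S X)"
  unfolding linear_superop_def
proof (intro conjI ballI allI)
  fix A :: "complex mat" assume A: "A \<in> carrier_mat m m"
  note [simp] = linear_superopD[OF S]
  have [simp]: "S A \<in> carrier_mat n n" using A by simp_all
  show "c \<cdot>\<^sub>m S A \<in> carrier_mat n n" by simp
  show "c \<cdot>\<^sub>m S (b \<cdot>\<^sub>m A) = b \<cdot>\<^sub>m (c \<cdot>\<^sub>m S A)" for b
    using A carrier_matD[of "S A" n n] by (intro eq_matI) auto
  fix B :: "complex mat" assume B: "B \<in> carrier_mat m m"
  have [simp]: "S B \<in> carrier_mat n n" using B by simp_all
  show "c \<cdot>\<^sub>m S (A + B) = c \<cdot>\<^sub>m S A + c \<cdot>\<^sub>m S B"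
    using A B carrier_matD[of "S A" n n] carrier_matD[of "S B" n n]
    by (intro eq_matI) (auto simp: distrib_left)
qed

lemma cp_map_add: "cp_map d S \<Longrightarrow> cp_map d T \<Longrightarrow> cp_map d (\<lambda>X. S X + T X)"
  by (auto simp: cp_map_def completely_positive_def ampliation_add linear_superop_add intro: psd_add)

lemma cp_map_smult: "0 \<le> c \<Longrightarrow> cp_map d S \<Longrightarrow> cp_map d (\<lambda>X. complex_of_real c \<cdot>\<^sub>m S X)"
  by (auto simp: cp_map_def completely_positive_def ampliation_smult linear_superop_smult intro: psd_smult)

lemma psd_cp_map:
  assumes "cp_map d T" "psd d X" shows "psd d (T X)"
proof -
  have X: "X \<in> carrier_mat d d" using assms(2) by (rule psd_carrier)
  have "block d X 0 0 = X" using X by (intro eq_matI) (auto simp: block_def)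
  then have "ampliation 1 d d T X = T X"
    using cp_map_carrier[OF assms(1) X] by (intro eq_matI) (auto simp: ampliation_def)
  then show ?thesis using assms by (simp add: cp_map_def completely_positive_def)
      (metis mult_1 One_nat_def)
qed

lemma trace_add: "A \<in> carrier_mat n n \<Longrightarrow> B \<in> carrier_mat n n \<Longrightarrow> trace (A + B) = trace A + trace B"
  by (auto simp: trace_def sum.distrib)

lemma trace_smult: "A \<in> carrier_mat n n \<Longrightarrow> trace (c \<cdot>\<^sub>m A) = c * trace A"
  by (auto simp: trace_def sum_distrib_left)

text \<open>A certificate for a diamond-norm bound. The decomposition is existential, so K only
  bounds from above. \<open>0 \<le> K\<close> is stated because at d = 0 all traces vanish and the
  inequality says nothing about K.\<close>

definition cp_bounded :: "nat \<Rightarrow> superop \<Rightarrow> real \<Rightarrow> bool" where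
  "cp_bounded d T K \<longleftrightarrow> 0 \<le> K \<and> (\<exists>T1 T2. cp_map d T1 \<and> cp_map d T2 \<and>
     (\<forall>X\<in>carrier_mat d d. T X = T1 X - T2 X) \<and>
     (\<forall>X. psd d X \<longrightarrow> Re (trace (T1 X)) + Re (trace (T2 X)) \<le> K * Re (trace X)))"

lemma cp_boundedI:
  assumes "0 \<le> K" "cp_map d T1" "cp_map d T2" "\<And>X. X \<in> carrier_mat d d \<Longrightarrow> T X = T1 X - T2 X"
    "\<And>X. psd d X \<Longrightarrow> Re (trace (T1 X)) + Re (trace (T2 X)) \<le> K * Re (trace X)"
  shows "cp_bounded d T K"
  unfolding cp_bounded_def using assms by blast

lemma cp_boundedE:
  assumes "cp_bounded d T K"
  obtains T1 T2 where "0 \<le> K" "cp_map d T1" "cp_map d T2" "\<And>X. X \<in> carrier_mat d d \<Longrightarrow> T X = T1 X - T2 X"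
    "\<And>X. psd d X \<Longrightarrow> Re (trace (T1 X)) + Re (trace (T2 X)) \<le> K * Re (trace X)"
  using assms unfolding cp_bounded_def by blast

lemma cp_bounded_nonneg: "cp_bounded d T K \<Longrightarrow> 0 \<le> K"
  by (simp add: cp_bounded_def)

lemma cp_bounded_carrier: "cp_bounded d T K \<Longrightarrow> X \<in> carrier_mat d d \<Longrightarrow> T X \<in> carrier_mat d d"
  by (elim cp_boundedE) (auto intro: minus_carrier_mat cp_map_carrier)

lemma cp_bounded_cong:
  "cp_bounded d T K \<Longrightarrow> (\<And>X. X \<in> carrier_mat d d \<Longrightarrow> T' X = T X) \<Longrightarrow> cp_bounded d T' K"
  by (simp add: cp_bounded_def)

lemma psd_Re_trace_nonneg: "psd d X \<Longrightarrow> 0 \<le> Re (trace X)"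
  using psd_trace_nonneg[of d X] by (simp add: less_eq_complex_def)

lemma cp_bounded_mono: "cp_bounded d T K \<Longrightarrow> K \<le> K' \<Longrightarrow> cp_bounded d T K'"
proof (elim cp_boundedE)
  fix T1 T2 assume "K \<le> K'" "0 \<le> K" "cp_map d T1" "cp_map d T2" "\<And>X. X \<in> carrier_mat d d \<Longrightarrow> T X = T1 X - T2 X"
    and tr: "\<And>X. psd d X \<Longrightarrow> Re (trace (T1 X)) + Re (trace (T2 X)) \<le> K * Re (trace X)"
  moreover have "Re (trace (T1 X)) + Re (trace (T2 X)) \<le> K' * Re (trace X)" if "psd d X" for X
    using tr[OF that] mult_right_mono[OF \<open>K \<le> K'\<close> psd_Re_trace_nonneg[OF that]] by linarith
  ultimately show ?thesis by (intro cp_boundedI[of K' d T1 T2]) auto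
qed

lemma cp_bounded_cp_map:
  assumes "cp_map d T" "0 \<le> K" "\<And>X. psd d X \<Longrightarrow> Re (trace (T X)) \<le> K * Re (trace X)"
  shows "cp_bounded d T K"
proof (rule cp_boundedI[OF assms(2,1)])
  \<comment> \<open>The negative part is the zero map, written as 0 times the identity so that it is
    a scaled \<open>cp_map\<close>.\<close>
  have z: "complex_of_real 0 \<cdot>\<^sub>m X = 0\<^sub>m d d" if "X \<in> carrier_mat d d" for X
    using that by (intro eq_matI) auto
  show "cp_map d (\<lambda>X. complex_of_real 0 \<cdot>\<^sub>m X)" by (rule cp_map_smult[OF _ cp_map_id]) simp
  fix X
  show "T X = T X - complex_of_real 0 \<cdot>\<^sub>m X" if "X \<in> carrier_mat d d"
    using cp_map_carrier[OF assms(1) that] unfolding z[OF that] by (intro eq_matI) auto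
  show "Re (trace (T X)) + Re (trace (complex_of_real 0 \<cdot>\<^sub>m X)) \<le> K * Re (trace X)" if "psd d X"
    using assms(3)[OF that] trace_smult[OF psd_carrier[OF that], of 0] by simp
qed

lemma cp_bounded_channel: "quantum_channel d d T \<Longrightarrow> cp_bounded d T 1"
  by (rule cp_bounded_cp_map) (auto simp: quantum_channel_def cp_map_def trace_preserving_def psd_carrier)

lemma cp_bounded_id: "cp_bounded d (\<lambda>X. X) 1"
  by (rule cp_bounded_channel[OF quantum_channel_id])

lemma cp_bounded_add:
  assumes "cp_bounded d S J" "cp_bounded d T K"
  shows "cp_bounded d (\<lambda>X. S X + T X) (J + K)"
proof -
  from assms(1) obtain S1 S2 where S: "0 \<le> J" "cp_map d S1" "cp_map d S2" "\<And>X. X \<in> carrier_mat d d \<Longrightarrow> S X = S1 X - S2 X"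
    "\<And>X. psd d X \<Longrightarrow> Re (trace (S1 X)) + Re (trace (S2 X)) \<le> J * Re (trace X)"
    by (rule cp_boundedE) blast
  from assms(2) obtain T1 T2 where T: "0 \<le> K" "cp_map d T1" "cp_map d T2" "\<And>X. X \<in> carrier_mat d d \<Longrightarrow> T X = T1 X - T2 X"
    "\<And>X. psd d X \<Longrightarrow> Re (trace (T1 X)) + Re (trace (T2 X)) \<le> K * Re (trace X)"
    by (rule cp_boundedE) blast
  show ?thesis
  proof (rule cp_boundedI[OF _ cp_map_add[OF S(2) T(2)] cp_map_add[OF S(3) T(3)]])
    fix X
    show "S X + T X = S1 X + T1 X - (S2 X + T2 X)" if X: "X \<in> carrier_mat d d"
      unfolding S(4)[OF X] T(4)[OF X]
      using cp_map_carrier[OF S(2) X] cp_map_carrier[OF S(3) X] cp_map_carrier[OF T(2) X] cp_map_carrier[OF T(3) X]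
      by (intro eq_matI) auto
    show "Re (trace (S1 X + T1 X)) + Re (trace (S2 X + T2 X)) \<le> (J + K) * Re (trace X)" if P: "psd d X"
      using S(5)[OF P] T(5)[OF P] psd_carrier[OF P] cp_map_carrier[OF S(2)] cp_map_carrier[OF S(3)]
        cp_map_carrier[OF T(2)] cp_map_carrier[OF T(3)]
      by (simp add: trace_add[of _ d] distrib_right)
  qed (use S T in simp)
qed

text \<open>A negative scalar exchanges the two positive parts.\<close>

lemma cp_bounded_smult:
  assumes "cp_bounded d S J"
  shows "cp_bounded d (\<lambda>X. complex_of_real c \<cdot>\<^sub>m S X) (\<bar>c\<bar> * J)"
proof -
  from assms obtain S1 S2 where S: "0 \<le> J" "cp_map d S1" "cp_map d S2" "\<And>X. X \<in> carrier_mat d d \<Longrightarrow> S X = S1 X - S2 X"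
    "\<And>X. psd d X \<Longrightarrow> Re (trace (S1 X)) + Re (trace (S2 X)) \<le> J * Re (trace X)"
    by (rule cp_boundedE) blast
  have *: "Re (trace (complex_of_real \<bar>c\<bar> \<cdot>\<^sub>m S1 X)) + Re (trace (complex_of_real \<bar>c\<bar> \<cdot>\<^sub>m S2 X)) \<le> \<bar>c\<bar> * J * Re (trace X)"
    if P: "psd d X" for X
    using mult_left_mono[OF S(5)[OF P], of "\<bar>c\<bar>"] psd_carrier[OF P] cp_map_carrier[OF S(2)] cp_map_carrier[OF S(3)]
    by (simp add: trace_smult[of _ d] distrib_left mult.assoc)
  note m1 = cp_map_smult[OF abs_ge_zero S(2), of c] and m2 = cp_map_smult[OF abs_ge_zero S(3), of c]
  have nn: "0 \<le> \<bar>c\<bar> * J" using S(1) by simp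
  show ?thesis
  proof (cases "0 \<le> c")
    case True
    show ?thesis
    proof (rule cp_boundedI[OF nn m1 m2 _ *])
      fix X :: "complex mat" assume X: "X \<in> carrier_mat d d"
      show "complex_of_real c \<cdot>\<^sub>m S X = complex_of_real \<bar>c\<bar> \<cdot>\<^sub>m S1 X - complex_of_real \<bar>c\<bar> \<cdot>\<^sub>m S2 X"
        unfolding S(4)[OF X] using True cp_map_carrier[OF S(2) X] cp_map_carrier[OF S(3) X]
        by (intro eq_matI) (auto simp: right_diff_distrib)
    qed
  next
    case False
    show ?thesis
    proof (rule cp_boundedI[OF nn m2 m1])
      fix X :: "complex mat" assume X: "X \<in> carrier_mat d d"
      show "complex_of_real c \<cdot>\<^sub>m S X = complex_of_real \<bar>c\<bar> \<cdot>\<^sub>m S2 X - complex_of_real \<bar>c\<bar> \<cdot>\<^sub>m S1 X"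
        unfolding S(4)[OF X] using False cp_map_carrier[OF S(2) X] cp_map_carrier[OF S(3) X]
        by (intro eq_matI) (auto simp: right_diff_distrib)
    qed (use * in \<open>simp add: add.commute\<close>)
  qed
qed

text \<open>Expanding (S1 - S2)(T1 - T2) gives S1 T1 + S2 T2 as positive part and S1 T2 + S2 T1 as
  negative part. The bound for S is then applied at T1 X and T2 X, which are positive.\<close>

lemma cp_bounded_comp:
  assumes "cp_bounded d S J" "cp_bounded d T K"
  shows "cp_bounded d (\<lambda>X. S (T X)) (J * K)"
proof -
  from assms(1) obtain S1 S2 where S: "0 \<le> J" "cp_map d S1" "cp_map d S2" "\<And>X. X \<in> carrier_mat d d \<Longrightarrow> S X = S1 X - S2 X"
    "\<And>X. psd d X \<Longrightarrow> Re (trace (S1 X)) + Re (trace (S2 X)) \<le> J * Re (trace X)"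
    by (rule cp_boundedE) blast
  from assms(2) obtain T1 T2 where T: "0 \<le> K" "cp_map d T1" "cp_map d T2" "\<And>X. X \<in> carrier_mat d d \<Longrightarrow> T X = T1 X - T2 X"
    "\<And>X. psd d X \<Longrightarrow> Re (trace (T1 X)) + Re (trace (T2 X)) \<le> K * Re (trace X)"
    by (rule cp_boundedE) blast
  note cS1 = cp_map_carrier[OF S(2)] and cS2 = cp_map_carrier[OF S(3)]
    and cT1 = cp_map_carrier[OF T(2)] and cT2 = cp_map_carrier[OF T(3)]
  have lS: "linear_superop d d S1" "linear_superop d d S2" using S by (simp_all add: cp_map_def)
  show ?thesis
  proof (rule cp_boundedI)
    show "0 \<le> J * K" using S T by simp
    show "cp_map d (\<lambda>X. (S1 \<circ> T1) X + (S2 \<circ> T2) X)" "cp_map d (\<lambda>X. (S1 \<circ> T2) X + (S2 \<circ> T1) X)"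
      using S T by (intro cp_map_add cp_map_comp; simp)+
    fix X
    show "S (T X) = (S1 \<circ> T1) X + (S2 \<circ> T2) X - ((S1 \<circ> T2) X + (S2 \<circ> T1) X)" if X: "X \<in> carrier_mat d d"
    proof -
      have "T X \<in> carrier_mat d d" by (rule cp_bounded_carrier[OF assms(2) X])
      then have "S (T X) = S1 (T1 X - T2 X) - S2 (T1 X - T2 X)" by (simp add: S(4) T(4)[OF X])
      also have "\<dots> = (S1 (T1 X) - S1 (T2 X)) - (S2 (T1 X) - S2 (T2 X))"
        by (simp add: linear_superop_diff[OF lS(1) cT1[OF X] cT2[OF X]] linear_superop_diff[OF lS(2) cT1[OF X] cT2[OF X]])
      also have "\<dots> = (S1 \<circ> T1) X + (S2 \<circ> T2) X - ((S1 \<circ> T2) X + (S2 \<circ> T1) X)"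
        using cS1[OF cT1[OF X]] cS1[OF cT2[OF X]] cS2[OF cT1[OF X]] cS2[OF cT2[OF X]]
        by (intro eq_matI) auto
      finally show ?thesis .
    qed
    show "Re (trace ((S1 \<circ> T1) X + (S2 \<circ> T2) X)) + Re (trace ((S1 \<circ> T2) X + (S2 \<circ> T1) X)) \<le> J * K * Re (trace X)"
      if P: "psd d X"
    proof -
      have X: "X \<in> carrier_mat d d" by (rule psd_carrier[OF P])
      have "Re (trace ((S1 \<circ> T1) X + (S2 \<circ> T2) X)) + Re (trace ((S1 \<circ> T2) X + (S2 \<circ> T1) X)) =
        (Re (trace (S1 (T1 X))) + Re (trace (S2 (T1 X)))) + (Re (trace (S1 (T2 X))) + Re (trace (S2 (T2 X))))"
        using cS1[OF cT1[OF X]] cS1[OF cT2[OF X]] cS2[OF cT1[OF X]] cS2[OF cT2[OF X]]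
        by (simp add: trace_add[of _ d])
      also have "\<dots> \<le> J * Re (trace (T1 X)) + J * Re (trace (T2 X))"
        by (intro add_mono S(5) psd_cp_map[OF T(2) P] psd_cp_map[OF T(3) P])
      also have "\<dots> = J * (Re (trace (T1 X)) + Re (trace (T2 X)))" by (simp add: distrib_left)
      also have "\<dots> \<le> J * (K * Re (trace X))" by (intro mult_left_mono T(5) P S(1))
      finally show ?thesis by (simp add: mult.assoc)
    qed
  qed
qed

lemma cp_bounded_funpow: "cp_bounded d T K \<Longrightarrow> cp_bounded d (T ^^ k) (K ^ k)"
proof (induction k)
  case 0
  then show ?case using cp_bounded_id by (simp add: id_def)
next
  case (Suc k)
  then show ?case using cp_bounded_comp[OF Suc.prems Suc.IH[OF Suc.prems]] by (simp add: o_def)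
qed

text \<open>Every entry of a positive X is at most its trace in modulus, and the trace of the image
  is a sum of |I| d^3 terms.\<close>

lemma cp_bounded_kraus_map:
  assumes a: "\<And>x i k. x \<in> I \<Longrightarrow> i < d \<Longrightarrow> k < d \<Longrightarrow> cmod (a x i k) \<le> b" and "0 \<le> b"
  shows "cp_bounded d (kraus_map I a d d) (real (card I) * real d ^ 3 * b\<^sup>2)"
proof (rule cp_bounded_cp_map[OF cp_map_kraus_map])
  show "0 \<le> real (card I) * real d ^ 3 * b\<^sup>2" by simp
  fix X assume X: "psd d X"
  have eq: "trace (kraus_map I a d d X) = (\<Sum>i<d. \<Sum>x\<in>I. \<Sum>k<d. \<Sum>l<d. a x i k * X $$ (k, l) * cnj (a x i l))"
    unfolding trace_carrier[OF kraus_map_carrier] by (intro sum.cong refl) (simp add: kraus_map_index)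
  have "Re (trace (kraus_map I a d d X)) \<le> cmod (trace (kraus_map I a d d X))" by (rule complex_Re_le_cmod)
  also have "\<dots> \<le> (\<Sum>i<d. \<Sum>x\<in>I. \<Sum>k<d. \<Sum>l<d. b * Re (trace X) * b)"
    unfolding eq
  proof (intro sum_norm_le)
    fix i x k l assume "i \<in> {..<d}" "x \<in> I" "k \<in> {..<d}" "l \<in> {..<d}"
    then show "cmod (a x i k * X $$ (k, l) * cnj (a x i l)) \<le> b * Re (trace X) * b"
      unfolding norm_mult complex_mod_cnj
      by (intro mult_mono a psd_norm_index_le_trace[OF X] mult_nonneg_nonneg norm_ge_zero psd_Re_trace_nonneg[OF X] \<open>0 \<le> b\<close>) auto
  qed
  also have "\<dots> = real (card I) * real d ^ 3 * b\<^sup>2 * Re (trace X)"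
    by (simp add: power2_eq_square power3_eq_cube)
  finally show "Re (trace (kraus_map I a d d X)) \<le> real (card I) * real d ^ 3 * b\<^sup>2 * Re (trace X)" .
qed

text \<open>Over the diagonal blocks of \<rho> the trace bounds add up to K M times Tr \<rho> = 1,
  whatever the size r of the reference system. The map E enters through its entries alone, so the
  exponential series never has to be decomposed into positive parts.\<close>

lemma diamond_dist_le_limit:
  assumes S: "\<And>M. cp_bounded d (\<lambda>X. S M X - T X) (K M)" and Klim: "K \<longlonglongrightarrow> c"
    and lim: "\<And>X i j. X \<in> carrier_mat d d \<Longrightarrow> i < d \<Longrightarrow> j < d \<Longrightarrow> (\<lambda>M. S M X $$ (i, j)) \<longlonglongrightarrow> E X $$ (i, j)"
    and Tc: "\<And>X. X \<in> carrier_mat d d \<Longrightarrow> T X \<in> carrier_mat d d"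
  shows "diamond_dist d E T \<le> ereal c"
  unfolding diamond_dist_def
proof (rule SUP_least, clarsimp)
  fix r :: nat and \<rho> assume r: "0 < r" and \<rho>: "density_operator (r * d) \<rho>"
  have psd: "psd (r * d) \<rho>" and tr: "trace \<rho> = 1" using \<rho> by (simp_all add: density_operator_def)
  have "\<forall>M. \<exists>T1 T2. cp_map d T1 \<and> cp_map d T2 \<and> (\<forall>X\<in>carrier_mat d d. S M X - T X = T1 X - T2 X) \<and>
     (\<forall>X. psd d X \<longrightarrow> Re (trace (T1 X)) + Re (trace (T2 X)) \<le> K M * Re (trace X))"
    using S by (simp add: cp_bounded_def)
  then obtain T1 T2 where T1: "\<And>M. cp_map d (T1 M)" and T2: "\<And>M. cp_map d (T2 M)"
    and eq: "\<And>M X. X \<in> carrier_mat d d \<Longrightarrow> S M X - T X = T1 M X - T2 M X"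
    and le: "\<And>M X. psd d X \<Longrightarrow> Re (trace (T1 M X)) + Re (trace (T2 M X)) \<le> K M * Re (trace X)"
    by metis
  have lin: "linear_superop d d (T1 M)" "linear_superop d d (T2 M)" for M
    using T1[of M] T2[of M] by (simp_all add: cp_map_def)
  show "trace_norm (ampliation r d d E \<rho> - ampliation r d d T \<rho>) \<le> c"
  proof (rule trace_norm_le_limit[where P = "\<lambda>M. ampliation r d d (T1 M) \<rho>" and Q = "\<lambda>M. ampliation r d d (T2 M) \<rho>", OF _ _ _ _ _ Klim])
    show "ampliation r d d E \<rho> - ampliation r d d T \<rho> \<in> carrier_mat (r * d) (r * d)"
      by (rule minus_carrier_mat) simp
    show "psd (r * d) (ampliation r d d (T1 M) \<rho>)" "psd (r * d) (ampliation r d d (T2 M) \<rho>)" for M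
      using T1[of M] T2[of M] psd by (auto simp: cp_map_def completely_positive_def)
    show "Re (trace (ampliation r d d (T1 M) \<rho>)) + Re (trace (ampliation r d d (T2 M) \<rho>)) \<le> K M" for M
    proof -
      have "Re (trace (ampliation r d d (T1 M) \<rho>)) + Re (trace (ampliation r d d (T2 M) \<rho>)) =
        (\<Sum>i<r. Re (trace (T1 M (block d \<rho> i i))) + Re (trace (T2 M (block d \<rho> i i))))"
        by (simp add: trace_ampliation[OF lin(1)] trace_ampliation[OF lin(2)] sum.distrib)
      also have "\<dots> \<le> (\<Sum>i<r. K M * Re (trace (block d \<rho> i i)))"
        by (intro sum_mono le psd_block[OF psd]) simp
      also have "\<dots> = K M * Re (\<Sum>i<r. trace (block d \<rho> i i))" by (simp add: sum_distrib_left)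
      also have "\<dots> = K M" unfolding trace_blocks[OF psd_carrier[OF psd]] tr by simp
      finally show ?thesis .
    qed
    fix i j assume ij: "i < r * d" "j < r * d"
    note dm = div_mod_less[OF ij(1)] div_mod_less[OF ij(2)]
    let ?B = "block d \<rho> (i div d) (j div d)"
    have "ampliation r d d (T1 M) \<rho> $$ (i, j) - ampliation r d d (T2 M) \<rho> $$ (i, j) = S M ?B $$ (i mod d, j mod d) - T ?B $$ (i mod d, j mod d)" for M
    proof -
      have "S M ?B $$ (i mod d, j mod d) - T ?B $$ (i mod d, j mod d) = (S M ?B - T ?B) $$ (i mod d, j mod d)"
        using Tc[of ?B] dm by simp
      also have "\<dots> = T1 M ?B $$ (i mod d, j mod d) - T2 M ?B $$ (i mod d, j mod d)"
        unfolding eq[OF block_carrier] using carrier_matD[OF linear_superopD(1)[OF lin(2) block_carrier], of M \<rho>] dm by simp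
      finally show ?thesis using ij by (simp add: ampliation_def)
    qed
    moreover have "(\<lambda>M. S M ?B $$ (i mod d, j mod d) - T ?B $$ (i mod d, j mod d)) \<longlonglongrightarrow> E ?B $$ (i mod d, j mod d) - T ?B $$ (i mod d, j mod d)"
      by (intro tendsto_intros lim block_carrier dm)
    ultimately show "(\<lambda>M. ampliation r d d (T1 M) \<rho> $$ (i, j) - ampliation r d d (T2 M) \<rho> $$ (i, j)) \<longlonglongrightarrow>
      (ampliation r d d E \<rho> - ampliation r d d T \<rho>) $$ (i, j)"
      using ij by (simp add: ampliation_def)
  qed
qed

section \<open>Iterated small steps and the exponential series\<close>

lemma quantum_channel_funpow: "quantum_channel d d T \<Longrightarrow> quantum_channel d d (T ^^ k)"
  by (induction k) (auto simp: id_def quantum_channel_id intro: quantum_channel_comp)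

lemma linear_superop_id: "linear_superop m m (\<lambda>X. X)"
  by (simp add: linear_superop_def)

lemma linear_superop_funpow: "linear_superop d d T \<Longrightarrow> linear_superop d d (T ^^ k)"
  by (induction k) (auto simp: id_def linear_superop_id intro: linear_superop_comp)

text \<open>S^(n+1) - T^(n+1) = S (S^n - T^n) + (S - T) T^n, and channels have bound 1, so the
  errors add up without being amplified.\<close>

lemma cp_bounded_funpow_diff:
  assumes S: "quantum_channel d d S" and T: "quantum_channel d d T"
    and diff: "cp_bounded d (\<lambda>X. S X - T X) K"
  shows "cp_bounded d (\<lambda>X. (S ^^ n) X - (T ^^ n) X) (real n * K)"
proof (induction n)
  case 0
  have "cp_bounded d (\<lambda>X. complex_of_real 0 \<cdot>\<^sub>m X) 0"
    using cp_bounded_smult[OF cp_bounded_id, of d 0] by simp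
  then have "cp_bounded d (\<lambda>X. (S ^^ 0) X - (T ^^ 0) X) 0"
    by (rule cp_bounded_cong) (auto intro!: eq_matI)
  then show ?case by simp
next
  case (Suc n)
  have lS: "linear_superop d d S" "linear_superop d d T" using S T by (simp_all add: quantum_channel_def)
  have "cp_bounded d (T ^^ n) 1" using cp_bounded_funpow[OF cp_bounded_channel[OF T], of n] by simp
  from cp_bounded_add[OF cp_bounded_comp[OF cp_bounded_channel[OF S] Suc.IH] cp_bounded_comp[OF diff this]]
  have "cp_bounded d (\<lambda>X. S ((S ^^ n) X - (T ^^ n) X) + (S ((T ^^ n) X) - T ((T ^^ n) X))) (real (Suc n) * K)"
    by (simp add: distrib_right add.commute)
  then show ?case
  proof (rule cp_bounded_cong)
    fix X :: "complex mat" assume X: "X \<in> carrier_mat d d"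
    have c: "(S ^^ n) X \<in> carrier_mat d d" "(T ^^ n) X \<in> carrier_mat d d"
      using linear_superopD(1)[OF linear_superop_funpow[OF lS(1)] X] linear_superopD(1)[OF linear_superop_funpow[OF lS(2)] X] .
    have c2: "S ((S ^^ n) X) \<in> carrier_mat d d" "S ((T ^^ n) X) \<in> carrier_mat d d" "T ((T ^^ n) X) \<in> carrier_mat d d"
      using linear_superopD(1)[OF lS(1) c(1)] linear_superopD(1)[OF lS(1) c(2)] linear_superopD(1)[OF lS(2) c(2)] .
    show "(S ^^ Suc n) X - (T ^^ Suc n) X = S ((S ^^ n) X - (T ^^ n) X) + (S ((T ^^ n) X) - T ((T ^^ n) X))"
      unfolding linear_superop_diff[OF lS(1) c] using c2 by (intro eq_matI) auto
  qed
qed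

text \<open>With Phi = 1 + B and E_m the second-order remainder of Phi^m, E_(m+1) = Phi E_m + m B^2.
  The bound is the corresponding remainder of \<open>(1 + \<beta>) ^ m\<close>, which satisfies the
  scalar version of this recursion exactly.\<close>

lemma cp_bounded_second_order:
  assumes B: "cp_bounded d B \<beta>" and lB: "linear_superop d d B"
  shows "cp_bounded d (\<lambda>X. ((\<lambda>X. X + B X) ^^ m) X - (X + complex_of_real (real m) \<cdot>\<^sub>m B X)) ((1 + \<beta>) ^ m - 1 - real m * \<beta>)"
proof (induction m)
  case 0
  have "cp_bounded d (\<lambda>X. complex_of_real 0 \<cdot>\<^sub>m X) 0"
    using cp_bounded_smult[OF cp_bounded_id, of d 0] by simp
  then have "cp_bounded d (\<lambda>X. ((\<lambda>X. X + B X) ^^ 0) X - (X + complex_of_real (real 0) \<cdot>\<^sub>m B X)) 0"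
  proof (rule cp_bounded_cong)
    fix X :: "complex mat" assume X: "X \<in> carrier_mat d d"
    show "((\<lambda>X. X + B X) ^^ 0) X - (X + complex_of_real (real 0) \<cdot>\<^sub>m B X) = complex_of_real 0 \<cdot>\<^sub>m X"
      using carrier_matD[OF X] carrier_matD[OF linear_superopD(1)[OF lB X]] by (intro eq_matI) auto
  qed
  then show ?case by simp
next
  case (Suc m)
  let ?\<Phi> = "\<lambda>X. X + B X"
  have l\<Phi>: "linear_superop d d ?\<Phi>" by (rule linear_superop_add[OF linear_superop_id lB])
  have b\<Phi>: "cp_bounded d ?\<Phi> (1 + \<beta>)" by (rule cp_bounded_add[OF cp_bounded_id B])
  have "cp_bounded d (\<lambda>X. ?\<Phi> ((?\<Phi> ^^ m) X - (X + complex_of_real (real m) \<cdot>\<^sub>m B X)) + complex_of_real (real m) \<cdot>\<^sub>m B (B X))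
     ((1 + \<beta>) * ((1 + \<beta>) ^ m - 1 - real m * \<beta>) + \<bar>real m\<bar> * (\<beta> * \<beta>))"
    by (rule cp_bounded_add[OF cp_bounded_comp[OF b\<Phi> Suc.IH] cp_bounded_smult[OF cp_bounded_comp[OF B B]]])
  also have "(1 + \<beta>) * ((1 + \<beta>) ^ m - 1 - real m * \<beta>) + \<bar>real m\<bar> * (\<beta> * \<beta>) = (1 + \<beta>) ^ Suc m - 1 - real (Suc m) * \<beta>"
    by (simp add: algebra_simps)
  finally show ?case
  proof (rule cp_bounded_cong)
    fix X :: "complex mat" assume X: "X \<in> carrier_mat d d"
    let ?m = "complex_of_real (real m)"
    note cB = linear_superopD(1)[OF lB]
    have c: "(?\<Phi> ^^ m) X \<in> carrier_mat d d" by (rule linear_superopD(1)[OF linear_superop_funpow[OF l\<Phi>] X])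
    have mB: "?m \<cdot>\<^sub>m B X \<in> carrier_mat d d" using cB[OF X] by simp
    have c2: "X + ?m \<cdot>\<^sub>m B X \<in> carrier_mat d d" using X mB by simp
    note cc = X cB[OF X] cB[OF cB[OF X]] c cB[OF c]
    have 1: "B (X + ?m \<cdot>\<^sub>m B X) = B X + ?m \<cdot>\<^sub>m B (B X)"
      using linear_superopD(2)[OF lB X mB] linear_superopD(3)[OF lB cB[OF X]] by simp
    have "?\<Phi> ((?\<Phi> ^^ m) X - (X + ?m \<cdot>\<^sub>m B X)) = (?\<Phi> ^^ m) X - (X + ?m \<cdot>\<^sub>m B X) + (B ((?\<Phi> ^^ m) X) - (B X + ?m \<cdot>\<^sub>m B (B X)))"
      unfolding linear_superop_diff[OF lB c c2] 1 ..
    then show "(?\<Phi> ^^ Suc m) X - (X + complex_of_real (real (Suc m)) \<cdot>\<^sub>m B X) =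
       ?\<Phi> ((?\<Phi> ^^ m) X - (X + ?m \<cdot>\<^sub>m B X)) + ?m \<cdot>\<^sub>m B (B X)"
      using cc carrier_matD[OF cc(1)] carrier_matD[OF cc(2)] carrier_matD[OF cc(3)] carrier_matD[OF cc(4)] carrier_matD[OF cc(5)]
      by (intro eq_matI) (auto simp: algebra_simps)
  qed
qed

section \<open>Entrywise convergence to the exponential series\<close>

definition matrix_unit :: "nat \<Rightarrow> nat \<Rightarrow> nat \<Rightarrow> complex mat" where
  "matrix_unit m k l = mat m m (\<lambda>p. if p = (k, l) then 1 else 0)"

text \<open>Linearity is given for binary sums, so the expansion in matrix units is an induction on
  a set F of positions supporting X. It supplies continuity and boundedness in the entries, which
  stand in for a topology on matrices.\<close>

lemma linear_superop_index:
  assumes T: "linear_superop m n T" and X: "X \<in> carrier_mat m m" and ij: "i < n" "j < n"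
  shows "T X $$ (i, j) = (\<Sum>k<m. \<Sum>l<m. X $$ (k, l) * T (matrix_unit m k l) $$ (i, j))"
proof -
  have gen: "X \<in> carrier_mat m m \<longrightarrow> (\<forall>k<m. \<forall>l<m. (k, l) \<notin> F \<longrightarrow> X $$ (k, l) = 0) \<longrightarrow>
     T X $$ (i, j) = (\<Sum>(k, l)\<in>F. X $$ (k, l) * T (matrix_unit m k l) $$ (i, j))"
    if "finite F" "F \<subseteq> {..<m} \<times> {..<m}" for F X
    using that
  proof (induction F arbitrary: X rule: finite_induct)
    case empty
    show ?case
    proof (intro impI)
      assume X: "X \<in> carrier_mat m m" and z: "\<forall>k<m. \<forall>l<m. (k, l) \<notin> {} \<longrightarrow> X $$ (k, l) = 0"
      then have "X = 0 \<cdot>\<^sub>m X" by (intro eq_matI) auto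
      then have "T X = 0 \<cdot>\<^sub>m T X" using linear_superopD(3)[OF T X, of 0] by simp
      then have "T X $$ (i, j) = (0 \<cdot>\<^sub>m T X) $$ (i, j)" by simp
      then show "T X $$ (i, j) = (\<Sum>(k, l)\<in>{}. X $$ (k, l) * T (matrix_unit m k l) $$ (i, j))"
        using linear_superopD(1)[OF T X] ij by simp
    qed
  next
    case (insert p F)
    obtain k l where p: "p = (k, l)" by (cases p)
    have kl: "k < m" "l < m" using insert.prems p by auto
    show ?case
    proof (intro impI)
      assume X: "X \<in> carrier_mat m m" and z: "\<forall>k<m. \<forall>l<m. (k, l) \<notin> insert p F \<longrightarrow> X $$ (k, l) = 0"
      \<comment> \<open>X with the new position erased, hence supported on \<open>F\<close>.\<close>
      define Y where "Y = mat m m (\<lambda>q. if q = p then 0 else X $$ q)"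
      have Y: "Y \<in> carrier_mat m m" by (simp add: Y_def)
      have U: "matrix_unit m k l \<in> carrier_mat m m" by (simp add: matrix_unit_def)
      have XY: "X = Y + X $$ (k, l) \<cdot>\<^sub>m matrix_unit m k l"
        using X by (intro eq_matI) (auto simp: Y_def matrix_unit_def p)
      have "T X = T Y + X $$ (k, l) \<cdot>\<^sub>m T (matrix_unit m k l)"
        using arg_cong[OF XY, of T] linear_superopD(2)[OF T Y, of "X $$ (k, l) \<cdot>\<^sub>m matrix_unit m k l"] linear_superopD(3)[OF T U] U by simp
      then have "T X $$ (i, j) = (T Y + X $$ (k, l) \<cdot>\<^sub>m T (matrix_unit m k l)) $$ (i, j)" by simp
      also have "\<dots> = T Y $$ (i, j) + X $$ (k, l) * T (matrix_unit m k l) $$ (i, j)"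
        using linear_superopD(1)[OF T Y] linear_superopD(1)[OF T U] ij by simp
      also have "T Y $$ (i, j) = (\<Sum>(k, l)\<in>F. Y $$ (k, l) * T (matrix_unit m k l) $$ (i, j))"
        using insert.IH[of Y] insert.prems Y z by (auto simp: Y_def)
      also have "\<dots> = (\<Sum>(k, l)\<in>F. X $$ (k, l) * T (matrix_unit m k l) $$ (i, j))"
        using insert.hyps insert.prems by (intro sum.cong refl) (auto simp: Y_def)
      finally show "T X $$ (i, j) = (\<Sum>(k, l)\<in>insert p F. X $$ (k, l) * T (matrix_unit m k l) $$ (i, j))"
        using insert.hyps by (simp add: p add.commute)
    qed
  qed
  have "T X $$ (i, j) = (\<Sum>(k, l)\<in>{..<m} \<times> {..<m}. X $$ (k, l) * T (matrix_unit m k l) $$ (i, j))"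
    using gen[of "{..<m} \<times> {..<m}" X] X by simp
  then show ?thesis by (simp add: sum.cartesian_product)
qed

lemma tendsto_linear_superop:
  assumes T: "linear_superop m n T" and X: "\<And>M. X M \<in> carrier_mat m m" "Y \<in> carrier_mat m m"
    and lim: "\<And>k l. k < m \<Longrightarrow> l < m \<Longrightarrow> (\<lambda>M. X M $$ (k, l)) \<longlonglongrightarrow> Y $$ (k, l)" and ij: "i < n" "j < n"
  shows "(\<lambda>M. T (X M) $$ (i, j)) \<longlonglongrightarrow> T Y $$ (i, j)"
  unfolding linear_superop_index[OF T X(1) ij] linear_superop_index[OF T X(2) ij]
  by (intro tendsto_intros lim) auto

definition entry_norm :: "nat \<Rightarrow> complex mat \<Rightarrow> real" where
  "entry_norm d X = (\<Sum>i<d. \<Sum>j<d. cmod (X $$ (i, j)))"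

lemma entry_norm_nonneg: "0 \<le> entry_norm d X"
  by (simp add: entry_norm_def sum_nonneg)

lemma norm_index_le_entry_norm:
  assumes "i < d" "j < d" shows "cmod (X $$ (i, j)) \<le> entry_norm d X"
proof -
  have "cmod (X $$ (i, j)) \<le> (\<Sum>j<d. cmod (X $$ (i, j)))" using assms by (intro member_le_sum) auto
  also have "\<dots> \<le> entry_norm d X" unfolding entry_norm_def
    using assms by (intro member_le_sum[of i "{..<d}" "\<lambda>i. \<Sum>j<d. cmod (X $$ (i, j))"]) (auto intro: sum_nonneg)
  finally show ?thesis .
qed

lemma entry_norm_add:
  "X \<in> carrier_mat d d \<Longrightarrow> Y \<in> carrier_mat d d \<Longrightarrow> entry_norm d (X + Y) \<le> entry_norm d X + entry_norm d Y"
  unfolding entry_norm_def sum.distrib[symmetric] by (intro sum_mono) (simp add: norm_triangle_ineq)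

lemma entry_norm_smult:
  "X \<in> carrier_mat d d \<Longrightarrow> entry_norm d (c \<cdot>\<^sub>m X) = cmod c * entry_norm d X"
  unfolding entry_norm_def sum_distrib_left by (intro sum.cong refl) (simp add: norm_mult)

lemma linear_superop_bounded:
  assumes T: "linear_superop d d T"
  shows "\<exists>c\<ge>0. \<forall>X\<in>carrier_mat d d. entry_norm d (T X) \<le> c * entry_norm d X"
proof (intro exI conjI ballI)
  let ?c = "\<Sum>k<d. \<Sum>l<d. entry_norm d (T (matrix_unit d k l))"
  show "0 \<le> ?c" by (intro sum_nonneg entry_norm_nonneg)
  fix X :: "complex mat" assume X: "X \<in> carrier_mat d d"
  have "entry_norm d (T X) \<le> (\<Sum>i<d. \<Sum>j<d. \<Sum>k<d. \<Sum>l<d. cmod (T (matrix_unit d k l) $$ (i, j)) * cmod (X $$ (k, l)))"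
    unfolding entry_norm_def
  proof (intro sum_mono)
    fix i j assume "i \<in> {..<d}" "j \<in> {..<d}"
    then have ij: "i < d" "j < d" by auto
    show "cmod (T X $$ (i, j)) \<le> (\<Sum>k<d. \<Sum>l<d. cmod (T (matrix_unit d k l) $$ (i, j)) * cmod (X $$ (k, l)))"
      unfolding linear_superop_index[OF T X ij] by (intro sum_norm_le) (simp add: norm_mult)
  qed
  also have "\<dots> \<le> (\<Sum>i<d. \<Sum>j<d. \<Sum>k<d. \<Sum>l<d. cmod (T (matrix_unit d k l) $$ (i, j)) * entry_norm d X)"
    by (intro sum_mono mult_left_mono norm_index_le_entry_norm) auto
  also have "\<dots> = (\<Sum>k<d. \<Sum>l<d. \<Sum>i<d. \<Sum>j<d. cmod (T (matrix_unit d k l) $$ (i, j)) * entry_norm d X)"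
    by (rule sum_swap_pairs)
  also have "\<dots> = ?c * entry_norm d X"
    unfolding entry_norm_def[of d "T _"] sum_distrib_right ..
  finally show "entry_norm d (T X) \<le> ?c * entry_norm d X" .
qed

text \<open>The binomial theorem, as c B commutes with the identity. One step is split off on the
  inside, so the induction hypothesis is used at X + c B X and Pascal's rule joins the two
  sums.\<close>

lemma funpow_add_smult_binomial:
  assumes B: "linear_superop d d B" and ij: "i < d" "j < d"
  shows "X \<in> carrier_mat d d \<Longrightarrow> ((\<lambda>X. X + c \<cdot>\<^sub>m B X) ^^ M) X $$ (i, j) =
    (\<Sum>k\<le>M. of_nat (M choose k) * (c ^ k * (B ^^ k) X $$ (i, j)))"
proof (induction M arbitrary: X)
  case 0
  then show ?case by simp
next
  case (Suc M)
  let ?\<Phi> = "\<lambda>X. X + c \<cdot>\<^sub>m B X"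
  define g where "g k = c ^ k * (B ^^ k) X $$ (i, j)" for k
  have BX: "B X \<in> carrier_mat d d" "c \<cdot>\<^sub>m B X \<in> carrier_mat d d"
    using linear_superopD(1)[OF B Suc.prems] by simp_all
  have pw: "(B ^^ k) (?\<Phi> X) $$ (i, j) = (B ^^ k) X $$ (i, j) + c * (B ^^ Suc k) X $$ (i, j)" for k
  proof -
    note Bk = linear_superop_funpow[OF B, of k]
    have "(B ^^ k) (?\<Phi> X) = (B ^^ k) X + c \<cdot>\<^sub>m (B ^^ k) (B X)"
      using linear_superopD(2)[OF Bk Suc.prems BX(2)] linear_superopD(3)[OF Bk BX(1)] by simp
    then show ?thesis
      using linear_superopD(1)[OF Bk Suc.prems] linear_superopD(1)[OF Bk BX(1)] ij by (simp add: funpow_swap1)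
  qed
  have "(?\<Phi> ^^ Suc M) X $$ (i, j) = (?\<Phi> ^^ M) (?\<Phi> X) $$ (i, j)" by (simp only: funpow_Suc_right o_apply)
  also have "\<dots> = (\<Sum>k\<le>M. of_nat (M choose k) * (c ^ k * (B ^^ k) (?\<Phi> X) $$ (i, j)))"
    using Suc.prems BX by (intro Suc.IH) simp
  also have "\<dots> = (\<Sum>k\<le>M. of_nat (M choose k) * g k) + (\<Sum>k\<le>M. of_nat (M choose k) * g (Suc k))"
    unfolding sum.distrib[symmetric] by (intro sum.cong refl) (simp add: pw g_def algebra_simps)
  \<comment> \<open>The added term vanishes because \<open>M choose Suc M = 0\<close>.\<close>
  also have "(\<Sum>k\<le>M. of_nat (M choose k) * g k) = (\<Sum>k\<le>Suc M. of_nat (M choose k) * g k)" by simp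
  also have "\<dots> = g 0 + (\<Sum>k\<le>M. of_nat (M choose Suc k) * g (Suc k))"
    by (subst sum.atMost_Suc_shift) simp
  also have "g 0 + (\<Sum>k\<le>M. of_nat (M choose Suc k) * g (Suc k)) + (\<Sum>k\<le>M. of_nat (M choose k) * g (Suc k)) =
    (\<Sum>k\<le>Suc M. of_nat (Suc M choose k) * g k)"
    by (subst sum.atMost_Suc_shift) (simp add: sum.distrib algebra_simps)
  finally show ?case by (simp add: g_def)
qed

text \<open>Dominated convergence for series (Tannery's theorem): cut where the tail of w is below
  e/3 and use convergence on the finitely many terms before the cut.\<close>

lemma tendsto_suminf_dominated:
  fixes f :: "nat \<Rightarrow> nat \<Rightarrow> 'a::banach"
  assumes lim: "\<And>k. (\<lambda>M. f M k) \<longlonglongrightarrow> g k" and bd: "\<And>M k. norm (f M k) \<le> w k" and w: "summable w"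
  shows "(\<lambda>M. \<Sum>k. f M k) \<longlonglongrightarrow> (\<Sum>k. g k)"
proof (rule LIMSEQ_I)
  fix e :: real assume e: "0 < e"
  have bg: "norm (g k) \<le> w k" for k
    by (rule LIMSEQ_le_const2[OF tendsto_norm[OF lim]]) (use bd in auto)
  have sf: "summable (f M)" for M by (rule summable_comparison_test'[OF w]) (rule bd)
  have sg: "summable g" by (rule summable_comparison_test'[OF w]) (rule bg)
  obtain K where K: "norm (\<Sum>i. w (i + K)) < e / 3"
    using suminf_exist_split[OF _ w, of "e / 3"] e by auto
  have wK: "summable (\<lambda>i. w (i + K))" using w by (simp add: summable_iff_shift)
  have tf: "norm (\<Sum>i. f M (i + K)) < e / 3" for M
  proof -
    have "norm (\<Sum>i. f M (i + K)) \<le> (\<Sum>i. w (i + K))" by (rule norm_suminf_le[OF _ wK]) (rule bd)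
    then show ?thesis using K by simp
  qed
  have tg: "norm (\<Sum>i. g (i + K)) < e / 3"
  proof -
    have "norm (\<Sum>i. g (i + K)) \<le> (\<Sum>i. w (i + K))" by (rule norm_suminf_le[OF _ wK]) (rule bg)
    then show ?thesis using K by simp
  qed
  have "(\<lambda>M. \<Sum>k<K. f M k) \<longlonglongrightarrow> (\<Sum>k<K. g k)" by (intro tendsto_sum lim)
  from LIMSEQ_D[OF this, of "e / 3"] e
  obtain N where N: "\<And>M. N \<le> M \<Longrightarrow> norm ((\<Sum>k<K. f M k) - (\<Sum>k<K. g k)) < e / 3"
    by (metis zero_less_divide_iff zero_less_numeral)
  show "\<exists>N. \<forall>M\<ge>N. norm ((\<Sum>k. f M k) - (\<Sum>k. g k)) < e"
  proof (intro exI allI impI)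
    fix M assume "N \<le> M"
    have "(\<Sum>k. f M k) - (\<Sum>k. g k) = ((\<Sum>k<K. f M k) - (\<Sum>k<K. g k)) + ((\<Sum>i. f M (i + K)) - (\<Sum>i. g (i + K)))"
      using suminf_split_initial_segment[OF sf, of M K] suminf_split_initial_segment[OF sg, of K] by simp
    also have "norm \<dots> \<le> norm ((\<Sum>k<K. f M k) - (\<Sum>k<K. g k)) + (norm (\<Sum>i. f M (i + K)) + norm (\<Sum>i. g (i + K)))"
      by (intro norm_triangle_le add_left_mono norm_triangle_ineq4)
    also have "\<dots> < e" using N[OF \<open>N \<le> M\<close>] tf[of M] tg by simp
    finally show "norm ((\<Sum>k. f M k) - (\<Sum>k. g k)) < e" .
  qed
qed

text \<open>For fixed k this is a product of k factors (M - i)(t/M)/(k - i), each tending to t/(k -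
  i).\<close>

lemma tendsto_binomial_coefficient:
  "(\<lambda>M. real (M choose k) * (t / real M) ^ k) \<longlonglongrightarrow> t ^ k / fact k"
proof -
  have one: "(\<lambda>M. real (M - i) * (t / real M)) \<longlonglongrightarrow> t" for i
  proof -
    have "(\<lambda>M. t - t * (real i / real M)) \<longlonglongrightarrow> t - t * 0"
      by (intro tendsto_intros lim_const_over_n)
    \<comment> \<open>From \<open>Suc i\<close> on, the subtraction of naturals is not truncated and
      M is not zero.\<close>
    moreover have "eventually (\<lambda>M. t - t * (real i / real M) = real (M - i) * (t / real M)) sequentially"
      using eventually_ge_at_top[of "Suc i"] by eventually_elim (simp add: field_simps of_nat_diff)
    ultimately show ?thesis using Lim_transform_eventually by fastforce
  qed
  have "(\<lambda>M. \<Prod>i=0..<k. real (M - i) * (t / real M) / real (k - i)) \<longlonglongrightarrow> (\<Prod>i=0..<k. t / real (k - i))"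
    by (intro tendsto_prod tendsto_divide one tendsto_const) auto
  also have "(\<Prod>i=0..<k. t / real (k - i)) = t ^ k / fact k"
    by (simp add: prod_dividef fact_prod_rev)
  finally have lim: "(\<lambda>M. \<Prod>i=0..<k. real (M - i) * (t / real M) / real (k - i)) \<longlonglongrightarrow> t ^ k / fact k" .
  have "eventually (\<lambda>M. (\<Prod>i=0..<k. real (M - i) * (t / real M) / real (k - i)) = real (M choose k) * (t / real M) ^ k) sequentially"
    using eventually_ge_at_top[of k]
    by eventually_elim (simp add: binomial_altdef_of_nat prod_dividef prod.distrib power_divide)
  then show ?thesis by (rule Lim_transform_eventually[OF lim])
qed

lemma binomial_coefficient_le:
  assumes "0 \<le> t" shows "real (M choose k) * (t / real M) ^ k \<le> t ^ k / fact k"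
proof (cases "M = 0")
  \<comment> \<open>Here \<open>t / 0 = 0\<close>, and the left side is 1 for k = 0 and 0
    otherwise.\<close>
  case True
  then show ?thesis using assms by (cases k) auto
next
  case False
  have "real ((M choose k) * fact k) \<le> real (M ^ k)" by (simp only: of_nat_le_iff binomial_fact_pow)
  then have "real (M choose k) * fact k * t ^ k \<le> real M ^ k * t ^ k"
    using assms by (intro mult_right_mono) auto
  then show ?thesis using False by (simp add: field_simps power_divide)
qed

text \<open>The M-th approximation has generator B_M = A + (t/M) R, which tends to A; this is how
  the second-order term disappears in the limit. After binomial expansion the k-th term converges
  for each k and is dominated by (t b)^k / k! times the norm of X.\<close>

lemma funpow_tendsto_exp_superop:
  assumes A: "linear_superop d d A" and R: "linear_superop d d R" and t: "0 \<le> t"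
    and X: "X \<in> carrier_mat d d" and ij: "i < d" "j < d"
  shows "(\<lambda>M. ((\<lambda>X. X + complex_of_real (t / real M) \<cdot>\<^sub>m (A X + complex_of_real (t / real M) \<cdot>\<^sub>m R X)) ^^ M) X $$ (i, j))
    \<longlonglongrightarrow> exp_superop d A t X $$ (i, j)"
proof -
  define B where "B M = (\<lambda>X. A X + complex_of_real (t / real M) \<cdot>\<^sub>m R X)" for M
  have B_app: "B M Y = A Y + complex_of_real (t / real M) \<cdot>\<^sub>m R Y" for M Y by (simp add: B_def)
  have lB: "linear_superop d d (B M)" for M
    unfolding B_def by (intro linear_superop_add linear_superop_smult A R)
  obtain cA where cA: "0 \<le> cA" "\<And>X. X \<in> carrier_mat d d \<Longrightarrow> entry_norm d (A X) \<le> cA * entry_norm d X"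
    using linear_superop_bounded[OF A] by blast
  obtain cR where cR: "0 \<le> cR" "\<And>X. X \<in> carrier_mat d d \<Longrightarrow> entry_norm d (R X) \<le> cR * entry_norm d X"
    using linear_superop_bounded[OF R] by blast
  \<comment> \<open>As \<open>t / real M \<le> t\<close> for every M (the quotient being 0 at M =
    0), this bounds all \<open>B M\<close> at once.\<close>
  define b where "b = cA + t * cR"
  have b0: "0 \<le> b" using cA cR t by (simp add: b_def)
  have tM: "0 \<le> t / real M" "t / real M \<le> t" for M
    using t mult_left_mono[of 1 "real M" t] by (cases "M = 0"; simp add: divide_le_eq)+
  have bB: "entry_norm d (B M X) \<le> b * entry_norm d X" if X: "X \<in> carrier_mat d d" for M X
  proof -
    have "entry_norm d (B M X) \<le> entry_norm d (A X) + t / real M * entry_norm d (R X)"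
      using entry_norm_add[of "A X" d "complex_of_real (t / real M) \<cdot>\<^sub>m R X"] linear_superopD(1)[OF A X] linear_superopD(1)[OF R X] tM[of M]
      by (simp add: B_def entry_norm_smult norm_divide del: of_real_divide)
    also have "\<dots> \<le> cA * entry_norm d X + t * (cR * entry_norm d X)"
      using tM[of M] t by (intro add_mono mult_mono cA cR X entry_norm_nonneg) auto
    finally show ?thesis by (simp add: b_def algebra_simps)
  qed
  have cBk: "(B M ^^ k) X \<in> carrier_mat d d" for M k by (rule linear_superopD(1)[OF linear_superop_funpow[OF lB] X])
  have bBk: "entry_norm d ((B M ^^ k) X) \<le> b ^ k * entry_norm d X" for M k
  proof (induction k)
    case (Suc k)
    have "entry_norm d ((B M ^^ Suc k) X) \<le> b * entry_norm d ((B M ^^ k) X)" using bB[OF cBk] by simp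
    also have "\<dots> \<le> b * (b ^ k * entry_norm d X)" by (intro mult_left_mono Suc b0)
    finally show ?case by (simp add: mult.assoc)
  qed simp
  have cAk: "(A ^^ k) X \<in> carrier_mat d d" for k by (rule linear_superopD(1)[OF linear_superop_funpow[OF A] X])
  have limB: "(\<lambda>M. (B M ^^ k) X $$ (i, j)) \<longlonglongrightarrow> (A ^^ k) X $$ (i, j)" if "i < d" "j < d" for i j k
    using that
  proof (induction k arbitrary: i j)
    case (Suc k)
    have t0: "(\<lambda>M. complex_of_real (t / real M)) \<longlonglongrightarrow> complex_of_real 0"
      by (intro tendsto_of_real lim_const_over_n)
    have "(\<lambda>M. A ((B M ^^ k) X) $$ (i, j) + complex_of_real (t / real M) * R ((B M ^^ k) X) $$ (i, j)) \<longlonglongrightarrow>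
      A ((A ^^ k) X) $$ (i, j) + complex_of_real 0 * R ((A ^^ k) X) $$ (i, j)"
      by (intro tendsto_add tendsto_mult t0 tendsto_linear_superop[OF A] tendsto_linear_superop[OF R] cBk cAk Suc)
    moreover have "(B M ^^ Suc k) X $$ (i, j) = A ((B M ^^ k) X) $$ (i, j) + complex_of_real (t / real M) * R ((B M ^^ k) X) $$ (i, j)" for M
    proof -
      have "(B M ^^ Suc k) X = B M ((B M ^^ k) X)" by simp
      also have "\<dots> = A ((B M ^^ k) X) + complex_of_real (t / real M) \<cdot>\<^sub>m R ((B M ^^ k) X)"
        by (rule B_app)
      finally show ?thesis
        using carrier_matD[OF linear_superopD(1)[OF R cBk]] Suc.prems by simp
    qed
    ultimately show ?case by simp
  qed simp
  \<comment> \<open>The finite binomial sum extended by zero to a series over all k.\<close>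
  define f where "f M k = (if k \<le> M then complex_of_real (real (M choose k) * (t / real M) ^ k) * (B M ^^ k) X $$ (i, j) else 0)" for M k
  have "(\<lambda>M. \<Sum>k. f M k) \<longlonglongrightarrow> (\<Sum>k. complex_of_real (t ^ k / fact k) * (A ^^ k) X $$ (i, j))"
  proof (rule tendsto_suminf_dominated)
    fix k
    have "(\<lambda>M. complex_of_real (real (M choose k) * (t / real M) ^ k) * (B M ^^ k) X $$ (i, j)) \<longlonglongrightarrow>
      complex_of_real (t ^ k / fact k) * (A ^^ k) X $$ (i, j)"
      by (intro tendsto_mult tendsto_of_real tendsto_binomial_coefficient limB ij)
    moreover have "eventually (\<lambda>M. complex_of_real (real (M choose k) * (t / real M) ^ k) * (B M ^^ k) X $$ (i, j) = f M k) sequentially"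
      using eventually_ge_at_top[of k] by eventually_elim (simp add: f_def)
    ultimately show "(\<lambda>M. f M k) \<longlonglongrightarrow> complex_of_real (t ^ k / fact k) * (A ^^ k) X $$ (i, j)"
      by (rule Lim_transform_eventually)
    show "cmod (f M k) \<le> t ^ k / fact k * (b ^ k * entry_norm d X)" for M
    proof (cases "k \<le> M")
      case True
      have "cmod (f M k) = real (M choose k) * (t / real M) ^ k * cmod ((B M ^^ k) X $$ (i, j))"
        using True tM(1)[of M] by (simp only: f_def if_True norm_mult norm_of_real abs_of_nonneg mult_nonneg_nonneg zero_le_power of_nat_0_le_iff)
      also have "\<dots> \<le> t ^ k / fact k * (b ^ k * entry_norm d X)"
        using order_trans[OF norm_index_le_entry_norm[OF ij] bBk] t b0
        by (intro mult_mono binomial_coefficient_le) (auto intro!: divide_nonneg_nonneg)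
      finally show ?thesis .
    next
      case False
      then show ?thesis using t b0 by (simp add: f_def entry_norm_nonneg)
    qed
    have "summable (\<lambda>k. (t * b) ^ k /\<^sub>R fact k * entry_norm d X)"
      by (intro summable_mult2 summable_exp_generic)
    then show "summable (\<lambda>k. t ^ k / fact k * (b ^ k * entry_norm d X))"
      by (simp add: power_mult_distrib divide_inverse mult_ac)
  qed
  moreover have "(\<Sum>k. f M k) = ((\<lambda>X. X + complex_of_real (t / real M) \<cdot>\<^sub>m B M X) ^^ M) X $$ (i, j)" for M
  proof -
    have "(\<Sum>k. f M k) = (\<Sum>k\<le>M. f M k)" by (rule suminf_finite) (auto simp: f_def)
    also have "\<dots> = ((\<lambda>X. X + complex_of_real (t / real M) \<cdot>\<^sub>m B M X) ^^ M) X $$ (i, j)"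
      unfolding funpow_add_smult_binomial[OF lB ij X] by (intro sum.cong refl) (simp add: f_def)
    finally show ?thesis .
  qed
  ultimately show ?thesis using ij by (simp add: exp_superop_def B_def)
qed

section \<open>Comparison of a step with its refinement\<close>

definition taylor_step :: "superop \<Rightarrow> superop \<Rightarrow> real \<Rightarrow> superop" where
  "taylor_step A R h X = X + (complex_of_real h \<cdot>\<^sub>m A X + complex_of_real (h\<^sup>2) \<cdot>\<^sub>m R X)"

lemma taylor_step_funpow_tendsto:
  assumes A: "linear_superop d d A" and R: "linear_superop d d R" and t: "0 \<le> t"
    and X: "X \<in> carrier_mat d d" and ij: "i < d" "j < d"
  shows "(\<lambda>M. (taylor_step A R (t / real M) ^^ M) X $$ (i, j)) \<longlonglongrightarrow> exp_superop d A t X $$ (i, j)"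
proof -
  define S where "S h = (\<lambda>X. X + complex_of_real h \<cdot>\<^sub>m (A X + complex_of_real h \<cdot>\<^sub>m R X))" for h
  \<comment> \<open>\<open>S h\<close> factors h out of the increment. That identity is checked on d
    x d matrices, so the carrier is part of the induction.\<close>
  have "(taylor_step A R h ^^ M) X = (S h ^^ M) X \<and> (S h ^^ M) X \<in> carrier_mat d d" for h M
  proof (induction M)
    case (Suc M)
    define Y where "Y = (S h ^^ M) X"
    have Y: "Y \<in> carrier_mat d d" using Suc by (simp add: Y_def)
    note c = linear_superopD(1)[OF A Y] linear_superopD(1)[OF R Y]
    have "taylor_step A R h Y = S h Y" unfolding taylor_step_def S_def
      using carrier_matD[OF Y] carrier_matD[OF c(1)] carrier_matD[OF c(2)]
      by (intro eq_matI) (auto simp: algebra_simps power2_eq_square)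
    moreover have "S h Y \<in> carrier_mat d d" using Y c by (simp add: S_def)
    ultimately show ?case using Suc by (simp add: Y_def)
  qed (use X in simp)
  then show ?thesis using funpow_tendsto_exp_superop[OF A R t X ij] by (simp add: S_def)
qed

text \<open>\<open>1 + \<beta> \<le> exp \<beta>\<close>, followed by exp x <= 1 + x + x^2 on
  [0, 1].\<close>

lemma exp_second_order_le:
  assumes "0 \<le> \<beta>" "real m * \<beta> \<le> 1"
  shows "(1 + \<beta>) ^ m - 1 - real m * \<beta> \<le> (real m * \<beta>)\<^sup>2"
proof -
  have "(1 + \<beta>) ^ m \<le> exp \<beta> ^ m" using assms by (intro power_mono exp_ge_add_one_self) auto
  also have "\<dots> = exp (real m * \<beta>)" by (rule exp_of_nat_mult[symmetric])
  also have "\<dots> \<le> 1 + real m * \<beta> + (real m * \<beta>)\<^sup>2" using assms by (intro exp_bound) auto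
  finally show ?thesis by simp
qed

text \<open>Let M = m + 1 and g = h/M. To first order the M fine steps add h A + h g R, which misses
  the coarse step by (h g - h^2) R, a map of bound at most h^2 \<rho>. Their second-order remainder
  is at most (M \<beta>)^2, hence at most (h (\<alpha> + \<rho>))^2. Neither bound depends on
  m.\<close>

lemma cp_bounded_taylor_step_refinement:
  assumes lA: "linear_superop d d A" and lR: "linear_superop d d R"
    and A: "cp_bounded d A \<alpha>" and R: "cp_bounded d R \<rho>"
    and h: "0 \<le> h" "h \<le> 1" "h * (\<alpha> + \<rho>) \<le> 1"
  shows "cp_bounded d (\<lambda>X. (taylor_step A R (h / real (Suc m)) ^^ Suc m) X - taylor_step A R h X) (((\<alpha> + \<rho>)\<^sup>2 + \<rho>) * h\<^sup>2)"
proof -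
  define M where "M = real (Suc m)"
  have M: "1 \<le> M" by (simp add: M_def)
  define g where "g = h / M"
  have g: "0 \<le> g" "M * g = h" using h M by (simp_all add: g_def)
  define B where "B = (\<lambda>X. complex_of_real g \<cdot>\<^sub>m A X + complex_of_real (g\<^sup>2) \<cdot>\<^sub>m R X)"
  have lB: "linear_superop d d B" unfolding B_def by (intro linear_superop_add linear_superop_smult lA lR)
  note nn = cp_bounded_nonneg[OF A] cp_bounded_nonneg[OF R]
  define \<beta> where "\<beta> = g * \<alpha> + g\<^sup>2 * \<rho>"
  have \<beta>0: "0 \<le> \<beta>" using nn g by (simp add: \<beta>_def)
  have B: "cp_bounded d B \<beta>"
    using cp_bounded_add[OF cp_bounded_smult[OF A, of g] cp_bounded_smult[OF R, of "g\<^sup>2"]] g(1)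
    by (simp add: B_def \<beta>_def)
  have gh: "g \<le> h" using M h by (simp add: g_def divide_le_eq mult_le_cancel_left1)
  have Mg2: "M * g\<^sup>2 = h * g" using g(2) by (simp add: power2_eq_square mult.assoc[symmetric])
  have hg: "0 \<le> h * g" "h * g \<le> h\<^sup>2" using h g gh by (auto simp: power2_eq_square intro: mult_left_mono)
  have "M * \<beta> = h * \<alpha> + h * g * \<rho>"
    using Mg2 g(2) by (simp add: \<beta>_def distrib_left mult.assoc[symmetric])
  also have "\<dots> \<le> h * \<alpha> + h * 1 * \<rho>"
    using nn h gh by (intro add_left_mono mult_right_mono mult_left_mono) auto
  finally have M\<beta>: "M * \<beta> \<le> h * (\<alpha> + \<rho>)" by (simp add: distrib_left)
  have "(1 + \<beta>) ^ Suc m - 1 - real (Suc m) * \<beta> \<le> (real (Suc m) * \<beta>)\<^sup>2"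
    using M\<beta> h(3) by (intro exp_second_order_le \<beta>0) (simp add: M_def)
  also have "\<dots> \<le> (h * (\<alpha> + \<rho>))\<^sup>2"
    using M\<beta> \<beta>0 unfolding M_def by (intro power_mono) auto
  finally have b1: "(1 + \<beta>) ^ Suc m - 1 - real (Suc m) * \<beta> \<le> (h * (\<alpha> + \<rho>))\<^sup>2" .
  have b2: "\<bar>h * g - h\<^sup>2\<bar> * \<rho> \<le> h\<^sup>2 * \<rho>"
    using hg nn by (intro mult_right_mono) auto
  have "cp_bounded d (\<lambda>X. (((\<lambda>X. X + B X) ^^ Suc m) X - (X + complex_of_real (real (Suc m)) \<cdot>\<^sub>m B X)) +
    complex_of_real (h * g - h\<^sup>2) \<cdot>\<^sub>m R X) ((h * (\<alpha> + \<rho>))\<^sup>2 + h\<^sup>2 * \<rho>)"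
    by (intro cp_bounded_add cp_bounded_mono[OF cp_bounded_second_order[OF B lB] b1] cp_bounded_mono[OF cp_bounded_smult[OF R] b2])
  also have "(h * (\<alpha> + \<rho>))\<^sup>2 + h\<^sup>2 * \<rho> = ((\<alpha> + \<rho>)\<^sup>2 + \<rho>) * h\<^sup>2"
    unfolding power_mult_distrib distrib_right[of "(\<alpha> + \<rho>)\<^sup>2" \<rho>] by (simp only: mult.commute)
  finally show ?thesis
  proof (rule cp_bounded_cong)
    fix X :: "complex mat" assume X: "X \<in> carrier_mat d d"
    have ts: "taylor_step A R (h / real (Suc m)) = (\<lambda>X. X + B X)"
      by (simp add: taylor_step_def B_def g_def M_def fun_eq_iff)
    define Y where "Y = ((\<lambda>X. X + B X) ^^ Suc m) X"
    have Y: "Y \<in> carrier_mat d d"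
      unfolding Y_def by (intro linear_superopD(1)[OF linear_superop_funpow X] linear_superop_add linear_superop_id lB)
    note c = linear_superopD(1)[OF lA X] linear_superopD(1)[OF lR X]
    have e1: "complex_of_real (real (Suc m)) * complex_of_real g = complex_of_real h"
      unfolding of_real_mult[symmetric] using g(2) by (simp only: M_def)
    have e2: "complex_of_real (real (Suc m)) * complex_of_real (g\<^sup>2) = complex_of_real (h * g)"
      unfolding of_real_mult[symmetric] using Mg2 by (simp only: M_def)
    have "Y - taylor_step A R h X = (Y - (X + complex_of_real (real (Suc m)) \<cdot>\<^sub>m B X)) + complex_of_real (h * g - h\<^sup>2) \<cdot>\<^sub>m R X"
    proof (rule eq_matI)
      fix i j assume "i < dim_row (Y - (X + complex_of_real (real (Suc m)) \<cdot>\<^sub>m B X) + complex_of_real (h * g - h\<^sup>2) \<cdot>\<^sub>m R X)"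
        "j < dim_col (Y - (X + complex_of_real (real (Suc m)) \<cdot>\<^sub>m B X) + complex_of_real (h * g - h\<^sup>2) \<cdot>\<^sub>m R X)"
      then have ij: "i < d" "j < d" using carrier_matD[OF c(2)] by simp_all
      have "(Y - (X + complex_of_real (real (Suc m)) \<cdot>\<^sub>m B X) + complex_of_real (h * g - h\<^sup>2) \<cdot>\<^sub>m R X) $$ (i, j) =
        Y $$ (i, j) - (X $$ (i, j) + (complex_of_real (real (Suc m)) * complex_of_real g * A X $$ (i, j) +
          complex_of_real (real (Suc m)) * complex_of_real (g\<^sup>2) * R X $$ (i, j))) + (complex_of_real (h * g) - complex_of_real (h\<^sup>2)) * R X $$ (i, j)"
        using carrier_matD[OF X] carrier_matD[OF c(1)] carrier_matD[OF c(2)] carrier_matD[OF Y] ij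
        unfolding of_real_diff by (simp add: B_def distrib_left mult.assoc del: of_nat_Suc of_real_of_nat_eq of_real_mult of_real_power)
      also have "\<dots> = Y $$ (i, j) - (X $$ (i, j) + (complex_of_real h * A X $$ (i, j) + complex_of_real (h\<^sup>2) * R X $$ (i, j)))"
        unfolding e1 e2 by (simp add: left_diff_distrib)
      also have "\<dots> = (Y - taylor_step A R h X) $$ (i, j)"
        using carrier_matD[OF X] carrier_matD[OF c(1)] carrier_matD[OF c(2)] carrier_matD[OF Y] ij
        by (simp add: taylor_step_def)
      finally show "(Y - taylor_step A R h X) $$ (i, j) =
        (Y - (X + complex_of_real (real (Suc m)) \<cdot>\<^sub>m B X) + complex_of_real (h * g - h\<^sup>2) \<cdot>\<^sub>m R X) $$ (i, j)" ..
    qed (use carrier_matD[OF X] carrier_matD[OF c(1)] carrier_matD[OF c(2)] carrier_matD[OF Y] in \<open>simp_all add: taylor_step_def\<close>)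
    then show "(taylor_step A R (h / real (Suc m)) ^^ Suc m) X - taylor_step A R h X =
      (((\<lambda>X. X + B X) ^^ Suc m) X - (X + complex_of_real (real (Suc m)) \<cdot>\<^sub>m B X)) + complex_of_real (h * g - h\<^sup>2) \<cdot>\<^sub>m R X"
      unfolding ts Y_def .
  qed
qed

text \<open>Each coarse step is replaced by its refinement, and telescoping over n steps costs a
  factor n. Channels are required for all sizes up to h because the refined steps, too, must not
  amplify errors.\<close>

lemma diamond_dist_exp_superop_taylor_step:
  assumes lA: "linear_superop d d A" and lR: "linear_superop d d R"
    and A: "cp_bounded d A \<alpha>" and R: "cp_bounded d R \<rho>"
    and h: "0 \<le> h" "h \<le> 1" "h * (\<alpha> + \<rho>) \<le> 1" and n: "0 < n"
    and chan: "\<And>s. 0 \<le> s \<Longrightarrow> s \<le> h \<Longrightarrow> quantum_channel d d (taylor_step A R s)"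
  shows "diamond_dist d (exp_superop d A (real n * h)) (taylor_step A R h ^^ n) \<le> ereal (real n * (((\<alpha> + \<rho>)\<^sup>2 + \<rho>) * h\<^sup>2))"
proof (rule diamond_dist_le_limit)
  let ?S = "\<lambda>m. taylor_step A R (h / real (Suc m)) ^^ Suc m"
  have hs: "0 \<le> h / real (Suc m)" "h / real (Suc m) \<le> h" for m
    using h by (auto simp: divide_le_eq mult_le_cancel_left1)
  have cS: "quantum_channel d d (?S m)" for m by (rule quantum_channel_funpow[OF chan[OF hs]])
  have cT: "quantum_channel d d (taylor_step A R h)" using chan h by simp
  show "cp_bounded d (\<lambda>X. ((?S m) ^^ n) X - (taylor_step A R h ^^ n) X) (real n * (((\<alpha> + \<rho>)\<^sup>2 + \<rho>) * h\<^sup>2))" for m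
    by (intro cp_bounded_funpow_diff cS cT cp_bounded_taylor_step_refinement lA lR A R h)
  show "(\<lambda>m. real n * (((\<alpha> + \<rho>)\<^sup>2 + \<rho>) * h\<^sup>2)) \<longlonglongrightarrow> real n * (((\<alpha> + \<rho>)\<^sup>2 + \<rho>) * h\<^sup>2)" by simp
  show "(taylor_step A R h ^^ n) X \<in> carrier_mat d d" if "X \<in> carrier_mat d d" for X
    using quantum_channel_funpow[OF cT, of n] linear_superopD(1)[OF _ that] by (simp add: quantum_channel_def)
  fix X :: "complex mat" and i j assume X: "X \<in> carrier_mat d d" and ij: "i < d" "j < d"
  \<comment> \<open>n blocks of \<open>Suc m\<close> fine steps are \<open>Suc m * n\<close> steps
    towards time n h, so the refined evolutions form a subsequence of the approximations to the
    exponential at that time.\<close>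
  have "strict_mono (\<lambda>m. Suc m * n)" using n by (auto simp: strict_mono_Suc_iff)
  from LIMSEQ_subseq_LIMSEQ[OF taylor_step_funpow_tendsto[OF lA lR _ X ij, of "real n * h"] this]
  have "(\<lambda>m. (taylor_step A R (real n * h / real (Suc m * n)) ^^ (Suc m * n)) X $$ (i, j)) \<longlonglongrightarrow> exp_superop d A (real n * h) X $$ (i, j)"
    using h by (simp add: o_def)
  moreover have "real n * h / real (Suc m * n) = h / real (Suc m)" for m
    using n unfolding of_nat_mult mult.commute[of "real (Suc m)"]
    by (intro mult_divide_mult_cancel_left) simp
  ultimately show "(\<lambda>m. ((?S m) ^^ n) X $$ (i, j)) \<longlonglongrightarrow> exp_superop d A (real n * h) X $$ (i, j)"
    by (simp only: funpow_mult)
qed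

section \<open>Kronecker products and the program state\<close>

lemma quantum_channel_cong:
  assumes "quantum_channel m n \<Phi>" and eq: "\<And>X. X \<in> carrier_mat m m \<Longrightarrow> \<Psi> X = \<Phi> X"
  shows "quantum_channel m n \<Psi>"
proof -
  have "ampliation r m n \<Psi> X = ampliation r m n \<Phi> X" for r X
    by (simp add: ampliation_def eq)
  then show ?thesis using assms
    by (simp add: quantum_channel_def linear_superop_def completely_positive_def trace_preserving_def)
qed

lemma linear_superop_cong:
  "linear_superop m n \<Phi> \<Longrightarrow> (\<And>X. X \<in> carrier_mat m m \<Longrightarrow> \<Psi> X = \<Phi> X) \<Longrightarrow> linear_superop m n \<Psi>"
  by (simp add: linear_superop_def)

lemma diamond_dist_cong:
  assumes "\<And>X. X \<in> carrier_mat d d \<Longrightarrow> T X = T' X"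
  shows "diamond_dist d E T = diamond_dist d E T'"
proof -
  have "ampliation r d d T X = ampliation r d d T' X" for r X by (simp add: ampliation_def assms)
  then show ?thesis by (simp add: diamond_dist_def)
qed

lemma kron_carrier: "A \<in> carrier_mat m n \<Longrightarrow> B \<in> carrier_mat p q \<Longrightarrow> kron A B \<in> carrier_mat (m * p) (n * q)"
  by (auto simp: kron_def)

lemma kron_index:
  assumes "A \<in> carrier_mat m n" "B \<in> carrier_mat p q" "i < m * p" "j < n * q"
  shows "kron A B $$ (i, j) = A $$ (i div p, j div q) * B $$ (i mod p, j mod q)"
  using assms carrier_matD[OF assms(1)] carrier_matD[OF assms(2)] by (simp add: kron_def)

text \<open>Regroups S (x) (copy (x) rest) as (S (x) copy) (x) rest, so that a step can act on the
  first copy.\<close>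

lemma kron_assoc:
  assumes A: "A \<in> carrier_mat m m" and B: "B \<in> carrier_mat n n" and C: "C \<in> carrier_mat p p"
  shows "kron A (kron B C) = kron (kron A B) C"
proof (rule eq_matI)
  note AB = kron_carrier[OF A B] and BC = kron_carrier[OF B C]
  show dims: "dim_row (kron A (kron B C)) = dim_row (kron (kron A B) C)" "dim_col (kron A (kron B C)) = dim_col (kron (kron A B) C)"
    using carrier_matD[OF kron_carrier[OF A BC]] carrier_matD[OF kron_carrier[OF AB C]] by (simp_all add: mult.assoc)
  fix i j assume "i < dim_row (kron (kron A B) C)" "j < dim_col (kron (kron A B) C)"
  then have ij: "i < m * n * p" "j < m * n * p" using carrier_matD[OF kron_carrier[OF AB C]] by simp_all
  then have ij': "i < m * (n * p)" "j < m * (n * p)" by (simp_all add: mult.assoc)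
  note dm = div_mod_less[OF ij(1)] div_mod_less[OF ij(2)] div_mod_less[OF ij'(1)] div_mod_less[OF ij'(2)]
  have p: "0 < p" using ij(1) by (cases p) auto
  have m2: "k mod (n * p) = p * (k div p mod n) + k mod p" for k
    using mod_mult2_eq[of k p n] by (simp only: mult.commute)
  have nat_eqs: "k div (n * p) = k div p div n" "k mod (n * p) div p = k div p mod n" "k mod (n * p) mod p = k mod p" for k
    using p div_mult2_eq[of k p n] unfolding m2 by (simp_all only: mult.commute) simp_all
  show "kron A (kron B C) $$ (i, j) = kron (kron A B) C $$ (i, j)"
    unfolding kron_index[OF A BC ij'] kron_index[OF AB C ij] kron_index[OF B C dm(6,8)] kron_index[OF A B dm(1,3)] nat_eqs
    by (simp add: mult.assoc)
qed

lemma kron_one: "A \<in> carrier_mat m n \<Longrightarrow> kron A (1\<^sub>m 1) = A"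
  by (rule eq_matI) (auto simp: kron_def)

lemma kron_pow_carrier: "A \<in> carrier_mat D D \<Longrightarrow> kron_pow A n \<in> carrier_mat (D ^ n) (D ^ n)"
  by (induction n) (auto intro: kron_carrier)

lemma trace_kron:
  assumes A: "A \<in> carrier_mat m m" and B: "B \<in> carrier_mat n n"
  shows "trace (kron A B) = trace A * trace B"
proof -
  have "trace (kron A B) = (\<Sum>i<m. \<Sum>a<n. A $$ (i, i) * B $$ (a, a))"
    unfolding trace_carrier[OF kron_carrier[OF A B]] sum_lessThan_mult
    by (intro sum.cong refl) (simp add: kron_index[OF A B] index_less_mult)
  then show ?thesis by (simp add: trace_carrier[OF A] trace_carrier[OF B] sum_product)
qed

definition right_ampliation :: "nat \<Rightarrow> ('x \<Rightarrow> nat \<Rightarrow> nat \<Rightarrow> complex) \<Rightarrow> 'x \<Rightarrow> nat \<Rightarrow> nat \<Rightarrow> complex" where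
  "right_ampliation q a x i k = (if i mod q = k mod q then a x (i div q) (k div q) else 0)"

lemma kraus_map_right_ampliation:
  assumes Y: "Y \<in> carrier_mat m m" and Z: "Z \<in> carrier_mat q q"
  shows "kraus_map I (right_ampliation q a) (m * q) (n * q) (kron Y Z) = kron (kraus_map I a m n Y) Z"
proof (rule eq_matI)
  note K = kron_carrier[OF kraus_map_carrier[of I a m n Y] Z]
  show "dim_row (kraus_map I (right_ampliation q a) (m * q) (n * q) (kron Y Z)) = dim_row (kron (kraus_map I a m n Y) Z)"
    "dim_col (kraus_map I (right_ampliation q a) (m * q) (n * q) (kron Y Z)) = dim_col (kron (kraus_map I a m n Y) Z)"
    using carrier_matD[OF K] by simp_all
  fix i j assume "i < dim_row (kron (kraus_map I a m n Y) Z)" "j < dim_col (kron (kraus_map I a m n Y) Z)"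
  then have ij: "i < n * q" "j < n * q" using carrier_matD[OF K] by simp_all
  note dm = div_mod_less[OF ij(1)] div_mod_less[OF ij(2)]
  have "kraus_map I (right_ampliation q a) (m * q) (n * q) (kron Y Z) $$ (i, j) =
    (\<Sum>x\<in>I. \<Sum>k<m. \<Sum>c<q. \<Sum>l<m. \<Sum>e<q. if i mod q = c then if j mod q = e then
       a x (i div q) k * (Y $$ (k, l) * Z $$ (c, e)) * cnj (a x (j div q) l) else 0 else 0)"
    unfolding kraus_map_index[OF ij] sum_lessThan_mult
    by (intro sum.cong refl) (auto simp: right_ampliation_def kron_index[OF Y Z] index_less_mult)
  also have "\<dots> = (\<Sum>x\<in>I. \<Sum>k<m. \<Sum>l<m. a x (i div q) k * (Y $$ (k, l) * Z $$ (i mod q, j mod q)) * cnj (a x (j div q) l))"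
    using dm by (simp add: sum_if_const)
  also have "\<dots> = kron (kraus_map I a m n Y) Z $$ (i, j)"
    unfolding kron_index[OF kraus_map_carrier Z ij] kraus_map_index[OF dm(1,3)] sum_distrib_right
    by (intro sum.cong refl) simp
  finally show "kraus_map I (right_ampliation q a) (m * q) (n * q) (kron Y Z) $$ (i, j) = kron (kraus_map I a m n Y) Z $$ (i, j)" .
qed

lemma right_ampliation_isometry:
  assumes a: "\<And>k l. k < m \<Longrightarrow> l < m \<Longrightarrow> (\<Sum>x\<in>I. \<Sum>i<n. a x i k * cnj (a x i l)) = (if k = l then 1 else 0)"
    and kl: "k < m * q" "l < m * q"
  shows "(\<Sum>x\<in>I. \<Sum>i<n * q. right_ampliation q a x i k * cnj (right_ampliation q a x i l)) = (if k = l then 1 else 0)"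
proof -
  note dm = div_mod_less[OF kl(1)] div_mod_less[OF kl(2)]
  have "(\<Sum>x\<in>I. \<Sum>i<n * q. right_ampliation q a x i k * cnj (right_ampliation q a x i l)) =
    (\<Sum>x\<in>I. \<Sum>i<n. \<Sum>c<q. if k mod q = c then if k mod q = l mod q then a x i (k div q) * cnj (a x i (l div q)) else 0 else 0)"
    unfolding sum_lessThan_mult by (intro sum.cong refl) (auto simp: right_ampliation_def)
  also have "\<dots> = (if k mod q = l mod q then \<Sum>x\<in>I. \<Sum>i<n. a x i (k div q) * cnj (a x i (l div q)) else 0)"
    using dm by (simp add: sum_if_const)
  also have "\<dots> = (if k mod q = l mod q \<and> k div q = l div q then 1 else 0)"
    using dm by (simp add: a)
  also have "(k mod q = l mod q \<and> k div q = l div q) \<longleftrightarrow> k = l"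
    by (metis div_mult_mod_eq)
  finally show ?thesis .
qed

text \<open>Fixing a pure state v in the second factor replaces each a_x by a_x (1 (x) |v>), again a
  family of Kraus operators.\<close>

lemma kraus_map_kron_ket_bra:
  assumes X: "X \<in> carrier_mat m m" and v: "dim_vec v = D"
  shows "kraus_map I a (m * D) n (kron X (ket_bra v)) = kraus_map I (\<lambda>x i s. \<Sum>c<D. a x i (s * D + c) * v $ c) m n X"
proof (rule eq_matI; simp?)
  fix i j assume ij: "i < n" "j < n"
  have V: "ket_bra v \<in> carrier_mat D D" using v by (simp add: ket_bra_def)
  have idx: "ket_bra v $$ (c, e) = v $ c * cnj (v $ e)" if "c < D" "e < D" for c e
    using v that by (simp add: ket_bra_def)
  have "kraus_map I a (m * D) n (kron X (ket_bra v)) $$ (i, j) =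
    (\<Sum>x\<in>I. \<Sum>k<m. \<Sum>c<D. \<Sum>l<m. \<Sum>e<D. (a x i (k * D + c) * v $ c) * X $$ (k, l) * cnj (a x j (l * D + e) * v $ e))"
    unfolding kraus_map_index[OF ij] sum_lessThan_mult using v
    by (intro sum.cong refl) (simp add: kron_index[OF X V] index_less_mult idx)
  also have "\<dots> = (\<Sum>x\<in>I. \<Sum>k<m. \<Sum>l<m. \<Sum>c<D. \<Sum>e<D. (a x i (k * D + c) * v $ c) * X $$ (k, l) * cnj (a x j (l * D + e) * v $ e))"
    by (rule sum.cong[OF refl], rule sum.cong[OF refl], rule sum.swap)
  also have "\<dots> = kraus_map I (\<lambda>x i s. \<Sum>c<D. a x i (s * D + c) * v $ c) m n X $$ (i, j)"
    unfolding kraus_map_index[OF ij] cnj_sum sum_distrib_right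
    by (intro sum.cong refl) (simp add: sum_distrib_left)
  finally show "kraus_map I a (m * D) n (kron X (ket_bra v)) $$ (i, j) =
    kraus_map I (\<lambda>x i s. \<Sum>c<D. a x i (s * D + c) * v $ c) m n X $$ (i, j)" .
qed

lemma index_max_entangled:
  assumes "i < d * d" shows "max_entangled d $ i = (if i div d = i mod d then 1 else 0)"
proof -
  note dm = div_mod_less[OF assms]
  have "max_entangled d $ i = (\<Sum>j<d. kron_vec (unit_vec d j) (unit_vec d j) $ i)"
    unfolding max_entangled_def using assms
    by (intro index_finsum_vec) (auto simp: kron_vec_def)
  also have "\<dots> = (\<Sum>j<d. if j = i div d then if i div d = i mod d then 1 else 0 else 0)"
    using assms dm by (intro sum.cong refl) (auto simp: kron_vec_def)
  also have "\<dots> = (if i div d = i mod d then 1 else 0)" using dm by simp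
  finally show ?thesis .
qed

lemma dim_max_entangled: "dim_vec (max_entangled d) = d * d"
proof -
  have "max_entangled d \<in> carrier_vec (d * d)"
    unfolding max_entangled_def by (intro finsum_vec_closed Pi_I carrier_vecI) (simp add: kron_vec_def)
  then show ?thesis by (rule carrier_vecD)
qed

text \<open>The program vector is the row-by-row vectorization of L: a copy carries the entries of L
  as amplitudes.\<close>

lemma program_vec_index:
  assumes L: "L \<in> carrier_mat d d" and pq: "p < d" "q < d"
  shows "program_vec d L $ (p * d + q) = L $$ (p, q)"
proof -
  have K: "kron L (1\<^sub>m d) \<in> carrier_mat (d * d) (d * d)" by (rule kron_carrier[OF L]) simp
  have "program_vec d L $ (p * d + q) = (\<Sum>k<d * d. kron L (1\<^sub>m d) $$ (p * d + q, k) * max_entangled d $ k)"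
    using index_less_mult[OF pq] carrier_matD[OF K]
    by (simp add: program_vec_def scalar_prod_def dim_max_entangled atLeast0LessThan)
  also have "\<dots> = (\<Sum>r<d. \<Sum>s<d. if q = s then if r = s then L $$ (p, r) else 0 else 0)"
    unfolding sum_lessThan_mult using pq
    by (intro sum.cong refl) (auto simp: kron_index[OF L one_carrier_mat] index_less_mult index_max_entangled)
  also have "\<dots> = L $$ (p, q)" using pq by simp
  finally show ?thesis .
qed

lemma dim_program_vec: "L \<in> carrier_mat d d \<Longrightarrow> dim_vec (program_vec d L) = d * d"
  by (simp add: program_vec_def kron_def)

section \<open>The one-copy channel\<close>

definition kraus_labels :: "nat \<Rightarrow> (nat \<times> nat) option set" where
  "kraus_labels d = insert None (Some ` ({..<d} \<times> {..<d}))"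

lemma sum_kraus_labels:
  "(\<Sum>x\<in>kraus_labels d. f x) = f None + (\<Sum>a<d. \<Sum>b<d. f (Some (a, b)))" for f :: "_ \<Rightarrow> 'a::comm_monoid_add"
  unfolding kraus_labels_def by (simp add: sum.reindex sum.cartesian_product split_def comp_def image_iff)

text \<open>
  Kraus operators of the one-copy channel at column \<open>|s\<rangle>|p\<rangle>|q\<rangle>\<close>: the label \<open>None\<close> is the jump operator
  \<open>K = (\<delta>\<^sub>i\<^sub>p \<delta>\<^sub>s\<^sub>q)\<close> scaled by \<open>\<surd>(h - d h\<^sup>2/4)\<close>, and \<open>Some (a, b)\<close> is \<open>(I \<otimes> \<langle>a b|)(I - (h/2) K\<^sup>\<dagger>K)\<close>. The
  scaling of the jump operator is forced by trace preservation and \<open>K K\<^sup>\<dagger> = d I\<close>.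
\<close>

definition step_entry :: "nat \<Rightarrow> real \<Rightarrow> (nat \<times> nat) option \<Rightarrow> nat \<Rightarrow> nat \<Rightarrow> nat \<Rightarrow> nat \<Rightarrow> complex" where
  "step_entry d h x i s p q = (case x of
     None \<Rightarrow> if i = p \<and> s = q then complex_of_real (sqrt (h - real d * h\<^sup>2 / 4)) else 0
   | Some (a, b) \<Rightarrow> if a = p then (if i = s \<and> b = q then 1 else 0) - (if i = b \<and> s = q then complex_of_real (h / 2) else 0) else 0)"

definition step_kraus :: "nat \<Rightarrow> real \<Rightarrow> (nat \<times> nat) option \<Rightarrow> nat \<Rightarrow> nat \<Rightarrow> complex" where
  "step_kraus d h x i k = step_entry d h x i (k div (d * d)) (k mod (d * d) div d) (k mod (d * d) mod d)"

text \<open>With G = \<open>K\<^sup>\<dagger>K\<close>, k = h/2 and c the jump scaling, the sum is a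
  matrix element of c^2 G + (1 - k G)^2. Since G^2 = d G, this is 1 + (c^2 - 2k + d k^2) G, and c^2
  = h - d h^2/4 makes the bracket vanish.\<close>

lemma step_entry_isometry:
  assumes h: "0 \<le> h - real d * h\<^sup>2 / 4"
    and less: "s < d" "p < d" "q < d" "s' < d" "p' < d" "q' < d"
  shows "(\<Sum>x\<in>kraus_labels d. \<Sum>i<d. step_entry d h x i s p q * cnj (step_entry d h x i s' p' q')) =
    (if s = s' \<and> p = p' \<and> q = q' then 1 else 0)"
proof -
  let ?c = "complex_of_real (sqrt (h - real d * h\<^sup>2 / 4))" and ?k = "complex_of_real (h / 2)"
  \<comment> \<open>\<open>u\<close> and \<open>w\<close> are the entries of G and of the identity,
    stripped of their common factor [p = p'].\<close>
  define u :: complex where "u = (if s = q \<and> s' = q' then 1 else 0)"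
  define w :: complex where "w = (if s = s' \<and> q = q' then 1 else 0)"
  have cc: "?c * ?c = complex_of_real (h - real d * h\<^sup>2 / 4)"
    unfolding of_real_mult[symmetric] using h by simp
  have "(\<Sum>i<d. step_entry d h None i s p q * cnj (step_entry d h None i s' p' q')) =
    (\<Sum>i<d. if i = p then if p = p' then u * (?c * ?c) else 0 else 0)"
    by (intro sum.cong refl) (auto simp: step_entry_def u_def)
  also have "\<dots> = (if p = p' then u * (?c * ?c) else 0)" using less by simp
  finally have none: "(\<Sum>i<d. step_entry d h None i s p q * cnj (step_entry d h None i s' p' q')) = (if p = p' then u * (?c * ?c) else 0)" .
  have "(\<Sum>a<d. \<Sum>b<d. \<Sum>i<d. step_entry d h (Some (a, b)) i s p q * cnj (step_entry d h (Some (a, b)) i s' p' q')) =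
    (\<Sum>a<d. \<Sum>b<d. \<Sum>i<d. if a = p then if p = p' then
       ((if i = s then if b = q then w else 0 else 0) - (if i = s then if b = q then u * ?k else 0 else 0))
       + ((if i = b then u * (?k * ?k) else 0) - (if i = s' then if b = q' then u * ?k else 0 else 0)) else 0 else 0)"
    by (intro sum.cong refl) (auto simp: step_entry_def u_def w_def algebra_simps)
  also have "\<dots> = (if p = p' then w - u * ?k + (of_nat d * (u * (?k * ?k)) - u * ?k) else 0)"
    using less by (simp add: sum_if_const sum.distrib sum_subtractf)
  finally have some: "(\<Sum>a<d. \<Sum>b<d. \<Sum>i<d. step_entry d h (Some (a, b)) i s p q * cnj (step_entry d h (Some (a, b)) i s' p' q')) =
     (if p = p' then w - u * ?k + (of_nat d * (u * (?k * ?k)) - u * ?k) else 0)" .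
  have "u * (?c * ?c) + (w - u * ?k + (of_nat d * (u * (?k * ?k)) - u * ?k)) = w"
    unfolding cc by (simp add: algebra_simps power2_eq_square)
  then show ?thesis unfolding sum_kraus_labels none some by (auto simp: w_def)
qed

lemma step_kraus_isometry:
  assumes h: "0 \<le> h - real d * h\<^sup>2 / 4" and kl: "k < d * (d * d)" "l < d * (d * d)"
  shows "(\<Sum>x\<in>kraus_labels d. \<Sum>i<d. step_kraus d h x i k * cnj (step_kraus d h x i l)) = (if k = l then 1 else 0)"
proof -
  note dm = div_mod_less[OF kl(1)] div_mod_less[OF kl(2)]
  note dm' = div_mod_less[OF dm(2)] div_mod_less[OF dm(4)]
  have "(k div (d * d) = l div (d * d) \<and> k mod (d * d) div d = l mod (d * d) div d \<and> k mod (d * d) mod d = l mod (d * d) mod d) \<longleftrightarrow> k = l"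
    by (metis div_mult_mod_eq)
  then show ?thesis
    unfolding step_kraus_def step_entry_isometry[OF h dm(1) dm'(1,2) dm(3) dm'(3,4)] by simp
qed

lemma kraus_map_cong:
  assumes "\<And>x i k. x \<in> I \<Longrightarrow> i < n \<Longrightarrow> k < m \<Longrightarrow> a x i k = b x i k"
  shows "kraus_map I a m n X = kraus_map I b m n X"
  by (rule eq_matI) (auto simp: kraus_map_index assms intro!: sum.cong)

lemma kraus_map_single:
  "i < n \<Longrightarrow> j < n \<Longrightarrow> kraus_map {()} a m n X $$ (i, j) = (\<Sum>k<m. \<Sum>l<m. a () i k * X $$ (k, l) * cnj (a () j l))"
  by (simp add: kraus_map_index)

text \<open>The operators acting on S once the program register holds psi: a multiple of L for the
  jump, and L_ab 1 - (h/2) |b><a| L for the outcome (a, b).\<close>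

definition reduced_kraus :: "nat \<Rightarrow> real \<Rightarrow> complex mat \<Rightarrow> (nat \<times> nat) option \<Rightarrow> nat \<Rightarrow> nat \<Rightarrow> complex" where
  "reduced_kraus d h L x i s = (case x of
     None \<Rightarrow> complex_of_real (sqrt (h - real d * h\<^sup>2 / 4)) * L $$ (i, s)
   | Some (a, b) \<Rightarrow> (if i = s then L $$ (a, b) else 0) - (if i = b then complex_of_real (h / 2) * L $$ (a, s) else 0))"

lemma step_kraus_program_vec:
  assumes L: "L \<in> carrier_mat d d" and x: "x \<in> kraus_labels d" and less: "i < d" "s < d"
  shows "(\<Sum>c<d * d. step_kraus d h x i (s * (d * d) + c) * program_vec d L $ c) = reduced_kraus d h L x i s"
proof -
  have "(\<Sum>c<d * d. step_kraus d h x i (s * (d * d) + c) * program_vec d L $ c) =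
    (\<Sum>c<d * d. step_entry d h x i s (c div d) (c mod d) * program_vec d L $ c)"
    using less(1) by (intro sum.cong refl) (cases "d = 0"; simp add: step_kraus_def)
  also have "\<dots> = (\<Sum>p<d. \<Sum>q<d. step_entry d h x i s p q * L $$ (p, q))"
    unfolding sum_lessThan_mult by (intro sum.cong refl) (simp add: program_vec_index[OF L])
  also have "\<dots> = reduced_kraus d h L x i s"
  proof (cases x)
    case None
    have "(\<Sum>p<d. \<Sum>q<d. step_entry d h x i s p q * L $$ (p, q)) =
      (\<Sum>p<d. \<Sum>q<d. if i = p then if s = q then complex_of_real (sqrt (h - real d * h\<^sup>2 / 4)) * L $$ (p, q) else 0 else 0)"
      by (intro sum.cong refl) (simp add: step_entry_def None)
    also have "\<dots> = reduced_kraus d h L x i s" using less by (simp add: sum_if_const reduced_kraus_def None)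
    finally show ?thesis .
  next
    case (Some y)
    obtain a b where y: "y = (a, b)" by (cases y)
    have ab: "a < d" "b < d" using x Some y by (auto simp: kraus_labels_def)
    have "(\<Sum>p<d. \<Sum>q<d. step_entry d h x i s p q * L $$ (p, q)) =
      (\<Sum>p<d. \<Sum>q<d. if a = p then (if b = q then if i = s then L $$ (p, q) else 0 else 0) -
         (if s = q then if i = b then complex_of_real (h / 2) * L $$ (p, q) else 0 else 0) else 0)"
      by (intro sum.cong refl) (simp add: step_entry_def Some y left_diff_distrib)
    also have "\<dots> = reduced_kraus d h L x i s" using less ab
      by (simp add: sum_if_const sum_subtractf reduced_kraus_def Some y)
    finally show ?thesis .
  qed
  finally show ?thesis .
qed

lemma kraus_map_step_kraus:
  assumes L: "L \<in> carrier_mat d d" and X: "X \<in> carrier_mat d d"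
  shows "kraus_map (kraus_labels d) (step_kraus d h) (d * (d * d)) d (kron X (program_state d L)) =
    kraus_map (kraus_labels d) (reduced_kraus d h L) d d X"
  unfolding program_state_def kraus_map_kron_ket_bra[OF X dim_program_vec[OF L]]
  by (rule kraus_map_cong) (rule step_kraus_program_vec[OF L])

section \<open>The Lindbladian and the remainder as combinations of Kraus maps\<close>

definition gram :: "nat \<Rightarrow> complex mat \<Rightarrow> nat \<Rightarrow> nat \<Rightarrow> complex" where
  "gram d L i k = (\<Sum>a<d. cnj (L $$ (a, i)) * L $$ (a, k))"

lemma cnj_gram: "cnj (gram d L i k) = gram d L k i"
  by (simp add: gram_def mult.commute)

lemma lindbladian_index:
  assumes L: "L \<in> carrier_mat d d" and X: "X \<in> carrier_mat d d" and ij: "i < d" "j < d"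
  shows "lindbladian L X $$ (i, j) = (\<Sum>k<d. \<Sum>l<d. L $$ (i, k) * X $$ (k, l) * cnj (L $$ (j, l)))
     - 1 / 2 * ((\<Sum>k<d. gram d L i k * X $$ (k, j)) + (\<Sum>k<d. X $$ (i, k) * gram d L k j))"
proof -
  note La = mat_adjoint_carrier[OF L]
  have LX: "L * X \<in> carrier_mat d d" and G: "mat_adjoint L * L \<in> carrier_mat d d"
    using mult_carrier_mat[OF L X] mult_carrier_mat[OF La L] .
  have GX: "mat_adjoint L * L * X \<in> carrier_mat d d" "X * (mat_adjoint L * L) \<in> carrier_mat d d"
    using mult_carrier_mat[OF G X] mult_carrier_mat[OF X G] .
  have Gi: "(mat_adjoint L * L) $$ (i, k) = gram d L i k" if "i < d" "k < d" for i k
    unfolding mat_mult_index[OF La L that] gram_def using that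
    by (intro sum.cong refl) (simp add: mat_adjoint_index[OF L])
  have 1: "(L * X * mat_adjoint L) $$ (i, j) = (\<Sum>k<d. \<Sum>l<d. L $$ (i, k) * X $$ (k, l) * cnj (L $$ (j, l)))"
  proof -
    have "(L * X * mat_adjoint L) $$ (i, j) = (\<Sum>l<d. \<Sum>k<d. L $$ (i, k) * X $$ (k, l) * cnj (L $$ (j, l)))"
      unfolding mat_mult_index[OF LX La ij] using ij
      by (intro sum.cong refl) (simp add: mat_mult_index[OF L X] mat_adjoint_index[OF L] sum_distrib_right)
    then show ?thesis by (subst sum.swap)
  qed
  have 2: "(mat_adjoint L * L * X) $$ (i, j) = (\<Sum>k<d. gram d L i k * X $$ (k, j))"
    unfolding mat_mult_index[OF G X ij] using ij by (intro sum.cong refl) (simp add: Gi del: index_mult_mat)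
  have 3: "(X * (mat_adjoint L * L)) $$ (i, j) = (\<Sum>k<d. X $$ (i, k) * gram d L k j)"
    unfolding mat_mult_index[OF X G ij] using ij by (intro sum.cong refl) (simp add: Gi del: index_mult_mat)
  have LXL: "L * X * mat_adjoint L \<in> carrier_mat d d" by (rule mult_carrier_mat[OF LX La])
  show ?thesis
    using ij carrier_matD[OF LXL] carrier_matD[OF GX(1)] carrier_matD[OF GX(2)]
    unfolding lindbladian_def anticommutator_def 1[symmetric] 2[symmetric] 3[symmetric]
    by (simp del: index_mult_mat)
qed

lemma lindbladian_carrier:
  assumes L: "L \<in> carrier_mat d d" and X: "X \<in> carrier_mat d d"
  shows "lindbladian L X \<in> carrier_mat d d"
proof -
  note La = mat_adjoint_carrier[OF L]
  have "mat_adjoint L * L * X + X * (mat_adjoint L * L) \<in> carrier_mat d d"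
    by (intro add_carrier_mat mult_carrier_mat[OF X] mult_carrier_mat[OF La L])
  then show ?thesis unfolding lindbladian_def anticommutator_def
    by (intro minus_carrier_mat) simp
qed

text \<open>Writing \<open>G = L\<^sup>\<dagger>L\<close>, the anticommutator is a difference of completely positive maps by
  \<open>{G, X} = (1 + G) X (1 + G) - X - G X G\<close>.\<close>

lemma lindbladian_eq_kraus_maps:
  assumes L: "L \<in> carrier_mat d d" and X: "X \<in> carrier_mat d d"
  shows "lindbladian L X = kraus_map {()} (\<lambda>_ i k. L $$ (i, k)) d d X +
    (complex_of_real (-1/2) \<cdot>\<^sub>m kraus_map {()} (\<lambda>_ i k. (if i = k then 1 else 0) + gram d L i k) d d X +
     complex_of_real (1/2) \<cdot>\<^sub>m (X + kraus_map {()} (\<lambda>_. gram d L) d d X))"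
proof (rule eq_matI)
  fix i j assume "i < dim_row (kraus_map {()} (\<lambda>_ i k. L $$ (i, k)) d d X +
    (complex_of_real (-1/2) \<cdot>\<^sub>m kraus_map {()} (\<lambda>_ i k. (if i = k then 1 else 0) + gram d L i k) d d X +
     complex_of_real (1/2) \<cdot>\<^sub>m (X + kraus_map {()} (\<lambda>_. gram d L) d d X)))"
    "j < dim_col (kraus_map {()} (\<lambda>_ i k. L $$ (i, k)) d d X +
    (complex_of_real (-1/2) \<cdot>\<^sub>m kraus_map {()} (\<lambda>_ i k. (if i = k then 1 else 0) + gram d L i k) d d X +
     complex_of_real (1/2) \<cdot>\<^sub>m (X + kraus_map {()} (\<lambda>_. gram d L) d d X)))"
  then have ij: "i < d" "j < d" by simp_all
  have "kraus_map {()} (\<lambda>_ i k. (if i = k then 1 else 0) + gram d L i k) d d X $$ (i, j) =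
    (\<Sum>k<d. \<Sum>l<d. (if i = k then if j = l then X $$ (k, l) else 0 else 0) + (if j = l then gram d L i k * X $$ (k, l) else 0) +
      (if i = k then X $$ (k, l) * gram d L l j else 0) + gram d L i k * X $$ (k, l) * cnj (gram d L j l))"
    unfolding kraus_map_single[OF ij] by (intro sum.cong refl) (auto simp: algebra_simps cnj_gram)
  also have "\<dots> = X $$ (i, j) + (\<Sum>k<d. gram d L i k * X $$ (k, j)) + (\<Sum>l<d. X $$ (i, l) * gram d L l j) +
     kraus_map {()} (\<lambda>_. gram d L) d d X $$ (i, j)"
    using ij by (simp add: sum.distrib sum_if_const kraus_map_single)
  finally have K: "kraus_map {()} (\<lambda>_ i k. (if i = k then 1 else 0) + gram d L i k) d d X $$ (i, j) =
     X $$ (i, j) + (\<Sum>k<d. gram d L i k * X $$ (k, j)) + (\<Sum>l<d. X $$ (i, l) * gram d L l j) +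
     kraus_map {()} (\<lambda>_. gram d L) d d X $$ (i, j)" .
  have S: "kraus_map {()} (\<lambda>_ i k. L $$ (i, k)) d d X $$ (i, j) = (\<Sum>k<d. \<Sum>l<d. L $$ (i, k) * X $$ (k, l) * cnj (L $$ (j, l)))"
    by (simp add: kraus_map_index[OF ij])
  have R: "(kraus_map {()} (\<lambda>_ i k. L $$ (i, k)) d d X +
    (complex_of_real (-1/2) \<cdot>\<^sub>m kraus_map {()} (\<lambda>_ i k. (if i = k then 1 else 0) + gram d L i k) d d X +
     complex_of_real (1/2) \<cdot>\<^sub>m (X + kraus_map {()} (\<lambda>_. gram d L) d d X))) $$ (i, j) =
     kraus_map {()} (\<lambda>_ i k. L $$ (i, k)) d d X $$ (i, j) +
    (complex_of_real (-1/2) * kraus_map {()} (\<lambda>_ i k. (if i = k then 1 else 0) + gram d L i k) d d X $$ (i, j) +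
     complex_of_real (1/2) * (X $$ (i, j) + kraus_map {()} (\<lambda>_. gram d L) d d X $$ (i, j)))"
    using ij X by simp
  show "lindbladian L X $$ (i, j) = (kraus_map {()} (\<lambda>_ i k. L $$ (i, k)) d d X +
    (complex_of_real (-1/2) \<cdot>\<^sub>m kraus_map {()} (\<lambda>_ i k. (if i = k then 1 else 0) + gram d L i k) d d X +
     complex_of_real (1/2) \<cdot>\<^sub>m (X + kraus_map {()} (\<lambda>_. gram d L) d d X))) $$ (i, j)"
    unfolding R K S lindbladian_index[OF L X ij] by (simp add: field_simps)
qed (use carrier_matD[OF lindbladian_carrier[OF L X]] in simp_all)

text \<open>The operators |b><a| L give the map X -> Tr(L X L^dagger) I. In this form linearity and
  a \<open>cp_bounded\<close> estimate follow from those of Kraus maps.\<close>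

definition remainder :: "nat \<Rightarrow> complex mat \<Rightarrow> superop" where
  "remainder d L X =
     complex_of_real (1/4) \<cdot>\<^sub>m kraus_map ({..<d} \<times> {..<d}) (\<lambda>(a, b) i k. if i = b then L $$ (a, k) else 0) d d X +
     complex_of_real (- real d / 4) \<cdot>\<^sub>m kraus_map {()} (\<lambda>_ i k. L $$ (i, k)) d d X"

text \<open>The sum makes the zeroth-order term of a step exact; the entry bound makes every later
  constant uniform in L.\<close>

lemma hs_norm_one:
  assumes L: "L \<in> carrier_mat d d" and "hs_norm L = 1"
  shows "(\<Sum>a<d. \<Sum>b<d. L $$ (a, b) * cnj (L $$ (a, b))) = 1"
    and "\<And>a b. a < d \<Longrightarrow> b < d \<Longrightarrow> cmod (L $$ (a, b)) \<le> 1"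
proof -
  note La = mat_adjoint_carrier[OF L]
  have "trace (mat_adjoint L * L) = (\<Sum>b<d. \<Sum>a<d. L $$ (a, b) * cnj (L $$ (a, b)))"
    unfolding trace_carrier[OF mult_carrier_mat[OF La L]]
    by (intro sum.cong refl) (simp add: mat_mult_index[OF La L] mat_adjoint_index[OF L] mult.commute del: index_mult_mat)
  also have "\<dots> = (\<Sum>a<d. \<Sum>b<d. L $$ (a, b) * cnj (L $$ (a, b)))" by (rule sum.swap)
  also have "\<dots> = complex_of_real (\<Sum>a<d. \<Sum>b<d. (cmod (L $$ (a, b)))\<^sup>2)"
    by (simp only: complex_norm_square of_real_sum)
  finally have tr: "trace (mat_adjoint L * L) = complex_of_real (\<Sum>a<d. \<Sum>b<d. (cmod (L $$ (a, b)))\<^sup>2)" .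
  have "sqrt (\<Sum>a<d. \<Sum>b<d. (cmod (L $$ (a, b)))\<^sup>2) = 1"
    using assms(2) unfolding hs_norm_def tr by simp
  then have one: "(\<Sum>a<d. \<Sum>b<d. (cmod (L $$ (a, b)))\<^sup>2) = 1" by simp
  have "(\<Sum>a<d. \<Sum>b<d. L $$ (a, b) * cnj (L $$ (a, b))) = complex_of_real (\<Sum>a<d. \<Sum>b<d. (cmod (L $$ (a, b)))\<^sup>2)"
    by (simp only: complex_norm_square of_real_sum)
  then show "(\<Sum>a<d. \<Sum>b<d. L $$ (a, b) * cnj (L $$ (a, b))) = 1" unfolding one by simp
  fix a b assume ab: "a < d" "b < d"
  have "(cmod (L $$ (a, b)))\<^sup>2 \<le> (\<Sum>b<d. (cmod (L $$ (a, b)))\<^sup>2)"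
    using ab by (intro member_le_sum) auto
  also have "\<dots> \<le> (\<Sum>a<d. \<Sum>b<d. (cmod (L $$ (a, b)))\<^sup>2)"
    using ab by (intro member_le_sum[of a "{..<d}" "\<lambda>a. \<Sum>b<d. (cmod (L $$ (a, b)))\<^sup>2"]) (auto intro: sum_nonneg)
  finally have "(cmod (L $$ (a, b)))\<^sup>2 \<le> 1\<^sup>2" unfolding one by simp
  then show "cmod (L $$ (a, b)) \<le> 1" by (rule power2_le_imp_le) simp
qed

lemma trace_program_state:
  assumes L: "L \<in> carrier_mat d d" and "hs_norm L = 1"
  shows "trace (program_state d L) = 1"
proof -
  have "trace (program_state d L) = (\<Sum>c<d * d. program_vec d L $ c * cnj (program_vec d L $ c))"
    by (simp add: trace_def program_state_def ket_bra_def dim_program_vec[OF L])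
  also have "\<dots> = (\<Sum>a<d. \<Sum>b<d. L $$ (a, b) * cnj (L $$ (a, b)))"
    unfolding sum_lessThan_mult by (intro sum.cong refl) (simp add: program_vec_index[OF L])
  finally show ?thesis using hs_norm_one(1)[OF assms] by simp
qed

lemma program_state_carrier: "L \<in> carrier_mat d d \<Longrightarrow> program_state d L \<in> carrier_mat (d * d) (d * d)"
  by (simp add: program_state_def ket_bra_def dim_program_vec)

text \<open>The jump contributes (h - d h^2/4) L X L^dagger and the outcomes (a, b) together X -
  (h/2)(G X + X G) + (h^2/4) Tr(L X L^dagger) I, where G = L^dagger L. The correction of the jump
  weight is the negative term of the remainder.\<close>

lemma reduced_kraus_taylor_step:
  assumes L: "L \<in> carrier_mat d d" and hs: "hs_norm L = 1" and X: "X \<in> carrier_mat d d"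
    and h: "0 \<le> h - real d * h\<^sup>2 / 4"
  shows "taylor_step (lindbladian L) (remainder d L) h X = kraus_map (kraus_labels d) (reduced_kraus d h L) d d X"
proof (rule eq_matI)
  note lc = lindbladian_carrier[OF L X]
  have rc: "remainder d L X \<in> carrier_mat d d" by (simp add: remainder_def)
  show "dim_row (taylor_step (lindbladian L) (remainder d L) h X) = dim_row (kraus_map (kraus_labels d) (reduced_kraus d h L) d d X)"
   "dim_col (taylor_step (lindbladian L) (remainder d L) h X) = dim_col (kraus_map (kraus_labels d) (reduced_kraus d h L) d d X)"
    using carrier_matD[OF rc] by (simp_all add: taylor_step_def)
  fix i j assume "i < dim_row (kraus_map (kraus_labels d) (reduced_kraus d h L) d d X)" "j < dim_col (kraus_map (kraus_labels d) (reduced_kraus d h L) d d X)"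
  then have ij: "i < d" "j < d" by simp_all
  let ?c = "complex_of_real (sqrt (h - real d * h\<^sup>2 / 4))"
  define kk where "kk = complex_of_real (h / 2)"
  have ckk: "cnj kk = kk" by (simp add: kk_def)
  \<comment> \<open>\<open>S\<close>, \<open>P\<close>, \<open>GX\<close> and \<open>XG\<close> are
    the entries at (i, j) of L X L^dagger, Tr(L X L^dagger) I, G X and X G.\<close>
  define S where "S = (\<Sum>k<d. \<Sum>l<d. L $$ (i, k) * X $$ (k, l) * cnj (L $$ (j, l)))"
  define P where "P = (if i = j then \<Sum>a<d. \<Sum>k<d. \<Sum>l<d. L $$ (a, k) * X $$ (k, l) * cnj (L $$ (a, l)) else 0)"
  define GX where "GX = (\<Sum>k<d. gram d L i k * X $$ (k, j))"
  define XG where "XG = (\<Sum>k<d. X $$ (i, k) * gram d L k j)"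
  have cc: "?c * ?c = complex_of_real (h - real d * h\<^sup>2 / 4)"
    unfolding of_real_mult[symmetric] using h by simp
  have none: "(\<Sum>k<d. \<Sum>l<d. reduced_kraus d h L None i k * X $$ (k, l) * cnj (reduced_kraus d h L None j l)) = ?c * ?c * S"
    unfolding S_def sum_distrib_left by (intro sum.cong refl) (simp add: reduced_kraus_def)
  have "(\<Sum>a<d. \<Sum>b<d. \<Sum>k<d. \<Sum>l<d. reduced_kraus d h L (Some (a, b)) i k * X $$ (k, l) * cnj (reduced_kraus d h L (Some (a, b)) j l)) =
    (\<Sum>a<d. \<Sum>b<d. \<Sum>k<d. \<Sum>l<d.
      (if i = k then if j = l then X $$ (k, l) * (L $$ (a, b) * cnj (L $$ (a, b))) else 0 else 0) -
      (if i = k then if j = b then kk * (L $$ (a, b) * X $$ (k, l) * cnj (L $$ (a, l))) else 0 else 0) -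
      (if j = l then if i = b then kk * (L $$ (a, k) * X $$ (k, l) * cnj (L $$ (a, b))) else 0 else 0) +
      (if i = b then if j = b then kk * kk * (L $$ (a, k) * X $$ (k, l) * cnj (L $$ (a, l))) else 0 else 0))"
    by (intro sum.cong refl) (simp add: reduced_kraus_def kk_def[symmetric] ckk algebra_simps del: of_real_divide)
  also have "\<dots> = X $$ (i, j) * (\<Sum>a<d. \<Sum>b<d. L $$ (a, b) * cnj (L $$ (a, b)))
     - kk * (\<Sum>a<d. \<Sum>l<d. L $$ (a, j) * X $$ (i, l) * cnj (L $$ (a, l)))
     - kk * (\<Sum>a<d. \<Sum>k<d. L $$ (a, k) * X $$ (k, j) * cnj (L $$ (a, i))) + kk * kk * P"
    using ij by (cases "i = j") (simp_all add: sum.distrib sum_subtractf sum_if_const sum_distrib_left P_def)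
  also have "(\<Sum>a<d. \<Sum>l<d. L $$ (a, j) * X $$ (i, l) * cnj (L $$ (a, l))) = XG"
    unfolding XG_def gram_def sum_distrib_left by (subst sum.swap) (simp add: mult_ac)
  also have "(\<Sum>a<d. \<Sum>k<d. L $$ (a, k) * X $$ (k, j) * cnj (L $$ (a, i))) = GX"
    unfolding GX_def gram_def sum_distrib_right by (subst sum.swap) (simp add: mult_ac)
  finally have some: "(\<Sum>a<d. \<Sum>b<d. \<Sum>k<d. \<Sum>l<d. reduced_kraus d h L (Some (a, b)) i k * X $$ (k, l) * cnj (reduced_kraus d h L (Some (a, b)) j l)) =
    X $$ (i, j) - kk * XG - kk * GX + kk * kk * P"
    by (simp add: hs_norm_one(1)[OF L hs])
  have "kraus_map ({..<d} \<times> {..<d}) (\<lambda>(a, b) i k. if i = b then L $$ (a, k) else 0) d d X $$ (i, j) =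
    (\<Sum>a<d. \<Sum>b<d. \<Sum>k<d. \<Sum>l<d. if i = b then if j = b then L $$ (a, k) * X $$ (k, l) * cnj (L $$ (a, l)) else 0 else 0)"
    unfolding kraus_map_index[OF ij] sum.cartesian_product' by (intro sum.cong refl) auto
  also have "\<dots> = P" using ij by (simp add: sum_if_const P_def)
  finally have Pe: "kraus_map ({..<d} \<times> {..<d}) (\<lambda>(a, b) i k. if i = b then L $$ (a, k) else 0) d d X $$ (i, j) = P" .
  have Se: "kraus_map {()} (\<lambda>_ i k. L $$ (i, k)) d d X $$ (i, j) = S"
    by (simp add: kraus_map_index[OF ij] S_def)
  have R: "remainder d L X $$ (i, j) = complex_of_real (1/4) * P + complex_of_real (- real d / 4) * S"
    using ij by (simp add: remainder_def Pe Se)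
  have Li: "lindbladian L X $$ (i, j) = S - 1 / 2 * (GX + XG)"
    unfolding lindbladian_index[OF L X ij] S_def GX_def XG_def ..
  have "taylor_step (lindbladian L) (remainder d L) h X $$ (i, j) =
    X $$ (i, j) + (complex_of_real h * lindbladian L X $$ (i, j) + complex_of_real (h\<^sup>2) * remainder d L X $$ (i, j))"
    using ij carrier_matD[OF rc] carrier_matD[OF lc] carrier_matD[OF X] by (simp add: taylor_step_def)
  also have "\<dots> = complex_of_real (h - real d * h\<^sup>2 / 4) * S + (X $$ (i, j) - kk * XG - kk * GX + kk * kk * P)"
    unfolding R Li by (simp add: kk_def field_simps power2_eq_square)
  also have "\<dots> = kraus_map (kraus_labels d) (reduced_kraus d h L) d d X $$ (i, j)"
    unfolding kraus_map_index[OF ij] sum_kraus_labels none some cc ..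
  finally show "taylor_step (lindbladian L) (remainder d L) h X $$ (i, j) = kraus_map (kraus_labels d) (reduced_kraus d h L) d d X $$ (i, j)" .
qed

section \<open>The algorithm and its error\<close>

text \<open>The Kraus map is applied first: it acts on S and the first copy, discards that copy and
  leaves S with n copies for the recursion. Dimensions are grouped as (S (x) copy) (x) rest to fit
  \<open>right_ampliation\<close>.\<close>

primrec program_channel :: "nat \<Rightarrow> real \<Rightarrow> nat \<Rightarrow> superop" where
  "program_channel d h 0 = (\<lambda>X. X)"
| "program_channel d h (Suc n) = program_channel d h n \<circ>
     kraus_map (kraus_labels d) (right_ampliation ((d * d) ^ n) (step_kraus d h)) (d * (d * d) * (d * d) ^ n) (d * (d * d) ^ n)"

lemma quantum_channel_program_channel:
  assumes "0 \<le> h - real d * h\<^sup>2 / 4"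
  shows "quantum_channel (d * (d * d) ^ n) d (program_channel d h n)"
proof (induction n)
  case 0
  then show ?case by (simp add: quantum_channel_id)
next
  case (Suc n)
  have "quantum_channel (d * (d * d) * (d * d) ^ n) d (program_channel d h (Suc n))"
    unfolding program_channel.simps
    by (intro quantum_channel_comp[OF _ Suc] quantum_channel_kraus_map right_ampliation_isometry step_kraus_isometry assms)
  then show ?case by (simp only: power_Suc mult.assoc)
qed

lemma program_channel_program_state:
  assumes L: "L \<in> carrier_mat d d" and hs: "hs_norm L = 1" and h: "0 \<le> h - real d * h\<^sup>2 / 4"
  shows "X \<in> carrier_mat d d \<Longrightarrow> program_channel d h n (kron X (kron_pow (program_state d L) n)) =
    (taylor_step (lindbladian L) (remainder d L) h ^^ n) X"
proof (induction n arbitrary: X)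
  case 0
  then show ?case by (simp add: kron_one[unfolded One_nat_def])
next
  case (Suc n)
  let ?T = "taylor_step (lindbladian L) (remainder d L) h"
  note P = program_state_carrier[OF L]
  have step: "kraus_map (kraus_labels d) (step_kraus d h) (d * (d * d)) d (kron X (program_state d L)) = ?T X"
    by (simp only: kraus_map_step_kraus[OF L Suc.prems] reduced_kraus_taylor_step[OF L hs Suc.prems h])
  have T: "?T X \<in> carrier_mat d d" by (simp only: step[symmetric] kraus_map_carrier)
  have "program_channel d h (Suc n) (kron X (kron_pow (program_state d L) (Suc n))) =
    program_channel d h n (kron (?T X) (kron_pow (program_state d L) n))"
    by (simp only: program_channel.simps o_apply kron_pow.simps kron_assoc[OF Suc.prems P kron_pow_carrier[OF P]]
      kraus_map_right_ampliation[OF kron_carrier[OF Suc.prems P] kron_pow_carrier[OF P]] step)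
  also have "\<dots> = (?T ^^ n) (?T X)" by (rule Suc.IH[OF T])
  also have "\<dots> = (?T ^^ Suc n) X" by (simp only: funpow_Suc_right o_apply)
  finally show ?case .
qed

text \<open>Complete positivity is visible from the Kraus form. Trace preservation is inherited from
  the channel on S with a copy attached, since Tr psi = 1.\<close>

lemma quantum_channel_taylor_step:
  assumes L: "L \<in> carrier_mat d d" and hs: "hs_norm L = 1" and h: "0 \<le> h - real d * h\<^sup>2 / 4"
  shows "quantum_channel d d (taylor_step (lindbladian L) (remainder d L) h)"
proof (rule quantum_channel_cong[OF _ reduced_kraus_taylor_step[OF L hs _ h]])
  have "trace_preserving d (kraus_map (kraus_labels d) (reduced_kraus d h L) d d)"
    unfolding trace_preserving_def
  proof
    fix X :: "complex mat" assume X: "X \<in> carrier_mat d d"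
    note P = program_state_carrier[OF L]
    have "trace (kraus_map (kraus_labels d) (reduced_kraus d h L) d d X) = trace (kron X (program_state d L))"
      using quantum_channel_kraus_map[OF step_kraus_isometry[OF h]] kron_carrier[OF X P]
      unfolding kraus_map_step_kraus[OF L X, symmetric] quantum_channel_def trace_preserving_def by blast
    then show "trace (kraus_map (kraus_labels d) (reduced_kraus d h L) d d X) = trace X"
      by (simp add: trace_kron[OF X P] trace_program_state[OF L hs])
  qed
  then show "quantum_channel d d (kraus_map (kraus_labels d) (reduced_kraus d h L) d d)"
    by (simp add: quantum_channel_def linear_kraus_map completely_positive_kraus_map)
qed

section \<open>Bounds uniform in L\<close>

lemma linear_lindbladian:
  assumes L: "L \<in> carrier_mat d d" shows "linear_superop d d (lindbladian L)"
  by (rule linear_superop_cong[OF _ lindbladian_eq_kraus_maps[OF L]])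
    (intro linear_superop_add linear_superop_smult linear_kraus_map linear_superop_id)

lemma linear_remainder: "linear_superop d d (remainder d L)"
  unfolding remainder_def by (intro linear_superop_add linear_superop_smult linear_kraus_map)

lemma norm_gram_le:
  assumes L: "L \<in> carrier_mat d d" and hs: "hs_norm L = 1" and "i < d" "k < d"
  shows "cmod (gram d L i k) \<le> real d"
proof -
  have "cmod (gram d L i k) \<le> (\<Sum>a<d. 1)" unfolding gram_def
  proof (rule sum_norm_le)
    fix a assume "a \<in> {..<d}"
    then show "cmod (cnj (L $$ (a, i)) * L $$ (a, k)) \<le> 1"
      using mult_mono[OF hs_norm_one(2)[OF L hs, of a i] hs_norm_one(2)[OF L hs, of a k]] assms(3,4)
      by (simp add: norm_mult)
  qed
  then show ?thesis by simp
qed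

text \<open>d^3 b^2 for each single-operator map, with entry bounds b = 1 for L, 1 + d for 1 + G and
  d for G; the identity map has bound 1. The weights 1 and 1/2 are those of
  \<open>lindbladian_eq_kraus_maps\<close>.\<close>

definition generator_bound :: "nat \<Rightarrow> real" where
  "generator_bound d = real d ^ 3 + (real d ^ 3 * (1 + real d)\<^sup>2 / 2 + (1 + real d ^ 3 * (real d)\<^sup>2) / 2)"

text \<open>d^2 operators with entries at most 1 at weight 1/4, and the map of L at weight
  d/4.\<close>

definition remainder_bound :: "nat \<Rightarrow> real" where
  "remainder_bound d = (real d)\<^sup>2 * real d ^ 3 / 4 + real d / 4 * real d ^ 3"

lemma cp_bounded_single_kraus:
  assumes "\<And>i k. i < d \<Longrightarrow> k < d \<Longrightarrow> cmod (f i k) \<le> b" "0 \<le> b"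
  shows "cp_bounded d (kraus_map {()} (\<lambda>_. f) d d) (real d ^ 3 * b\<^sup>2)"
  using cp_bounded_kraus_map[of "{()}" d "\<lambda>_. f" b] assms by simp

lemma cp_bounded_lindbladian:
  assumes L: "L \<in> carrier_mat d d" and hs: "hs_norm L = 1"
  shows "cp_bounded d (lindbladian L) (generator_bound d)"
proof (rule cp_bounded_cong[OF _ lindbladian_eq_kraus_maps[OF L]])
  let ?K = "\<lambda>f b. cp_bounded d (kraus_map {()} (\<lambda>_. f) d d) (real d ^ 3 * b\<^sup>2)"
  have 1: "?K (\<lambda>i k. L $$ (i, k)) 1" by (rule cp_bounded_single_kraus) (simp_all add: hs_norm_one(2)[OF L hs])
  have 2: "?K (gram d L) (real d)" by (rule cp_bounded_single_kraus) (simp_all add: norm_gram_le[OF L hs])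
  have 3: "?K (\<lambda>i k. (if i = k then 1 else 0) + gram d L i k) (1 + real d)"
  proof (rule cp_bounded_single_kraus)
    fix i k assume "i < d" "k < d"
    then show "cmod ((if i = k then 1 else 0) + gram d L i k) \<le> 1 + real d"
      by (intro norm_triangle_le add_mono norm_gram_le[OF L hs]) auto
  qed simp
  have "cp_bounded d (\<lambda>X. kraus_map {()} (\<lambda>_ i k. L $$ (i, k)) d d X +
    (complex_of_real (-1/2) \<cdot>\<^sub>m kraus_map {()} (\<lambda>_ i k. (if i = k then 1 else 0) + gram d L i k) d d X +
     complex_of_real (1/2) \<cdot>\<^sub>m (X + kraus_map {()} (\<lambda>_. gram d L) d d X)))
    (real d ^ 3 * 1\<^sup>2 + (\<bar>-1/2\<bar> * (real d ^ 3 * (1 + real d)\<^sup>2) + \<bar>1/2\<bar> * (1 + real d ^ 3 * (real d)\<^sup>2)))"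
    by (intro cp_bounded_add cp_bounded_smult cp_bounded_id 1 2 3)
  then show "cp_bounded d (\<lambda>X. kraus_map {()} (\<lambda>_ i k. L $$ (i, k)) d d X +
    (complex_of_real (-1/2) \<cdot>\<^sub>m kraus_map {()} (\<lambda>_ i k. (if i = k then 1 else 0) + gram d L i k) d d X +
     complex_of_real (1/2) \<cdot>\<^sub>m (X + kraus_map {()} (\<lambda>_. gram d L) d d X))) (generator_bound d)"
    by (rule cp_bounded_mono) (simp add: generator_bound_def)
qed

lemma cp_bounded_remainder:
  assumes L: "L \<in> carrier_mat d d" and hs: "hs_norm L = 1"
  shows "cp_bounded d (remainder d L) (remainder_bound d)"
proof -
  have 1: "cp_bounded d (kraus_map {()} (\<lambda>_ i k. L $$ (i, k)) d d) (real d ^ 3 * 1\<^sup>2)"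
    by (rule cp_bounded_single_kraus) (simp_all add: hs_norm_one(2)[OF L hs])
  have 2: "cp_bounded d (kraus_map ({..<d} \<times> {..<d}) (\<lambda>(a, b) i k. if i = b then L $$ (a, k) else 0) d d)
    (real (card ({..<d} \<times> {..<d})) * real d ^ 3 * 1\<^sup>2)"
    by (rule cp_bounded_kraus_map) (auto simp: hs_norm_one(2)[OF L hs])
  have "cp_bounded d (remainder d L) (\<bar>1/4\<bar> * (real (card ({..<d} \<times> {..<d})) * real d ^ 3 * 1\<^sup>2) + \<bar>- real d / 4\<bar> * (real d ^ 3 * 1\<^sup>2))"
    unfolding remainder_def by (intro cp_bounded_add cp_bounded_smult 1 2)
  then show ?thesis
    by (rule cp_bounded_mono) (simp add: remainder_bound_def power2_eq_square)
qed

lemma exp_superop_zero: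
  assumes "X \<in> carrier_mat d d" shows "exp_superop d \<Phi> 0 X = X"
proof (rule eq_matI)
  fix i j assume "i < dim_row X" "j < dim_col X"
  then have ij: "i < d" "j < d" using assms by auto
  \<comment> \<open>As \<open>0 ^ 0 = 1\<close>, exactly the term k = 0 survives.\<close>
  have "(\<Sum>k. complex_of_real (0 ^ k / fact k) * (\<Phi> ^^ k) X $$ (i, j)) =
    (\<Sum>k\<in>{0}. complex_of_real (0 ^ k / fact k) * (\<Phi> ^^ k) X $$ (i, j))"
    by (rule suminf_finite) auto
  then show "exp_superop d \<Phi> 0 X $$ (i, j) = X $$ (i, j)" using ij by (simp add: exp_superop_def)
qed (use assms in \<open>auto simp: exp_superop_def\<close>)

theorem theorem1:
  fixes d :: nat
  assumes "d \<ge> 1"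
  shows "\<exists>C::real. C > 0 \<and>
    (\<forall>(t::real) (\<epsilon>::real). 0 \<le> t \<longrightarrow> 0 < \<epsilon> \<longrightarrow> \<epsilon> < 1 \<longrightarrow>
      (\<exists>(n::nat) (\<Lambda>::superop).
         (0 < t \<longrightarrow> 0 < n) \<and> int n \<le> \<lceil>C * t ^ 2 / \<epsilon>\<rceil> \<and>
         quantum_channel (d * (d * d) ^ n) d \<Lambda> \<and>
         (\<forall>L \<in> carrier_mat d d. hs_norm L = 1 \<longrightarrow>
            ereal (1 / 2) * diamond_dist d
              (exp_superop d (lindbladian L) t)
              (\<lambda>\<rho>. \<Lambda> (kron \<rho> (kron_pow (program_state d L) n)))
            \<le> ereal \<epsilon>)))"
proof -
  define \<alpha> where "\<alpha> = generator_bound d"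
  define r where "r = remainder_bound d"
  have nn: "0 \<le> \<alpha>" "0 \<le> r" by (simp_all add: \<alpha>_def r_def generator_bound_def remainder_bound_def)
  \<comment> \<open>The single condition h b <= 1 yields everything asked of the step size: h <= 1,
    h (\<alpha> + r) <= 1 and h d <= 1, the last making the jump weight nonnegative.\<close>
  define b where "b = \<alpha> + r + real d"
  \<comment> \<open>The error of one step against its refinement is at most K h^2.\<close>
  define K where "K = (\<alpha> + r)\<^sup>2 + r"
  \<comment> \<open>The summand \<open>b\<^sup>2\<close> makes n large enough for h b <= 1, the
    summand K makes the total error K t^2 / n at most \<epsilon>.\<close>
  define C where "C = b\<^sup>2 + K"
  have b1: "1 \<le> b" using nn assms by (simp add: b_def)
  have K0: "0 \<le> K" using nn by (simp add: K_def)
  have C0: "0 < C" and Cb: "b\<^sup>2 \<le> C" and CK: "K \<le> C"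
    using K0 b1 by (simp_all add: C_def add_pos_nonneg)
  show ?thesis
  proof (intro exI[of _ C] conjI C0 allI impI)
    fix t \<epsilon> :: real
    assume t: "0 \<le> t" and \<epsilon>: "0 < \<epsilon>" "\<epsilon> < 1"
    \<comment> \<open>The factor 1/2 is given away: the distance itself will be at most
      \<epsilon>.\<close>
    have half: "ereal (1 / 2) * D \<le> ereal \<epsilon>" if "D \<le> ereal \<epsilon>" for D
    proof -
      have "ereal (1 / 2) * D \<le> ereal (1 / 2) * ereal \<epsilon>" using that by (intro ereal_mult_left_mono) auto
      also have "\<dots> \<le> ereal \<epsilon>" using \<epsilon> by simp
      finally show ?thesis .
    qed
    show "\<exists>n \<Lambda>. (0 < t \<longrightarrow> 0 < n) \<and> int n \<le> \<lceil>C * t ^ 2 / \<epsilon>\<rceil> \<and>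
         quantum_channel (d * (d * d) ^ n) d \<Lambda> \<and>
         (\<forall>L \<in> carrier_mat d d. hs_norm L = 1 \<longrightarrow>
            ereal (1 / 2) * diamond_dist d (exp_superop d (lindbladian L) t)
              (\<lambda>\<rho>. \<Lambda> (kron \<rho> (kron_pow (program_state d L) n))) \<le> ereal \<epsilon>)"
    proof (cases "t = 0")
      \<comment> \<open>At t = 0 the bound on n is 0, so no copy may be used; the identity channel
        on S is exact.\<close>
      case True
      have "diamond_dist d (exp_superop d (lindbladian L) t) (\<lambda>\<rho>. \<rho>) \<le> ereal 0" for L
      proof (rule diamond_dist_le_limit)
        show "cp_bounded d (\<lambda>X. X - X) 0"
        proof (rule cp_bounded_cong)
          show "cp_bounded d (\<lambda>X. complex_of_real 0 \<cdot>\<^sub>m X) 0"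
            using cp_bounded_smult[OF cp_bounded_id, of d 0] by simp
        qed (auto intro!: eq_matI)
      qed (simp_all add: True exp_superop_zero)
      then have "diamond_dist d (exp_superop d (lindbladian L) t) (\<lambda>\<rho>. kron \<rho> (kron_pow (program_state d L) 0)) \<le> ereal 0" for L
        using diamond_dist_cong[of d "\<lambda>\<rho>. kron \<rho> (kron_pow (program_state d L) 0)" "\<lambda>\<rho>. \<rho>"] by (simp add: kron_one[unfolded One_nat_def])
      then have "ereal (1 / 2) * diamond_dist d (exp_superop d (lindbladian L) t) (\<lambda>\<rho>. kron \<rho> (kron_pow (program_state d L) 0)) \<le> ereal \<epsilon>" for L
        by (rule half[OF order_trans]) (use \<epsilon> in simp)
      then show ?thesis using True quantum_channel_id
        by (intro exI[of _ 0] exI[of _ "\<lambda>X. X"]) simp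
    next
      case False
      then have t0: "0 < t" using t by simp
      \<comment> \<open>The largest number of copies allowed. It is positive since t > 0.\<close>
      define n where "n = nat \<lceil>C * t\<^sup>2 / \<epsilon>\<rceil>"
      have pos: "0 < C * t\<^sup>2 / \<epsilon>" using C0 t0 \<epsilon> by simp
      have n_int: "int n = \<lceil>C * t\<^sup>2 / \<epsilon>\<rceil>" using pos by (simp add: n_def)
      have n0: "0 < n" using pos by (simp add: n_def)
      have n_ge: "C * t\<^sup>2 / \<epsilon> \<le> real n"
        using le_of_int_ceiling[of "C * t\<^sup>2 / \<epsilon>"] by (simp add: n_int[symmetric])
      define h where "h = t / real n"
      have h0: "0 \<le> h" and nh: "real n * h = t" using t n0 by (simp_all add: h_def)
      \<comment> \<open>Dividing by \<epsilon> < 1 only enlarges C t^2, and n <= n^2 for n >= 1, so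
        (b t)^2 <= n^2 holds for small and large t alike.\<close>
      have "(b * t)\<^sup>2 \<le> C * t\<^sup>2" using Cb by (simp add: power_mult_distrib mult_right_mono)
      also have "\<dots> \<le> C * t\<^sup>2 / \<epsilon>" using \<epsilon> C0 by (simp add: le_divide_eq mult_left_le)
      also have "\<dots> \<le> real n" by (rule n_ge)
      also have "\<dots> \<le> (real n)\<^sup>2" using n0 by (simp add: power2_eq_square)
      finally have "b * t \<le> real n" by (rule power2_le_imp_le) simp
      then have hb: "h * b \<le> 1" using n0 by (simp add: h_def mult.commute)
      have h1: "h \<le> 1" using order_trans[OF mult_left_mono[OF b1 h0] hb] by simp
      have ha: "h * (\<alpha> + r) \<le> 1"
        using order_trans[OF mult_left_mono[of "\<alpha> + r" b h] hb] h0 by (simp add: b_def)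
      have hd: "h * real d \<le> 1"
        using order_trans[OF mult_left_mono[of "real d" b h] hb] h0 nn by (simp add: b_def)
      \<comment> \<open>Stated for every s up to h, because the refined steps in the error estimate
        have to be channels as well.\<close>
      have sd: "0 \<le> s - real d * s\<^sup>2 / 4" if "0 \<le> s" "s \<le> h" for s
      proof -
        have "s * real d \<le> 4" using mult_right_mono[OF that(2), of "real d"] hd by simp
        then have "s * (s * real d) \<le> s * 4" using that(1) by (rule mult_left_mono)
        then show ?thesis by (simp add: power2_eq_square algebra_simps)
      qed
      have err: "real n * (K * h\<^sup>2) \<le> \<epsilon>"
      proof -
        have "real n * (K * h\<^sup>2) = K * t\<^sup>2 / real n" using n0 by (simp add: h_def power2_eq_square)
        also have "\<dots> \<le> C * t\<^sup>2 / real n" using CK by (intro divide_right_mono mult_right_mono) auto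
        also have "\<dots> \<le> \<epsilon>" using n_ge n0 \<epsilon> by (simp add: divide_le_eq mult.commute)
        finally show ?thesis .
      qed
      have main: "ereal (1 / 2) * diamond_dist d (exp_superop d (lindbladian L) t)
              (\<lambda>\<rho>. program_channel d h n (kron \<rho> (kron_pow (program_state d L) n))) \<le> ereal \<epsilon>"
        if L: "L \<in> carrier_mat d d" and hs: "hs_norm L = 1" for L
      proof -
        have "diamond_dist d (exp_superop d (lindbladian L) t) (\<lambda>\<rho>. program_channel d h n (kron \<rho> (kron_pow (program_state d L) n))) =
          diamond_dist d (exp_superop d (lindbladian L) (real n * h)) (taylor_step (lindbladian L) (remainder d L) h ^^ n)"
          unfolding nh by (rule diamond_dist_cong) (rule program_channel_program_state[OF L hs sd[OF h0 order_refl]])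
        also have "\<dots> \<le> ereal (real n * (K * h\<^sup>2))"
          unfolding K_def \<alpha>_def r_def
          by (intro diamond_dist_exp_superop_taylor_step linear_lindbladian linear_remainder cp_bounded_lindbladian
            cp_bounded_remainder quantum_channel_taylor_step L hs h0 h1 n0 sd ha[unfolded \<alpha>_def r_def])
        also have "\<dots> \<le> ereal \<epsilon>" using err by simp
        finally show ?thesis by (rule half)
      qed
      show ?thesis
        using n0 n_int quantum_channel_program_channel[OF sd[OF h0 order_refl], of n] main
        by (intro exI[of _ n] exI[of _ "program_channel d h n"]) auto
    qed
  qed
qed

end
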